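(* Let $E$ be an infinite-dimensional separable real Hilbert space, let $\lambda:\mathcal R\to[0,+\infty)$ be the shift- and rotation-invariant finitely additive measure on $E$ described in the context, and let $\mathbb H=L_2(E,\mathcal R,\lambda,\mathbb C)$. Then $$\mathbb H=\bigoplus_{\{\mathcal E\}\in\Sigma}\mathcal H_{\{\mathcal E\}}\qquad\text{(orthogonal Hilbert sum)},$$ where $\Sigma$ is the set of equivalence classes of orthonormal bases of $E$ and $\mathcal H_{\{\mathcal E\}}=L_2(E,\mathcal R_{\mathcal E},\lambda_{\mathcal E},\mathbb C)$ is regarded as a closed subspace of $\mathbb H$ (via $\chi_A\mapsto\chi_A$, $A\in\mathcal R_{\mathcal E}$).
   Context: A ring of sets is a nonempty family closed under finite unions and differences; a measure on a ring is a finitely additive nonnegative function. For an orthonormal basis (ONB) $\mathcal E=\{e_j\}_{j\in\mathbb N}$ of $E$, $\mathcal K_{\mathcal E}$ denotes the collection consisting of $\varnothing$ and of all nonempty sets $\Pi=\{x\in E:\ (x,e_j)\in[a_j,b_j)\ \forall j\in\mathbb N\}$ with $a,b\in\ell_\infty$ and $\sum_{j}\max\{0,\ln(b_j-a_j)\}<\infty$. Put $\lambda_{\mathcal E}(\varnothing)=0$ and $\lambda_{\mathcal E}(\Pi)=\exp\bigl[\sum_{j}\ln(b_j-a_j)\bigr]$ (equal to $0$ if the sum is $-\infty$). It is known that $\lambda_{\mathcal E}$ extends uniquely to a finitely additive shift-invariant measure on the ring $r_{\mathcal E}$ generated by $\mathcal K_{\mathcal E}$. $\mathcal R_{\mathcal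 E}$ is the ring of all $A\subset E$ such that for every $\epsilon>0$ there are $A_*,A^*\in r_{\mathcal E}$ with $A_*\subset A\subset A^*$ and $\lambda_{\mathcal E}(A^*\setminus A_* )<\epsilon$, and $\lambda_{\mathcal E}(A)=\inf\{\lambda_{\mathcal E}(A^* ):A^*\in r_{\mathcal E},A^*\supset A\}$ for $A\in\mathcal R_{\mathcal E}$. ONB $\mathcal E=\{e_i\}$, $\mathcal F=\{f_j\}$ are equivalent, $\mathcal E\sim\mathcal F$, if $\prod_{j}\bigl(\sum_{i}|(e_i,f_j)|\bigr)<+\infty$; this is an equivalence relation, equivalent bases have the same $\mathcal R_{\mathcal E}$ and $\lambda_{\mathcal E}$, and $\Sigma$ is the set of equivalence classes. The measure $\lambda$: let $r$ be the ring generated by $\bigcup_{\mathcal E}\mathcal R_{\mathcal E}$ (over all ONB). The paper shows that there is a unique finitely additive measure $\lambda:r\to[0,+\infty)$ such that $\lambda\bigl(A_0\setminus\bigcup_{j=1}^N A_j\bigr)=\lambda_{\mathcal E_0}(A_0)$ whenever $N\ge 0$, $A_j\in\mathcal R_{\mathcal E_j}$ ($j=0,\dots,N$) and $\mathcal E_j\not\sim\mathcal E_0$ for $j\ge1$. $\mathcal R$ is the completion of $r$: all $A\subset E$ such that for every $\epsilon>0$ there are $A_*,A^*\in r$ with $A_*\subset A\subset A^*$ and $\lambda(A^*\setminus A_* )<\epsilon$; $\lambda(A)=\inf\{\lambda(A^* ):A^*\in r,A^*\supset A\}$ for $A\in\mathcal R$. For a finitely additive measure $\mu$ on a ring $\mathcal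 A$, $L_2(E,\mathcal A,\mu,\mathbb C)$ is the Hilbert space obtained by completing $\mathrm{span}_{\mathbb C}\{\chi_A:A\in\mathcal A\}$ (modulo functions of zero seminorm) with respect to the inner product with $(\chi_A,\chi_B)=\mu(A\cap B)$. *)

theory Defs
  imports "HOL-Analysis.Analysis"
begin

section \<open>Rings of sets and finitely additive measures\<close>

definition generated_set_ring :: "'e set set \<Rightarrow> 'e set set" where
  "generated_set_ring K = \<Inter>{M. ring_of_sets UNIV M \<and> K \<subseteq> M}"

text \<open>A finitely additive measure is a total function on sets; its values outside the ring
  carry no information.\<close>

definition fa_measure :: "'e set set \<Rightarrow> ('e set \<Rightarrow> real) \<Rightarrow> bool" where
  "fa_measure R m \<longleftrightarrow> ring_of_sets UNIV R \<and> (\<forall>A\<in>R. 0 \<le> m A) \<and>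
     (\<forall>A\<in>R. \<forall>B\<in>R. A \<inter> B = {} \<longrightarrow> m (A \<union> B) = m A + m B)"

definition completed_ring :: "'e set set \<Rightarrow> ('e set \<Rightarrow> real) \<Rightarrow> 'e set set" where
  "completed_ring R m =
     {A. \<forall>\<epsilon>>0. \<exists>A1\<in>R. \<exists>A2\<in>R. A1 \<subseteq> A \<and> A \<subseteq> A2 \<and> m (A2 - A1) < \<epsilon>}"

definition completed_measure :: "'e set set \<Rightarrow> ('e set \<Rightarrow> real) \<Rightarrow> 'e set \<Rightarrow> real" where
  "completed_measure R m A = Inf {m B |B. B \<in> R \<and> A \<subseteq> B}"

section \<open>Orthonormal bases and infinite-dimensional boxes\<close>

definition is_onb :: "(nat \<Rightarrow> 'a::real_inner) \<Rightarrow> bool" where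
  "is_onb e \<longleftrightarrow> (\<forall>i j. e i \<bullet> e j = (if i = j then 1 else 0)) \<and> closure (span (range e)) = UNIV"

definition box_set :: "(nat \<Rightarrow> 'a::real_inner) \<Rightarrow> (nat \<Rightarrow> real) \<Rightarrow> (nat \<Rightarrow> real) \<Rightarrow> 'a set" where
  "box_set e a b = {x. \<forall>j. a j \<le> x \<bullet> e j \<and> x \<bullet> e j < b j}"

definition box_bounds :: "(nat \<Rightarrow> 'a::real_inner) \<Rightarrow> (nat \<Rightarrow> real) \<Rightarrow> (nat \<Rightarrow> real) \<Rightarrow> bool" where
  "box_bounds e a b \<longleftrightarrow> bounded (range a) \<and> bounded (range b) \<and> box_set e a b \<noteq> {} \<and>
     summable (\<lambda>j. max 0 (ln (b j - a j)))"

definition box_family :: "(nat \<Rightarrow> 'a::real_inner) \<Rightarrow> 'a set set" where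
  "box_family e = insert {} {box_set e a b |a b. box_bounds e a b}"

text \<open>For admissible bounds the positive parts of the logarithms are summable, so the series
  of logarithms either converges or diverges to \<open>-\<infinity>\<close>; in the latter case the volume is \<open>0\<close>.\<close>

definition box_volume :: "(nat \<Rightarrow> real) \<Rightarrow> (nat \<Rightarrow> real) \<Rightarrow> real" where
  "box_volume a b =
     (if summable (\<lambda>j. ln (b j - a j)) then exp (\<Sum>j. ln (b j - a j)) else 0)"

definition box_ring :: "(nat \<Rightarrow> 'a::real_inner) \<Rightarrow> 'a set set" where
  "box_ring e = generated_set_ring (box_family e)"

definition is_box_measure :: "(nat \<Rightarrow> 'a::real_inner) \<Rightarrow> ('a set \<Rightarrow> real) \<Rightarrow> bool" where
  "is_box_measure e m \<longleftrightarrow> fa_measure (box_ring e) m \<and>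
     (\<forall>A\<in>box_ring e. \<forall>h. m ((\<lambda>x. x + h) ` A) = m A) \<and>
     m {} = 0 \<and> (\<forall>a b. box_bounds e a b \<longrightarrow> m (box_set e a b) = box_volume a b)"

section \<open>Equivalence of orthonormal bases\<close>

text \<open>Each factor \<open>\<Sum>i. \<bar>e i \<bullet> f j\<bar>\<close> lies in \<open>[1, \<infinity>]\<close> because \<open>f j\<close> is a unit vector, so the
  infinite product is the supremum of its partial products.\<close>

definition onb_rel :: "((nat \<Rightarrow> 'a::real_inner) \<times> (nat \<Rightarrow> 'a)) set" where
  "onb_rel = {(e, f). is_onb e \<and> is_onb f \<and>
     (SUP n. \<Prod>j<n. \<Sum>i. ennreal \<bar>e i \<bullet> f j\<bar>) < \<infinity>}"

definition onb_classes :: "(nat \<Rightarrow> 'a::real_inner) set set" where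
  "onb_classes = {e. is_onb e} // onb_rel"

section \<open>The invariant measure\<close>

text \<open>In this section \<open>l\<close> assigns to every orthonormal basis \<open>e\<close> its measure on \<open>box_ring e\<close>.\<close>

definition onb_ring ::
    "((nat \<Rightarrow> 'a::real_inner) \<Rightarrow> 'a set \<Rightarrow> real) \<Rightarrow> (nat \<Rightarrow> 'a) \<Rightarrow> 'a set set" where
  "onb_ring l e = completed_ring (box_ring e) (l e)"

definition onb_measure ::
    "((nat \<Rightarrow> 'a::real_inner) \<Rightarrow> 'a set \<Rightarrow> real) \<Rightarrow> (nat \<Rightarrow> 'a) \<Rightarrow> 'a set \<Rightarrow> real" where
  "onb_measure l e = completed_measure (box_ring e) (l e)"

definition total_ring ::
    "((nat \<Rightarrow> 'a::real_inner) \<Rightarrow> 'a set \<Rightarrow> real) \<Rightarrow> 'a set set" where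
  "total_ring l = generated_set_ring (\<Union>e\<in>{e. is_onb e}. onb_ring l e)"

definition is_total_measure ::
    "((nat \<Rightarrow> 'a::real_inner) \<Rightarrow> 'a set \<Rightarrow> real) \<Rightarrow> ('a set \<Rightarrow> real) \<Rightarrow> bool" where
  "is_total_measure l m \<longleftrightarrow> fa_measure (total_ring l) m \<and>
     (\<forall>(N::nat) e A.
        (\<forall>j\<le>N. is_onb (e j) \<and> A j \<in> onb_ring l (e j)) \<longrightarrow>
        (\<forall>j\<in>{1..N}. (e j, e 0) \<notin> onb_rel) \<longrightarrow>
        m (A 0 - (\<Union>j\<in>{1..N}. A j)) = onb_measure l (e 0) (A 0))"

section \<open>Complex Hilbert spaces and the spaces \<open>L\<^sub>2\<close>\<close>

definition simple_functions :: "'e set set \<Rightarrow> ('e \<Rightarrow> complex) set" where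
  "simple_functions R = {\<lambda>x. \<Sum>A\<in>F. c A * indicator A x |F c. finite F \<and> F \<subseteq> R}"

text \<open>The complex scalar multiplication and inner product are required to be compatible with
  the real Banach space structure of the type, which supplies norm, topology and completeness.\<close>

locale complex_hilbert_space = vector_space scale
  for scale :: "complex \<Rightarrow> 'h::banach \<Rightarrow> 'h" +
  fixes ip :: "'h \<Rightarrow> 'h \<Rightarrow> complex"
  assumes scale_of_real: "scale (complex_of_real r) x = r *\<^sub>R x"
    and ip_add_left: "ip (x + y) z = ip x z + ip y z"
    and ip_scale_left: "ip (scale c x) z = c * ip x z"
    and ip_commute: "ip x y = cnj (ip y x)"
    and ip_self: "ip x x = complex_of_real ((norm x)\<^sup>2)"
begin

text \<open>The closed set \<open>V\<close> is a completion of the pre-Hilbert space of simple functions over \<open>R\<close>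
  with \<open>(\<chi>\<^sub>A, \<chi>\<^sub>B) = m (A \<inter> B)\<close>, with canonical map \<open>\<iota>\<close>. The prescribed inner product
  forces \<open>\<iota>\<close> to annihilate exactly the functions of zero seminorm.\<close>

definition is_L2 ::
    "'e set set \<Rightarrow> ('e set \<Rightarrow> real) \<Rightarrow> (('e \<Rightarrow> complex) \<Rightarrow> 'h) \<Rightarrow> 'h set \<Rightarrow> bool" where
  "is_L2 R m \<iota> V \<longleftrightarrow>
     (\<forall>f\<in>simple_functions R. \<forall>g\<in>simple_functions R. \<iota> (\<lambda>x. f x + g x) = \<iota> f + \<iota> g) \<and>
     (\<forall>c. \<forall>f\<in>simple_functions R. \<iota> (\<lambda>x. c * f x) = scale c (\<iota> f)) \<and>
     (\<forall>A\<in>R. \<forall>B\<in>R. ip (\<iota> (indicator A)) (\<iota> (indicator B)) = complex_of_real (m (A \<inter> B))) \<and>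
     V = closure (\<iota> ` simple_functions R)"

text \<open>The whole space is the (internal) Hilbert sum of the family \<open>H\<close> of closed subspaces.\<close>

definition is_hilbert_sum :: "'i set \<Rightarrow> ('i \<Rightarrow> 'h set) \<Rightarrow> bool" where
  "is_hilbert_sum I H \<longleftrightarrow>
     (\<forall>i\<in>I. subspace (H i) \<and> closed (H i)) \<and>
     (\<forall>i\<in>I. \<forall>j\<in>I. i \<noteq> j \<longrightarrow> (\<forall>x\<in>H i. \<forall>y\<in>H j. ip x y = 0)) \<and>
     closure (span (\<Union>i\<in>I. H i)) = UNIV"

end

end

theory Submission
  imports Defs
begin

text \<open>
  For bases \<open>e \<sim> f\<close> the matrix \<open>c i j = e i \<bullet> f j\<close> satisfies \<open>\<Sum>i. \<Sum>j. \<bar>c i j\<bar> - (c i j)\<^sup>2 < \<infinity>\<close>, a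
  condition symmetric in \<open>e\<close> and \<open>f\<close>. Hence, up to a permutation, signs and a finite block, it is
  summably close to the identity. An \<open>e\<close>-box of positive volume is therefore contained in a set
  given by box conditions on \<open>f j\<close>, \<open>j \<ge> J\<close>, and on almost orthonormal vectors spanning the same
  space as \<open>f j\<close>, \<open>j < J\<close>, and of only slightly larger volume; Gram--Schmidt and plane rotations
  turn it into finitely many \<open>f\<close>-boxes. Since the total measure computes the volume both of \<open>e\<close>-boxes
  and of \<open>f\<close>-boxes, these outer covers already approximate the \<open>e\<close>-box in \<open>L\<^sub>2\<close>, whereas boxes of
  volume zero vanish there. So equivalent bases have the same closed subspace. Inequivalent bases
  have orthogonal subspaces because the total measure vanishes on intersections of their sets.
  Multiplication by an indicator is a contraction, and by these two facts it preserves the closed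
  span \<open>W\<close> of all the subspaces when the set belongs to one of the rings; the sets with this
  property and with indicator in \<open>W\<close> form a ring, so \<open>W\<close> is everything.
\<close>

section \<open>Orthonormal bases and their equivalence\<close>

text \<open>Finite additivity admits only finite covers, while a box has infinitely many sides.
  Hence the cut at an index \<open>J\<close>: beyond it, the discrepancy between the bases is
  absorbed by longer sides, with a summable change of the logarithms; below it, only a
  finite-dimensional change of vectors remains, and the count of covering squares comes from planar
  Lebesgue measure. Changes of side length control changes of logarithms only if the lengths are
  bounded below, which positive volume provides. Outer estimates suffice because for P \<subseteq> B
  the squared distance of the two indicators is \<open>m B - m P\<close>, and \<open>m\<close>
  evaluates both terms; no inner approximation of an \<open>e\<close>-box by \<open>f\<close>-boxes
  is made. The price is that the rings of \<open>e\<close> and \<open>f\<close> are never compared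
  as families of sets: for equivalent bases, the intersection of a set from one ring with a set from
  the other is not known to lie in either. The last part therefore argues with multiplication by
  indicators on \<open>W\<close> instead of with intersections of generators.\<close>

lemma onb_inner: "is_onb e \<Longrightarrow> e i \<bullet> e j = (if i = j then 1 else 0)"
  by (simp add: is_onb_def)

lemma onb_norm [simp]: "is_onb e \<Longrightarrow> norm (e i) = 1"
  by (simp add: norm_eq_sqrt_inner onb_inner)

lemma onb_partial_norm:
  fixes e :: "nat \<Rightarrow> 'a::real_inner"
  assumes "is_onb e"
  shows "(norm (x - (\<Sum>i<n. (x \<bullet> e i) *\<^sub>R e i)))\<^sup>2 = (norm x)\<^sup>2 - (\<Sum>i<n. (x \<bullet> e i)\<^sup>2)"
proof -
  let ?P = "\<Sum>i<n. (x \<bullet> e i) *\<^sub>R e i"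
  have 1: "x \<bullet> ?P = (\<Sum>i<n. (x \<bullet> e i)\<^sup>2)"
    by (simp add: inner_sum_right power2_eq_square)
  have 2: "?P \<bullet> ?P = (\<Sum>i<n. (x \<bullet> e i)\<^sup>2)"
    by (simp add: inner_sum_right inner_sum_left onb_inner[OF assms] if_distrib sum.delta
        power2_eq_square cong: if_cong)
  show ?thesis
    using 1 2 by (simp add: power2_norm_eq_inner inner_diff_left inner_diff_right inner_commute)
qed

lemma span_range_nat_prefix:
  fixes e :: "nat \<Rightarrow> 'a::real_vector"
  assumes "y \<in> span (range e)"
  shows "\<exists>n. y \<in> span (e ` {..<n})"
proof -
  from assms obtain t r where t: "finite t" "t \<subseteq> range e" "y = (\<Sum>a\<in>t. r a *\<^sub>R a)"
    by (auto simp: span_explicit)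
  from finite_subset_image[OF t(1,2)] obtain I where I: "finite I" "t = e ` I" by blast
  obtain n where "I \<subseteq> {..<n}"
    using I(1) finite_nat_set_iff_bounded by auto
  then have "t \<subseteq> e ` {..<n}" using I by auto
  then have "y \<in> span (e ` {..<n})"
    unfolding t(3) by (intro span_sum span_scale span_base) auto
  then show ?thesis by blast
qed

text \<open>Density of the span suffices, without completeness: the partial sum map fixes a finite
  combination \<open>y\<close> close to \<open>x\<close>, so the remainder of \<open>x\<close>
  equals the remainder of \<open>x - y\<close> and is no longer than \<open>x - y\<close>.\<close>

lemma onb_expansion:
  fixes e :: "nat \<Rightarrow> 'a::real_inner"
  assumes e: "is_onb e"
  shows "(\<lambda>i. (x \<bullet> e i) *\<^sub>R e i) sums x"
  unfolding sums_def
proof (rule LIMSEQ_I)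
  fix r :: real assume r: "r > 0"
  have "x \<in> closure (span (range e))" using e by (simp add: is_onb_def)
  then obtain y where y: "y \<in> span (range e)" "dist y x < r"
    using r by (meson closure_approachable)
  obtain n where n: "y \<in> span (e ` {..<n})" using span_range_nat_prefix y(1) by blast
  have "norm ((\<Sum>i<k. (x \<bullet> e i) *\<^sub>R e i) - x) < r" if "k \<ge> n" for k
  proof -
    let ?P = "\<lambda>x. \<Sum>i<k. (x \<bullet> e i) *\<^sub>R e i"
    have lin: "linear ?P"
      by (intro linear_compose_sum ballI) (auto intro!: linearI simp: inner_add_left scaleR_add_left)
    have "?P b = b" if "b \<in> e ` {..<n}" for b
      using that \<open>k \<ge> n\<close>
      by (auto simp: onb_inner[OF e] if_distrib[of "\<lambda>c. c *\<^sub>R _"] sum.delta cong: if_cong)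
    then have Py: "?P y = y"
      using linear_eq_on_span[OF lin linear_id, of "e ` {..<n}" y] n by simp
    have "x - ?P x = (x - y) - ?P (x - y)"
      using Py linear_diff[OF lin, of x y] by (simp only: algebra_simps)
    then have "(norm (x - ?P x))\<^sup>2 = (norm ((x - y) - ?P (x - y)))\<^sup>2" by (simp only:)
    also have "\<dots> \<le> (norm (x - y))\<^sup>2"
      using onb_partial_norm[OF e, of "x - y" k] sum_nonneg[of "{..<k}" "\<lambda>i. ((x-y) \<bullet> e i)\<^sup>2"] by simp
    finally have "norm (x - ?P x) \<le> norm (x - y)"
      by (rule power2_le_imp_le) simp
    then show ?thesis using y(2) by (simp add: dist_norm norm_minus_commute)
  qed
  then show "\<exists>no. \<forall>n\<ge>no. norm ((\<Sum>i<n. (x \<bullet> e i) *\<^sub>R e i) - x) < r" by blast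
qed

lemma onb_parseval:
  fixes e :: "nat \<Rightarrow> 'a::real_inner"
  assumes e: "is_onb e"
  shows "(\<lambda>i. (x \<bullet> e i) * (y \<bullet> e i)) sums (x \<bullet> y)"
proof -
  have "bounded_linear (\<lambda>z. z \<bullet> y)" by (rule bounded_linear_inner_left)
  from bounded_linear.sums[OF this onb_expansion[OF e, of x]]
  show ?thesis by (simp add: inner_commute)
qed

lemma onb_parseval_sq:
  fixes e :: "nat \<Rightarrow> 'a::real_inner"
  assumes e: "is_onb e"
  shows "(\<lambda>i. (x \<bullet> e i)\<^sup>2) sums (norm x)\<^sup>2"
  using onb_parseval[OF e, of x x] by (simp only: power2_norm_eq_inner power2_eq_square[of "x \<bullet> _"])

lemma onb_coeff_le: "\<bar>e i \<bullet> f j\<bar> \<le> 1" if "is_onb e" "is_onb f" for e f :: "nat \<Rightarrow> 'a::real_inner"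
  using Cauchy_Schwarz_ineq2[of "e i" "f j"] that by simp

lemma onbI:
  fixes e :: "nat \<Rightarrow> 'a::real_inner"
  assumes "\<And>i j. e i \<bullet> e j = (if i = j then 1 else 0)" and f: "is_onb f" 
    and "\<And>j. f j \<in> span (range e)"
  shows "is_onb e"
proof -
  have "span (range f) \<subseteq> span (range e)"
    by (rule span_minimal) (use assms in auto)
  then have "closure (span (range e)) = UNIV"
    using closure_mono[of "span (range f)" "span (range e)"] f by (auto simp: is_onb_def)
  with assms(1) show ?thesis by (simp add: is_onb_def)
qed

section \<open>Equivalence of bases as summability of a symmetric defect\<close>

lemma ennreal_suminf_swap:
  fixes f :: "nat \<Rightarrow> nat \<Rightarrow> ennreal"
  shows "(\<Sum>i. \<Sum>j. f i j) = (\<Sum>j. \<Sum>i. f i j)"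
proof -
  have "(\<integral>\<^sup>+j. (\<Sum>i. f i j) \<partial>count_space UNIV) = (\<Sum>i. \<integral>\<^sup>+j. f i j \<partial>count_space UNIV)"
    by (rule nn_integral_suminf) simp
  then show ?thesis by (simp add: nn_integral_count_space_nat)
qed

text \<open>The excess of the l1 norm of column \<open>j\<close> over its squared l2 norm, which is
  1. Values in \<open>ennreal\<close> let the double series be summed in either order.\<close>

definition defect :: "(nat \<Rightarrow> 'a::real_inner) \<Rightarrow> (nat \<Rightarrow> 'a) \<Rightarrow> nat \<Rightarrow> ennreal" where
  "defect e f j = (\<Sum>i. ennreal (\<bar>e i \<bullet> f j\<bar> - (e i \<bullet> f j)\<^sup>2))"

lemma abs_minus_square_nonneg: "0 \<le> \<bar>e i \<bullet> f j\<bar> - (e i \<bullet> f j)\<^sup>2"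
  if "is_onb e" "is_onb f" for e f :: "nat \<Rightarrow> 'a::real_inner"
proof -
  have "\<bar>e i \<bullet> f j\<bar>^2 \<le> \<bar>e i \<bullet> f j\<bar>^1"
    by (rule power_decreasing) (use onb_coeff_le[OF that] in auto)
  then show ?thesis by simp
qed

lemma l1_norm_eq_defect:
  assumes "is_onb e" "is_onb f"
  shows "(\<Sum>i. ennreal \<bar>e i \<bullet> f j\<bar>) = 1 + defect e f j"
proof -
  have "(\<lambda>i. (e i \<bullet> f j)\<^sup>2) sums 1"
    using onb_parseval_sq[OF assms(1), of "f j"] assms by (simp add: inner_commute)
  then have "(\<Sum>i. ennreal ((e i \<bullet> f j)\<^sup>2)) = 1"
    by (subst suminf_ennreal2) (auto simp: sums_iff)
  moreover have "(\<Sum>i. ennreal \<bar>e i \<bullet> f j\<bar>) =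
      (\<Sum>i. ennreal ((e i \<bullet> f j)\<^sup>2) + ennreal (\<bar>e i \<bullet> f j\<bar> - (e i \<bullet> f j)\<^sup>2))"
    by (rule arg_cong[where f=suminf], rule ext, subst ennreal_plus[symmetric])
       (use abs_minus_square_nonneg[OF assms] in auto)
  ultimately show ?thesis
    by (simp add: suminf_add[symmetric] defect_def summableI)
qed

lemma ennreal_one_plus_sum_le_prod:
  fixes d :: "nat \<Rightarrow> ennreal"
  shows "1 + (\<Sum>j<n. d j) \<le> (\<Prod>j<n. 1 + d j)"
proof (induction n)
  case (Suc n)
  have "1 + (\<Sum>j<Suc n. d j) \<le> 1 + (\<Sum>j<n. d j) + (1 + (\<Sum>j<n. d j)) * d n"
    by (simp add: distrib_right add.assoc add_increasing2)
  also have "\<dots> = (1 + (\<Sum>j<n. d j)) * (1 + d n)" by (simp add: distrib_left)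
  also have "\<dots> \<le> (\<Prod>j<n. 1 + d j) * (1 + d n)"
    by (intro mult_right_mono Suc.IH) simp
  finally show ?case by simp
qed simp

text \<open>The factors of the product are \<open>1 + defect e f j\<close>, and such a product lies
  between 1 plus the sum of the defects and the exponential of that sum. The series, unlike the
  product, treats rows and columns alike.\<close>

lemma onb_rel_iff_defect:
  "(e, f) \<in> onb_rel \<longleftrightarrow> is_onb e \<and> is_onb f \<and> (\<Sum>j. defect e f j) < \<infinity>"
proof -
  have "(SUP n. \<Prod>j<n. 1 + d j) < \<infinity> \<longleftrightarrow> (\<Sum>j. d j) < \<infinity>" for d :: "nat \<Rightarrow> ennreal"
  proof
    assume *: "(SUP n. \<Prod>j<n. 1 + d j) < \<infinity>"
    have "(\<Sum>j. d j) \<le> (SUP n. \<Prod>j<n. 1 + d j)"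
      unfolding suminf_eq_SUP
    proof (rule SUP_mono)
      fix n
      have "(\<Sum>j<n. d j) \<le> 1 + (\<Sum>j<n. d j)" by simp
      also note ennreal_one_plus_sum_le_prod
      finally show "\<exists>k\<in>UNIV. (\<Sum>j<n. d j) \<le> (\<Prod>j<k. 1 + d j)" by blast
    qed
    then show "(\<Sum>j. d j) < \<infinity>" using * by (rule le_less_trans)
  next
    assume *: "(\<Sum>j. d j) < \<infinity>"
    define r where "r j = enn2real (d j)" for j
    have r0: "0 \<le> r j" for j by (simp add: r_def)
    have fin: "d j < \<infinity>" for j
      using * ennreal_suminf_lessD by blast
    have d: "d j = ennreal (r j)" for j using fin[of j] by (simp add: r_def)
    have "summable r"
      using * by (intro summable_suminf_not_top) (auto simp flip: d simp: r0)
    have "(\<Prod>j<n. 1 + d j) \<le> ennreal (exp (suminf r))" for n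
    proof -
      have "(\<Prod>j<n. 1 + r j) \<le> (\<Prod>j<n. exp (r j))"
        by (intro prod_mono) (auto simp: r_def add_nonneg_nonneg)
      also have "\<dots> = exp (\<Sum>j<n. r j)" by (simp add: exp_sum)
      also have "\<dots> \<le> exp (suminf r)"
        using sum_le_suminf[OF \<open>summable r\<close>, of "{..<n}"] by (simp add: r_def)
      finally have "ennreal (\<Prod>j<n. 1 + r j) \<le> ennreal (exp (suminf r))" by (rule ennreal_leI)
      moreover have "(\<Prod>j<n. 1 + d j) = ennreal (\<Prod>j<n. 1 + r j)"
        by (subst prod_ennreal[symmetric]) (auto simp: d r0 add_nonneg_nonneg)
      ultimately show ?thesis by simp
    qed
    then have "(SUP n. \<Prod>j<n. 1 + d j) \<le> ennreal (exp (suminf r))" by (intro SUP_least)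
    then show "(SUP n. \<Prod>j<n. 1 + d j) < \<infinity>" using le_less_trans by fastforce
  qed
  note * = this[of "defect e f"]
  show ?thesis
  proof (cases "is_onb e \<and> is_onb f")
    case True
    then have "(\<Sum>i. ennreal \<bar>e i \<bullet> f j\<bar>) = 1 + defect e f j" for j
      by (simp add: l1_norm_eq_defect)
    then show ?thesis using * True unfolding onb_rel_def by (simp only: mem_Collect_eq split_conv)
  next
    case False
    then show ?thesis unfolding onb_rel_def mem_Collect_eq split_conv by blast
  qed
qed

lemma onb_relD: "(e, f) \<in> onb_rel \<Longrightarrow> is_onb e" "(e, f) \<in> onb_rel \<Longrightarrow> is_onb f"
  by (simp_all only: onb_rel_iff_defect)


lemma defect_suminf_swap: "(\<Sum>j. defect e f j) = (\<Sum>j. defect f e j)"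
  unfolding defect_def by (subst ennreal_suminf_swap) (simp add: inner_commute)

lemma onb_rel_sym: "(e, f) \<in> onb_rel \<Longrightarrow> (f, e) \<in> onb_rel"
  unfolding onb_rel_iff_defect by (subst defect_suminf_swap) blast

lemma onb_rel_refl: "is_onb e \<Longrightarrow> (e, e) \<in> onb_rel"
proof -
  assume e: "is_onb e"
  have "\<bar>e i \<bullet> e j\<bar> - (e i \<bullet> e j)\<^sup>2 = 0" for i j by (simp add: onb_inner[OF e])
  then show ?thesis by (simp add: onb_rel_iff_defect e defect_def)
qed

lemma coeff_triangle:
  assumes "is_onb e" "is_onb f" "is_onb g"
  shows "ennreal \<bar>e i \<bullet> g k\<bar> \<le> (\<Sum>j. ennreal \<bar>e i \<bullet> f j\<bar> * ennreal \<bar>f j \<bullet> g k\<bar>)"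
proof (cases "(\<Sum>j. ennreal \<bar>e i \<bullet> f j\<bar> * ennreal \<bar>f j \<bullet> g k\<bar>) = top")
  case False
  let ?a = "\<lambda>j. (e i \<bullet> f j) * (g k \<bullet> f j)"
  have eq: "(\<Sum>j. ennreal \<bar>e i \<bullet> f j\<bar> * ennreal \<bar>f j \<bullet> g k\<bar>) = (\<Sum>j. ennreal \<bar>?a j\<bar>)"
    by (simp add: ennreal_mult[symmetric] abs_mult inner_commute)
  have summ: "summable (\<lambda>j. \<bar>?a j\<bar>)"
    by (rule summable_suminf_not_top) (use False eq in auto)
  have "\<bar>e i \<bullet> g k\<bar> = \<bar>suminf ?a\<bar>"
    using onb_parseval[OF assms(2), of "e i" "g k"] by (simp add: sums_iff)
  also have "\<dots> \<le> (\<Sum>j. \<bar>?a j\<bar>)" by (rule summable_rabs[OF summ])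
  finally show ?thesis
    unfolding eq using summ by (simp add: suminf_ennreal2 ennreal_leI)
qed simp

text \<open>Expanding the coefficients of \<open>e\<close> against \<open>g\<close> through
  \<open>f\<close> bounds column \<open>k\<close> by \<Sum>j. (1 + \<open>defect e f j\<close>)
  times \<bar>\<open>f j \<bullet> g k\<close>\<bar>. Subtracting 1 and summing over
  \<open>k\<close> leaves the two total defects, provided that the row sums of \<open>f\<close>
  against \<open>g\<close> are uniformly bounded.\<close>

lemma onb_rel_trans:
  assumes "(e, f) \<in> onb_rel" "(f, g) \<in> onb_rel"
  shows "(e, g) \<in> onb_rel"
proof -
  have e: "is_onb e" and f: "is_onb f" and g: "is_onb g"
    using assms by (auto dest: onb_relD)
  define D where "D = (\<Sum>k. defect f g k)"
  have Dlt: "D < \<infinity>" using assms(2) by (simp add: onb_rel_iff_defect D_def)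
  \<comment> \<open>Row sums for the pair \<open>f\<close>, \<open>g\<close> are column sums for
    \<open>g\<close>, \<open>f\<close>; by symmetry of the total defect the same \<open>D\<close>
    bounds them.\<close>
  have col: "(\<Sum>k. ennreal \<bar>f j \<bullet> g k\<bar>) \<le> 1 + D" for j
  proof -
    have "(\<Sum>k. ennreal \<bar>f j \<bullet> g k\<bar>) = 1 + defect g f j"
      by (subst inner_commute) (rule l1_norm_eq_defect[OF g f])
    moreover have "defect g f j \<le> D"
      using sum_le_suminf[OF summableI, of "{j}" "defect g f"]
      unfolding D_def defect_suminf_swap[of f g] by simp
    ultimately show ?thesis by (metis add_left_mono)
  qed
  have "1 + defect e g k \<le> 1 + (defect f g k + (\<Sum>j. defect e f j * ennreal \<bar>f j \<bullet> g k\<bar>))" for k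
  proof -
    have "1 + defect e g k = (\<Sum>i. ennreal \<bar>e i \<bullet> g k\<bar>)" by (rule l1_norm_eq_defect[OF e g, symmetric])
    also have "\<dots> \<le> (\<Sum>i. \<Sum>j. ennreal \<bar>e i \<bullet> f j\<bar> * ennreal \<bar>f j \<bullet> g k\<bar>)"
      by (intro suminf_le coeff_triangle e f g summableI)
    also have "\<dots> = (\<Sum>j. \<Sum>i. ennreal \<bar>e i \<bullet> f j\<bar> * ennreal \<bar>f j \<bullet> g k\<bar>)"
      by (rule ennreal_suminf_swap)
    also have "\<dots> = (\<Sum>j. (1 + defect e f j) * ennreal \<bar>f j \<bullet> g k\<bar>)"
      by (simp add: ennreal_suminf_multc l1_norm_eq_defect[OF e f])
    also have "\<dots> = (\<Sum>j. ennreal \<bar>f j \<bullet> g k\<bar>) + (\<Sum>j. defect e f j * ennreal \<bar>f j \<bullet> g k\<bar>)"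
      by (simp add: distrib_right suminf_add[symmetric] summableI)
    also have "(\<Sum>j. ennreal \<bar>f j \<bullet> g k\<bar>) = 1 + defect f g k" by (rule l1_norm_eq_defect[OF f g])
    finally show ?thesis by (simp add: add.assoc)
  qed
  then have "defect e g k \<le> defect f g k + (\<Sum>j. defect e f j * ennreal \<bar>f j \<bullet> g k\<bar>)" for k
    by (simp add: ennreal_add_left_cancel_le)
  then have "(\<Sum>k. defect e g k) \<le> (\<Sum>k. defect f g k + (\<Sum>j. defect e f j * ennreal \<bar>f j \<bullet> g k\<bar>))"
    by (intro suminf_le summableI)
  also have "\<dots> = D + (\<Sum>k. \<Sum>j. defect e f j * ennreal \<bar>f j \<bullet> g k\<bar>)"
    by (simp add: D_def suminf_add[symmetric] summableI)
  also have "(\<Sum>k. \<Sum>j. defect e f j * ennreal \<bar>f j \<bullet> g k\<bar>) = (\<Sum>j. defect e f j * (\<Sum>k. ennreal \<bar>f j \<bullet> g k\<bar>))"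
    by (subst ennreal_suminf_swap) (simp only: ennreal_suminf_cmult)
  also have "\<dots> \<le> (\<Sum>j. defect e f j * (1 + D))"
    by (intro suminf_le summableI mult_left_mono col) simp
  also have "\<dots> = (\<Sum>j. defect e f j) * (1 + D)" by (rule ennreal_suminf_multc)
  finally have "(\<Sum>k. defect e g k) \<le> D + (\<Sum>j. defect e f j) * (1 + D)" by (simp only: add_left_mono)
  also have "\<dots> < \<infinity>"
    using Dlt assms(1) by (simp add: onb_rel_iff_defect ennreal_mult_less_top)
  finally show ?thesis by (simp add: onb_rel_iff_defect e g)
qed

lemma equiv_onb_rel: "equiv {e. is_onb e} onb_rel"
proof (rule equivI)
  show "onb_rel \<subseteq> {e. is_onb e} \<times> {e. is_onb e}" by (auto dest: onb_relD)
  show "refl_on {e. is_onb e} onb_rel" by (auto intro: refl_onI onb_rel_refl)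
  show "sym onb_rel" by (rule symI) (rule onb_rel_sym)
  show "trans onb_rel" by (rule transI) (rule onb_rel_trans)
qed

section \<open>Covering a rotated rectangle by small squares\<close>

text \<open>The sign \<open>\<sigma>\<close> is the determinant; reflections are included because
  turning one unit vector into another may end with a change of sign.\<close>

lemma orthogonal_transformation_plane:
  fixes c s \<sigma> :: real
  assumes "c\<^sup>2 + s\<^sup>2 = 1" "\<sigma>\<^sup>2 = 1"
  shows "orthogonal_transformation (\<lambda>y::real^2. vector [c * y$1 - \<sigma> * s * y$2, s * y$1 + \<sigma> * c * y$2] :: real^2)"
  unfolding orthogonal_transformation_def
proof (intro conjI allI)
  show "linear (\<lambda>y::real^2. vector [c * y$1 - \<sigma> * s * y$2, s * y$1 + \<sigma> * c * y$2] :: real^2)"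
    by (rule linearI) (simp_all add: vec_eq_iff forall_2 algebra_simps)
  fix v w :: "real^2"
  have "(c * v$1 - \<sigma> * s * v$2) * (c * w$1 - \<sigma> * s * w$2) + (s * v$1 + \<sigma> * c * v$2) * (s * w$1 + \<sigma> * c * w$2)
      = (c\<^sup>2 + s\<^sup>2) * (v$1 * w$1) + \<sigma>\<^sup>2 * (c\<^sup>2 + s\<^sup>2) * (v$2 * w$2)"
    by (simp add: algebra_simps power2_eq_square)
  then show "(vector [c * v$1 - \<sigma> * s * v$2, s * v$1 + \<sigma> * c * v$2] :: real^2) \<bullet>
      vector [c * w$1 - \<sigma> * s * w$2, s * w$1 + \<sigma> * c * w$2] = v \<bullet> w"
    using assms by (simp add: inner_vec_def sum_2)
qed

lemma measure_box_2:
  fixes a b :: "real^2"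
  assumes "a$1 \<le> b$1" "a$2 \<le> b$2"
  shows "measure lborel (box a b) = (b$1 - a$1) * (b$2 - a$2)"
    and "measure lborel (cbox a b) = (b$1 - a$1) * (b$2 - a$2)"
proof -
  have "a \<in> cbox a b" using assms by (simp add: mem_box_cart forall_2)
  then have *: "cbox a b \<noteq> {}" by blast
  show c: "measure lborel (cbox a b) = (b$1 - a$1) * (b$2 - a$2)"
    using content_cbox_cart[OF *] by (simp add: UNIV_2)
  have "measure lborel (box a b) = measure lborel (cbox a b)"
    by (simp add: measure_lborel_box_eq measure_lborel_cbox_eq)
  with c show "measure lborel (box a b) = (b$1 - a$1) * (b$2 - a$2)" by simp
qed

lemma floor_grid:
  fixes p h :: real
  assumes "h > 0"
  shows "of_int \<lfloor>p / h\<rfloor> * h \<le> p" "p < (of_int \<lfloor>p / h\<rfloor> + 1) * h"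
  using of_int_floor_le[of "p / h"] floor_correct[of "p / h"] pos_le_divide_eq[OF assms] pos_divide_less_eq[OF assms]
  by (metis of_int_floor_le, metis of_int_1 of_int_add)

text \<open>Every grid square containing a point of the rotated rectangle lies inside the rectangle
  enlarged by \<open>2 * h\<close> on each side. The open squares are disjoint, so rotation
  invariance of planar Lebesgue measure bounds their number by an area. The count is made for finite
  subsets \<open>F\<close>, since finiteness of the whole index set is only a consequence.\<close>

lemma rotated_grid_bound:
  fixes c s \<sigma> h :: real
  assumes cs: "c\<^sup>2 + s\<^sup>2 = 1" and \<sigma>: "\<sigma>\<^sup>2 = 1" and ab: "a1 < b1" "a2 < b2" and h: "h > 0"
  defines "P \<equiv> {(p, q). a1 \<le> c * p + s * q \<and> c * p + s * q < b1 \<and>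
                       a2 \<le> \<sigma> * (c * q - s * p) \<and> \<sigma> * (c * q - s * p) < b2}"
  assumes F: "finite F" "F \<subseteq> (\<lambda>(p, q). (\<lfloor>p / h\<rfloor>, \<lfloor>q / h\<rfloor>)) ` P"
  shows "real (card F) * h\<^sup>2 \<le> (b1 - a1 + 4 * h) * (b2 - a2 + 4 * h)"
proof -
  define T where "T = (\<lambda>y::real^2. vector [c * y$1 - \<sigma> * s * y$2, s * y$1 + \<sigma> * c * y$2] :: real^2)"
  have T: "orthogonal_transformation T"
    unfolding T_def by (rule orthogonal_transformation_plane[OF cs \<sigma>])
  define R where "R = cbox (vector [a1 - 2*h, a2 - 2*h] :: real^2) (vector [b1 + 2*h, b2 + 2*h])"
  define Q where "Q = (\<lambda>(i::int, j::int). box (vector [i * h, j * h] :: real^2) (vector [(i + 1) * h, (j + 1) * h]))"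
  have cs1: "\<bar>c\<bar> \<le> 1" "\<bar>s\<bar> \<le> 1"
    using cs by (metis abs_square_le_1 le_add_same_cancel1 le_add_same_cancel2 zero_le_power2)+
  have Q_sub: "Q ij \<subseteq> T ` R" if ij: "ij \<in> F" for ij
  proof
    fix y assume y: "y \<in> Q ij"
    obtain p q where pq: "(p, q) \<in> P" "ij = (\<lfloor>p / h\<rfloor>, \<lfloor>q / h\<rfloor>)" using subsetD[OF F(2) ij] by auto
    let ?d = "y$1 - p" and ?d' = "y$2 - q"
    have d: "\<bar>?d\<bar> \<le> h" "\<bar>?d'\<bar> \<le> h"
      using y floor_grid[OF h, of p] floor_grid[OF h, of q]
      by (auto simp: pq Q_def mem_box_cart forall_2 algebra_simps abs_le_iff)
    have "\<bar>c * ?d\<bar> \<le> h" "\<bar>s * ?d\<bar> \<le> h" "\<bar>c * ?d'\<bar> \<le> h" "\<bar>s * ?d'\<bar> \<le> h"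
      using mult_mono[OF cs1(1) d(1)] mult_mono[OF cs1(1) d(2)] mult_mono[OF cs1(2) d(1)] mult_mono[OF cs1(2) d(2)]
      by (simp_all add: abs_mult)
    then have e1: "\<bar>c * ?d + s * ?d'\<bar> \<le> 2 * h" and e2: "\<bar>c * ?d' - s * ?d\<bar> \<le> 2 * h" by linarith+
    have "\<bar>\<sigma>\<bar> = 1" using \<sigma> by (simp add: abs_square_eq_1)
    with e2 have e3: "\<bar>\<sigma> * (c * ?d' - s * ?d)\<bar> \<le> 2 * h" by (simp add: abs_mult)
    \<comment> \<open>The coordinates of \<open>y\<close> in the rotated frame, that is, its
      preimage under \<open>T\<close>.\<close>
    define z where "z = (vector [c * y$1 + s * y$2, \<sigma> * (c * y$2 - s * y$1)] :: real^2)"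
    have z1: "z$1 = c * p + s * q + (c * ?d + s * ?d')"
      by (simp add: z_def algebra_simps)
    have z2: "z$2 = \<sigma> * (c * q - s * p) + \<sigma> * (c * ?d' - s * ?d)"
      by (simp add: z_def algebra_simps)
    have "z \<in> R"
      using e1 e3 pq(1) unfolding R_def mem_box_cart forall_2 z1 z2 abs_le_iff P_def by auto
    moreover have "T z = y"
    proof -
      have "c * (c * y$1 + s * y$2) - \<sigma> * s * (\<sigma> * (c * y$2 - s * y$1)) =
          (c\<^sup>2 + \<sigma>\<^sup>2 * s\<^sup>2) * y$1 + (1 - \<sigma>\<^sup>2) * (c * s * y$2)"
        by (simp add: algebra_simps power2_eq_square)
      moreover have "s * (c * y$1 + s * y$2) + \<sigma> * c * (\<sigma> * (c * y$2 - s * y$1)) =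
          (s\<^sup>2 + \<sigma>\<^sup>2 * c\<^sup>2) * y$2 + (1 - \<sigma>\<^sup>2) * (c * s * y$1)"
        by (simp add: algebra_simps power2_eq_square)
      ultimately show ?thesis
        using cs \<sigma> by (simp add: T_def z_def vec_eq_iff forall_2 add.commute)
    qed
    ultimately show "y \<in> T ` R" by blast
  qed
  have disj: "pairwise (\<lambda>x y. disjnt (Q x) (Q y)) F"
  proof (rule pairwiseI)
    fix x y :: "int \<times> int" assume ne: "x \<noteq> y"
    obtain i j i' j' where xy: "x = (i, j)" "y = (i', j')" by (cases x, cases y)
    have *: "m = m'" if "of_int m * h < t" "t < (of_int m + 1) * h" "of_int m' * h < t" "t < (of_int m' + 1) * h"
      for m m' :: int and t
    proof -
      have "of_int m * h < (of_int m' + 1) * h" "of_int m' * h < (of_int m + 1) * h" using that by linarith+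
      then have "of_int m < (of_int m' + 1 :: real)" "of_int m' < (of_int m + 1 :: real)"
        using h by (simp_all only: mult_less_cancel_right_pos)
      then show ?thesis by linarith
    qed
    show "disjnt (Q x) (Q y)"
      using ne * unfolding disjnt_iff Q_def xy by (auto simp: mem_box_cart forall_2)
  qed
  have mQ: "measure lebesgue (Q ij) = h\<^sup>2" for ij
    using h by (cases ij) (simp add: Q_def measure_box_2 mult_right_mono power2_eq_square left_diff_distrib[symmetric])
  have Qm: "Q ij \<in> lmeasurable" for ij by (cases ij) (simp add: Q_def)
  have TR: "T ` R \<in> lmeasurable" unfolding R_def
    by (rule measurable_orthogonal_image) (use T in auto)
  have "real (card F) * h\<^sup>2 = (\<Sum>ij\<in>F. measure lebesgue (Q ij))" by (simp add: mQ)
  also have "\<dots> = measure lebesgue (\<Union>ij\<in>F. Q ij)"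
    by (rule measure_UNION'[symmetric]) (use F disj Qm in auto)
  also have "\<dots> \<le> measure lebesgue (T ` R)"
    by (rule measure_mono_fmeasurable) (use Q_sub TR F Qm in \<open>auto intro!: sets.finite_UN fmeasurableD\<close>)
  also have "\<dots> = measure lebesgue R"
    unfolding R_def by (rule measure_orthogonal_image) (use T in auto)
  also have "\<dots> = (b1 - a1 + 4 * h) * (b2 - a2 + 4 * h)"
    using ab h unfolding R_def by (simp add: measure_box_2 add.commute)
  finally show ?thesis .
qed

lemma rotated_rectangle_cover:
  fixes c s \<sigma> \<epsilon> :: real
  assumes cs: "c\<^sup>2 + s\<^sup>2 = 1" and \<sigma>: "\<sigma>\<^sup>2 = 1" and ab: "a1 < b1" "a2 < b2" and \<epsilon>: "\<epsilon> > 0"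
  obtains h :: real and G :: "(int \<times> int) set" where "h > 0" "finite G"
    "\<And>p q. a1 \<le> c * p + s * q \<Longrightarrow> c * p + s * q < b1 \<Longrightarrow> a2 \<le> \<sigma> * (c * q - s * p) \<Longrightarrow>
        \<sigma> * (c * q - s * p) < b2 \<Longrightarrow> (\<lfloor>p / h\<rfloor>, \<lfloor>q / h\<rfloor>) \<in> G"
    "real (card G) * h\<^sup>2 \<le> (b1 - a1) * (b2 - a2) + \<epsilon>"
proof -
  define P where "P = {(p, q). a1 \<le> c * p + s * q \<and> c * p + s * q < b1 \<and>
                       a2 \<le> \<sigma> * (c * q - s * p) \<and> \<sigma> * (c * q - s * p) < b2}"
  \<comment> \<open>The coefficient of \<open>h\<close> in the excess area, after
    \<open>h * h \<le> h\<close> has been used for the quadratic term; this is why \<open>h\<close>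
    is capped at 1.\<close>
  define K where "K = 4 * (b1 - a1) + 4 * (b2 - a2) + 16"
  define h where "h = min 1 (\<epsilon> / K)"
  have K: "K > 0" using ab by (simp add: K_def)
  have h: "h > 0" "h \<le> 1" "h * K \<le> \<epsilon>"
    using \<epsilon> K by (simp_all add: h_def min_def field_simps)
  define G where "G = (\<lambda>(p, q). (\<lfloor>p / h\<rfloor>, \<lfloor>q / h\<rfloor>)) ` P"
  note bound = rotated_grid_bound[OF cs \<sigma> ab h(1), folded P_def, folded G_def]
  \<comment> \<open>\<open>G\<close> is the image of an infinite set; it is finite because the
    cardinalities of its finite subsets have a common bound.\<close>
  have "finite G \<and> card G \<le> nat \<lfloor>(b1 - a1 + 4 * h) * (b2 - a2 + 4 * h) / h\<^sup>2\<rfloor>"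
  proof (rule finite_if_finite_subsets_card_bdd)
    fix F assume F: "F \<subseteq> G" "finite F"
    then have "real (card F) \<le> (b1 - a1 + 4 * h) * (b2 - a2 + 4 * h) / h\<^sup>2"
      using bound[of F] h by (simp add: field_simps)
    then show "card F \<le> nat \<lfloor>(b1 - a1 + 4 * h) * (b2 - a2 + 4 * h) / h\<^sup>2\<rfloor>"
      by (simp add: le_nat_floor)
  qed
  then have fin: "finite G" by blast
  have "h * h \<le> h" using h(1,2) mult_left_le[of h h] by simp
  moreover have "(b1 - a1 + 4 * h) * (b2 - a2 + 4 * h) =
      (b1 - a1) * (b2 - a2) + h * (4 * (b1 - a1) + 4 * (b2 - a2)) + 16 * (h * h)"
    by (simp add: algebra_simps)
  moreover have "h * K = h * (4 * (b1 - a1) + 4 * (b2 - a2)) + 16 * h"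
    by (simp add: K_def algebra_simps)
  ultimately have "real (card G) * h\<^sup>2 \<le> (b1 - a1) * (b2 - a2) + \<epsilon>"
    using bound[OF fin subset_refl] h(3) by linarith
  then show ?thesis
    by (intro that[of h G]) (use h fin in \<open>auto simp: G_def P_def intro!: image_eqI\<close>)
qed

section \<open>Outer volume and changes of basis\<close>

text \<open>The part of \<open>box_bounds\<close> that does not mention a basis. Nonemptiness of the
  box is weakened to nonempty sides, since infinitely many nonempty sides may have no common point
  in the space; a cover may thus contain empty boxes.\<close>

definition admissible :: "(nat \<Rightarrow> real) \<Rightarrow> (nat \<Rightarrow> real) \<Rightarrow> bool" where
  "admissible a b \<longleftrightarrow> bounded (range a) \<and> bounded (range b) \<and> (\<forall>j. a j < b j) \<and>
     summable (\<lambda>j. max 0 (ln (b j - a j)))"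

text \<open>An upper bound for the outer Jordan content with respect to \<open>f\<close>-boxes. The
  margin \<open>\<epsilon>\<close> stands for the infimum over finite covers.\<close>

definition outer_le :: "(nat \<Rightarrow> 'a::real_inner) \<Rightarrow> 'a set \<Rightarrow> real \<Rightarrow> bool" where
  "outer_le f A v \<longleftrightarrow> (\<forall>\<epsilon>>0. \<exists>F. finite F \<and> (\<forall>(a, b)\<in>F. admissible a b) \<and>
     A \<subseteq> (\<Union>(a, b)\<in>F. box_set f a b) \<and> (\<Sum>(a, b)\<in>F. box_volume a b) \<le> v + \<epsilon>)"

text \<open>A one-sided comparison of contents. It is transitive, so a change of basis can be
  decomposed into elementary ones.\<close>

definition dominates :: "(nat \<Rightarrow> 'a::real_inner) \<Rightarrow> (nat \<Rightarrow> 'a) \<Rightarrow> bool" where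
  "dominates f g \<longleftrightarrow> (\<forall>a b. admissible a b \<longrightarrow> outer_le f (box_set g a b) (box_volume a b))"

lemma box_volume_nonneg [simp]: "0 \<le> box_volume a b"
  by (simp add: box_volume_def)

lemma summable_between:
  fixes u v t :: "nat \<Rightarrow> real"
  assumes "summable t" "summable u" "\<And>j. \<bar>v j - u j\<bar> \<le> t j"
  shows "summable v"
proof -
  have "summable (\<lambda>j. v j - u j)"
    by (rule summable_comparison_test'[OF assms(1), of 0]) (use assms(3) in simp)
  from summable_add[OF this assms(2)] show ?thesis by simp
qed

section \<open>Box volumes under changes of the bounds\<close>

text \<open>If the new series of logarithms converges, so does the old one, since the two differ by
  a summable amount; if it does not, the new volume is 0 and there is nothing to prove.\<close>

lemma box_volume_perturb:
  assumes t: "summable t" and le: "\<And>j. \<bar>ln (b' j - a' j) - ln (b j - a j)\<bar> \<le> t j"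
  shows "box_volume a' b' \<le> exp (suminf t) * box_volume a b"
proof (cases "summable (\<lambda>j. ln (b' j - a' j))")
  case True
  have s: "summable (\<lambda>j. ln (b j - a j))"
    by (rule summable_between[OF t True]) (use le in \<open>simp add: abs_minus_commute\<close>)
  have "(\<Sum>j. ln (b' j - a' j)) \<le> (\<Sum>j. t j + ln (b j - a j))"
  proof (rule suminf_le[OF _ True summable_add[OF t s]])
    show "ln (b' j - a' j) \<le> t j + ln (b j - a j)" for j using le[of j] by linarith
  qed
  also have "\<dots> = suminf t + (\<Sum>j. ln (b j - a j))" by (rule suminf_add[OF t s, symmetric])
  finally show ?thesis using True s by (simp add: box_volume_def exp_add[symmetric])
qed (simp add: box_volume_def)

lemma summable_pos_ln_perturb:
  assumes t: "summable t" and le: "\<And>j. \<bar>ln (b' j - a' j) - ln (b j - a j)\<bar> \<le> t j"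
    and "summable (\<lambda>j. max 0 (ln (b j - a j)))"
  shows "summable (\<lambda>j. max 0 (ln (b' j - a' j :: real)))"
proof (rule summable_comparison_test'[of _ 0])
  show "summable (\<lambda>j. t j + max 0 (ln (b j - a j)))" by (rule summable_add) (use assms in auto)
  show "norm (max 0 (ln (b' j - a' j))) \<le> t j + max 0 (ln (b j - a j))" for j
    using le[of j] by (auto simp: max_def)
qed

lemma box_volume_upd:
  assumes "a k < b k" "p < q"
  shows "box_volume (a(k := p)) (b(k := q)) * (b k - a k) = (q - p) * box_volume a b"
proof -
  define d where "d = ln (q - p) - ln (b k - a k)"
  have eq: "(\<lambda>j. ln ((b(k := q)) j - (a(k := p)) j)) = (\<lambda>j. ln (b j - a j) + (if j = k then d else 0))"
    by (auto simp: d_def)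
  have d: "(\<lambda>j. if j = k then d else 0) sums d" using sums_single[of k "\<lambda>_. d"] by simp
  show ?thesis
  proof (cases "summable (\<lambda>j. ln (b j - a j))")
    case True
    note s = sums_add[OF summable_sums[OF True] d]
    have "exp d * (b k - a k) = q - p" using assms by (simp add: d_def exp_diff)
    moreover have "box_volume (a(k := p)) (b(k := q)) = exp d * box_volume a b"
      unfolding box_volume_def eq
      using True sums_summable[OF s] sums_unique[OF s, symmetric] by (simp add: exp_add)
    ultimately show ?thesis by (simp add: mult.assoc mult.commute[of "box_volume a b"])
  next
    case False
    have "\<not> summable (\<lambda>j. ln (b j - a j) + (if j = k then d else 0))"
    proof
      assume "summable (\<lambda>j. ln (b j - a j) + (if j = k then d else 0))"
      from summable_diff[OF this sums_summable[OF d]] show False using False by simp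
    qed
    then have "box_volume (a(k := p)) (b(k := q)) = 0" unfolding box_volume_def eq by simp
    then show ?thesis using False by (simp add: box_volume_def)
  qed
qed

lemma admissible_upd:
  assumes "admissible a b" "p < q"
  shows "admissible (a(k := p)) (b(k := q))"
proof -
  have bd: "bounded (range (x(k := y)))" if "bounded (range x)" for x :: "nat \<Rightarrow> real" and y
    by (rule bounded_subset[of "insert y (range x)"]) (use that in auto)
  let ?u = "\<lambda>j. max 0 (ln (b j - a j))" and ?v = "\<lambda>j. max 0 (ln ((b(k := q)) j - (a(k := p)) j))"
  have "summable ?v \<longleftrightarrow> summable ?u"
    by (rule summable_cong, rule eventually_sequentiallyI[of "Suc k"]) auto
  then show ?thesis using assms bd by (auto simp: admissible_def)
qed

lemma admissible_less: "admissible a b \<Longrightarrow> a j < b j"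
  by (simp add: admissible_def)

section \<open>Calculus of outer content\<close>

lemma outer_le_mono: "outer_le f A v \<Longrightarrow> B \<subseteq> A \<Longrightarrow> v \<le> w \<Longrightarrow> outer_le f B w"
  unfolding outer_le_def by (meson add_right_mono order_trans)

lemma outer_le_closed:
  assumes "\<And>\<epsilon>. \<epsilon> > 0 \<Longrightarrow> outer_le f A (v + \<epsilon>)"
  shows "outer_le f A v"
  unfolding outer_le_def
proof (intro allI impI)
  fix \<epsilon> :: real assume "\<epsilon> > 0"
  then obtain F where "finite F" "\<forall>(a, b)\<in>F. admissible a b" "A \<subseteq> (\<Union>(a, b)\<in>F. box_set f a b)"
    "(\<Sum>(a, b)\<in>F. box_volume a b) \<le> v + \<epsilon> / 2 + \<epsilon> / 2"
    using assms[of "\<epsilon> / 2"] unfolding outer_le_def by (meson half_gt_zero)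
  then show "\<exists>F. finite F \<and> (\<forall>(a, b)\<in>F. admissible a b) \<and>
     A \<subseteq> (\<Union>(a, b)\<in>F. box_set f a b) \<and> (\<Sum>(a, b)\<in>F. box_volume a b) \<le> v + \<epsilon>" by auto
qed

lemma outer_le_box: "admissible a b \<Longrightarrow> outer_le f (box_set f a b) (box_volume a b)"
  unfolding outer_le_def by (intro allI impI exI[of _ "{(a, b)}"]) auto

text \<open>Covers are sets of bounds, so covers of different pieces may share boxes; uniting them
  can only decrease the total volume.\<close>

lemma sum_UN_le:
  fixes g :: "'b \<Rightarrow> real"
  assumes "finite I" "\<And>i. i \<in> I \<Longrightarrow> finite (S i)" "\<And>x. 0 \<le> g x"
  shows "sum g (\<Union>i\<in>I. S i) \<le> (\<Sum>i\<in>I. sum g (S i))"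
  using assms(1,2)
proof (induction I rule: finite_induct)
  case (insert i I)
  have "sum g (\<Union>j\<in>insert i I. S j) + sum g (S i \<inter> (\<Union>j\<in>I. S j)) = sum g (S i) + sum g (\<Union>j\<in>I. S j)"
    using insert by (simp add: sum.union_inter)
  moreover have "0 \<le> sum g (S i \<inter> (\<Union>j\<in>I. S j))" by (intro sum_nonneg assms)
  ultimately show ?case using insert by auto
qed simp

lemma outer_le_trans:
  assumes A: "outer_le g A v" and dom: "dominates f g"
  shows "outer_le f A v"
  unfolding outer_le_def
proof (intro allI impI)
  fix \<epsilon> :: real assume \<epsilon>: "\<epsilon> > 0"
  then obtain F where F: "finite F" "\<forall>(a, b)\<in>F. admissible a b" "A \<subseteq> (\<Union>(a, b)\<in>F. box_set g a b)"
    "(\<Sum>(a, b)\<in>F. box_volume a b) \<le> v + \<epsilon> / 2"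
    using A unfolding outer_le_def by (meson half_gt_zero)
  \<comment> \<open>Half of \<open>\<epsilon>\<close> is distributed over the boxes of
    \<open>F\<close>; the added 1 covers the case of an empty \<open>F\<close>.\<close>
  define \<eta> where "\<eta> = \<epsilon> / (2 * (card F + 1))"
  have \<eta>: "\<eta> > 0" using \<epsilon> by (simp add: \<eta>_def)
  have "\<forall>ab\<in>F. \<exists>G. finite G \<and> (\<forall>(a, b)\<in>G. admissible a b) \<and>
      box_set g (fst ab) (snd ab) \<subseteq> (\<Union>(a, b)\<in>G. box_set f a b) \<and>
      (\<Sum>(a, b)\<in>G. box_volume a b) \<le> box_volume (fst ab) (snd ab) + \<eta>"
  proof
    fix ab assume "ab \<in> F"
    with F(2) have "admissible (fst ab) (snd ab)" by (auto simp: case_prod_beta)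
    then have "outer_le f (box_set g (fst ab) (snd ab)) (box_volume (fst ab) (snd ab))"
      using dom unfolding dominates_def by blast
    then show "\<exists>G. finite G \<and> (\<forall>(a, b)\<in>G. admissible a b) \<and>
        box_set g (fst ab) (snd ab) \<subseteq> (\<Union>(a, b)\<in>G. box_set f a b) \<and>
        (\<Sum>(a, b)\<in>G. box_volume a b) \<le> box_volume (fst ab) (snd ab) + \<eta>"
      using \<eta> unfolding outer_le_def by blast
  qed
  from bchoice[OF this] obtain G where G': "\<forall>ab\<in>F. finite (G ab) \<and> (\<forall>(a, b)\<in>G ab. admissible a b) \<and>
      box_set g (fst ab) (snd ab) \<subseteq> (\<Union>(a, b)\<in>G ab. box_set f a b) \<and>
      (\<Sum>(a, b)\<in>G ab. box_volume a b) \<le> box_volume (fst ab) (snd ab) + \<eta>"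
    by (rule exE)
  have G: "finite (G ab)" "\<forall>(a, b)\<in>G ab. admissible a b"
    "box_set g (fst ab) (snd ab) \<subseteq> (\<Union>(a, b)\<in>G ab. box_set f a b)"
    "(\<Sum>(a, b)\<in>G ab. box_volume a b) \<le> box_volume (fst ab) (snd ab) + \<eta>" if "ab \<in> F" for ab
    using bspec[OF G' that] by blast+
  let ?U = "\<Union>ab\<in>F. G ab"
  have "(\<Sum>(a, b)\<in>?U. box_volume a b) \<le> (\<Sum>ab\<in>F. \<Sum>(a, b)\<in>G ab. box_volume a b)"
    by (rule sum_UN_le) (use F G in auto)
  also have "\<dots> \<le> (\<Sum>ab\<in>F. box_volume (fst ab) (snd ab) + \<eta>)"
    by (rule sum_mono) (rule G(4))
  also have "\<dots> = (\<Sum>(a, b)\<in>F. box_volume a b) + card F * \<eta>"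
    by (simp add: sum.distrib case_prod_beta)
  also have "card F * \<eta> \<le> \<epsilon> / 2"
    using \<epsilon> by (simp add: \<eta>_def field_simps)
  finally have "(\<Sum>(a, b)\<in>?U. box_volume a b) \<le> v + \<epsilon>" using F(4) by simp
  moreover have "A \<subseteq> (\<Union>(a, b)\<in>?U. box_set f a b)"
  proof
    fix x assume "x \<in> A"
    then obtain ab where ab: "ab \<in> F" "x \<in> box_set g (fst ab) (snd ab)" using F(3) by fastforce
    then obtain cd where "cd \<in> G ab" "x \<in> box_set f (fst cd) (snd cd)"
      using subsetD[OF G(3)[OF ab(1)] ab(2)] by (auto simp: case_prod_beta)
    with ab(1) show "x \<in> (\<Union>(a, b)\<in>?U. box_set f a b)" by (auto simp: case_prod_beta)
  qed
  moreover have "finite ?U" using F(1) G(1) by simp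
  moreover have "\<forall>(a, b)\<in>?U. admissible a b" using G(2) by fast
  ultimately show "\<exists>F. finite F \<and> (\<forall>(a, b)\<in>F. admissible a b) \<and>
     A \<subseteq> (\<Union>(a, b)\<in>F. box_set f a b) \<and> (\<Sum>(a, b)\<in>F. box_volume a b) \<le> v + \<epsilon>" by blast
qed

lemma dominates_trans: "dominates f g \<Longrightarrow> dominates g h \<Longrightarrow> dominates f h"
  by (meson dominates_def outer_le_trans)

text \<open>Only the coordinates \<open>k\<close> and \<open>l\<close> change, so the box is a
  planar rectangle times a fixed infinite product, and a planar cover by squares becomes a cover by
  boxes.\<close>

lemma dominates_plane:
  fixes f g :: "nat \<Rightarrow> 'a::real_inner"
  assumes cs: "c\<^sup>2 + s\<^sup>2 = 1" and \<sigma>: "\<sigma>\<^sup>2 = 1" and kl: "k \<noteq> l"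
    and gk: "g k = c *\<^sub>R f k + s *\<^sub>R f l" and gl: "g l = \<sigma> *\<^sub>R (c *\<^sub>R f l - s *\<^sub>R f k)"
    and g: "\<And>j. j \<noteq> k \<Longrightarrow> j \<noteq> l \<Longrightarrow> g j = f j"
  shows "dominates f g"
  unfolding dominates_def outer_le_def
proof (intro allI impI)
  fix a b and \<epsilon> :: real assume ab: "admissible a b" and \<epsilon>: "\<epsilon> > 0"
  \<comment> \<open>The contribution of the remaining coordinates, isolated by giving the sides
    \<open>k\<close> and \<open>l\<close> unit length.\<close>
  define W where "W = box_volume (a(k := 0, l := 0)) (b(k := 1, l := 1))"
  have W: "W \<ge> 0" by (simp add: W_def)
  have vol: "box_volume (a(k := p, l := q)) (b(k := p', l := q')) = (p' - p) * (q' - q) * W"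
    if "p < p'" "q < q'" for p p' q q'
  proof -
    let ?a = "a(k := 0, l := 0)" and ?b = "b(k := 1, l := 1 :: real)"
    have "box_volume (?a(k := p)) (?b(k := p')) = (p' - p) * W"
      using box_volume_upd[of ?a k ?b p p'] kl that by (simp add: W_def)
    moreover have "box_volume (?a(k := p, l := q)) (?b(k := p', l := q')) = (q' - q) * box_volume (?a(k := p)) (?b(k := p'))"
      using box_volume_upd[of "?a(k := p)" l "?b(k := p')" q q'] kl that by simp
    moreover have "?a(k := p, l := q) = a(k := p, l := q)" "?b(k := p', l := q') = b(k := p', l := q')"
      using kl by auto
    ultimately show ?thesis by simp
  qed
  have vab: "box_volume a b = (b k - a k) * (b l - a l) * W"
    using vol[of "a k" "b k" "a l" "b l"] admissible_less[OF ab] by simp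
  \<comment> \<open>The planar error will be multiplied by \<open>W\<close>, which may be 0; hence
    the denominator \<open>W + 1\<close>.\<close>
  have \<epsilon>': "\<epsilon> / (W + 1) > 0" using \<epsilon> W by simp
  obtain h G where h: "h > 0" and G: "finite G"
    and cover: "\<And>p q. a k \<le> c * p + s * q \<Longrightarrow> c * p + s * q < b k \<Longrightarrow> a l \<le> \<sigma> * (c * q - s * p) \<Longrightarrow>
        \<sigma> * (c * q - s * p) < b l \<Longrightarrow> (\<lfloor>p / h\<rfloor>, \<lfloor>q / h\<rfloor>) \<in> G"
    and card: "real (card G) * h\<^sup>2 \<le> (b k - a k) * (b l - a l) + \<epsilon> / (W + 1)"
    using rotated_rectangle_cover[OF cs \<sigma> admissible_less[OF ab] admissible_less[OF ab] \<epsilon>', of k l] by metis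
  define B where "B = (\<lambda>(i::int, j::int). (a(k := i * h, l := j * h), b(k := (i + 1) * h, l := (j + 1) * h)))"
  have volB: "(case B ij of (a, b) \<Rightarrow> box_volume a b) = h\<^sup>2 * W" for ij
    using h by (cases ij) (simp add: B_def vol mult_strict_right_mono power2_eq_square left_diff_distrib[symmetric])
  show "\<exists>F. finite F \<and> (\<forall>(a, b)\<in>F. admissible a b) \<and>
     box_set g a b \<subseteq> (\<Union>(a, b)\<in>F. box_set f a b) \<and> (\<Sum>(a, b)\<in>F. box_volume a b) \<le> box_volume a b + \<epsilon>"
  proof (intro exI[of _ "B ` G"] conjI)
    show "finite (B ` G)" using G by simp
    show "\<forall>(a, b)\<in>B ` G. admissible a b"
      using h by (auto simp: B_def intro!: admissible_upd ab)
    show "box_set g a b \<subseteq> (\<Union>(a, b)\<in>B ` G. box_set f a b)"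
    proof
      fix x assume "x \<in> box_set g a b"
      then have x: "\<And>j. a j \<le> x \<bullet> g j" "\<And>j. x \<bullet> g j < b j" by (auto simp: box_set_def)
      let ?p = "x \<bullet> f k" and ?q = "x \<bullet> f l"
      have gx: "x \<bullet> g k = c * ?p + s * ?q" "x \<bullet> g l = \<sigma> * (c * ?q - s * ?p)"
        by (simp_all add: gk gl inner_add_right inner_diff_right)
      have "(\<lfloor>?p / h\<rfloor>, \<lfloor>?q / h\<rfloor>) \<in> G"
        using cover x[of k] x[of l] unfolding gx by blast
      moreover have "x \<in> (case B (\<lfloor>?p / h\<rfloor>, \<lfloor>?q / h\<rfloor>) of (a, b) \<Rightarrow> box_set f a b)"
      proof -
        have "a j \<le> x \<bullet> f j" "x \<bullet> f j < b j" if "j \<noteq> k" "j \<noteq> l" for j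
          using x[of j] g[OF that] by simp_all
        then show ?thesis using floor_grid[OF h] kl by (auto simp: B_def box_set_def)
      qed
      ultimately show "x \<in> (\<Union>(a, b)\<in>B ` G. box_set f a b)" by (rule UN_I[OF imageI])
    qed
    have "(\<Sum>(a, b)\<in>B ` G. box_volume a b) \<le> (\<Sum>ij\<in>G. case B ij of (a, b) \<Rightarrow> box_volume a b)"
      using sum_image_le[OF G, of "\<lambda>(a, b). box_volume a b" B] by (auto simp: o_def case_prod_beta)
    also have "\<dots> = real (card G) * h\<^sup>2 * W" by (simp add: volB)
    also have "\<dots> \<le> ((b k - a k) * (b l - a l) + \<epsilon> / (W + 1)) * W"
      by (rule mult_right_mono[OF card W])
    also have "\<dots> \<le> box_volume a b + \<epsilon>"
      using W \<epsilon> by (simp add: vab field_simps)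
    finally show "(\<Sum>(a, b)\<in>B ` G. box_volume a b) \<le> box_volume a b + \<epsilon>" .
  qed
qed

lemma onb_plane:
  fixes f g :: "nat \<Rightarrow> 'a::real_inner"
  assumes f: "is_onb f" and cs: "c\<^sup>2 + s\<^sup>2 = 1" and \<sigma>: "\<sigma>\<^sup>2 = 1" and kl: "k \<noteq> l"
    and gk: "g k = c *\<^sub>R f k + s *\<^sub>R f l" and gl: "g l = \<sigma> *\<^sub>R (c *\<^sub>R f l - s *\<^sub>R f k)"
    and g: "\<And>j. j \<noteq> k \<Longrightarrow> j \<noteq> l \<Longrightarrow> g j = f j"
  shows "is_onb g"
proof (rule onbI[OF _ f])
  have e: "g k \<bullet> g k = 1" "g l \<bullet> g l = 1" "g k \<bullet> g l = 0"
    using cs \<sigma> kl by (simp_all add: gk gl inner_add_left inner_add_right inner_diff_left inner_diff_right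
        onb_inner[OF f] power2_eq_square algebra_simps flip: distrib_left)
  have o: "g k \<bullet> g j = 0" "g l \<bullet> g j = 0" if "j \<noteq> k" "j \<noteq> l" for j
    using that by (simp_all add: gk gl g inner_add_left inner_diff_left onb_inner[OF f])
  show "g i \<bullet> g j = (if i = j then 1 else 0)" for i j
  proof (cases "i \<in> {k, l}"; cases "j \<in> {k, l}")
    assume "i \<notin> {k, l}" "j \<notin> {k, l}"
    then show ?thesis by (simp add: g onb_inner[OF f])
  qed (use e o kl in \<open>auto simp: inner_commute\<close>)
  have g_span: "g j \<in> span (range g)" for j by (rule span_base) simp
  show "f j \<in> span (range g)" for j
  proof -
    have \<sigma>2: "\<sigma> * \<sigma> = 1" using \<sigma> by (simp add: power2_eq_square)
    have "c *\<^sub>R g k - (\<sigma> * s) *\<^sub>R g l = (c\<^sup>2 + (\<sigma> * \<sigma>) * s\<^sup>2) *\<^sub>R f k + (c * s - (\<sigma> * \<sigma>) * (c * s)) *\<^sub>R f l"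
      by (simp add: gk gl algebra_simps power2_eq_square)
    then have fk: "f k = c *\<^sub>R g k - (\<sigma> * s) *\<^sub>R g l" using cs \<sigma>2 by simp
    have "s *\<^sub>R g k + (\<sigma> * c) *\<^sub>R g l = (s\<^sup>2 + (\<sigma> * \<sigma>) * c\<^sup>2) *\<^sub>R f l + (c * s - (\<sigma> * \<sigma>) * (c * s)) *\<^sub>R f k"
      by (simp add: gk gl algebra_simps power2_eq_square)
    then have fl: "f l = s *\<^sub>R g k + (\<sigma> * c) *\<^sub>R g l" using cs \<sigma>2 by (simp add: add.commute)
    show ?thesis
    proof (cases "j = k \<or> j = l")
      case True
      then show ?thesis using fk fl g_span by (auto intro!: span_add span_diff span_scale)
    next
      case False
      then show ?thesis using g_span[of j] g[of j] by simp
    qed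
  qed
qed

text \<open>Givens rotations: plane by plane, \<open>f n\<close> is turned into \<open>w\<close>.\<close>

lemma rotate_onb:
  fixes f :: "nat \<Rightarrow> 'a::real_inner"
  assumes "is_onb f" "norm w = 1" "k \<le> n" "\<And>j. k \<le> j \<Longrightarrow> j \<noteq> n \<Longrightarrow> w \<bullet> f j = 0"
  shows "\<exists>g. is_onb g \<and> g n = w \<and> (\<forall>j>n. g j = f j) \<and> dominates f g"
  using assms
proof (induction k arbitrary: f)
  case 0
  define \<sigma> where "\<sigma> = w \<bullet> f n"
  have "(\<lambda>i. (w \<bullet> f i) *\<^sub>R f i) sums w" by (rule onb_expansion[OF 0(1)])
  moreover have "(\<lambda>i. (w \<bullet> f i) *\<^sub>R f i) = (\<lambda>i. if i = n then \<sigma> *\<^sub>R f n else 0)"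
    using 0(4) by (auto simp: \<sigma>_def)
  moreover have "(\<lambda>i. if i = n then \<sigma> *\<^sub>R f n else 0) sums (\<sigma> *\<^sub>R f n)"
    using sums_single[of n "\<lambda>_. \<sigma> *\<^sub>R f n"] by simp
  ultimately have w: "w = \<sigma> *\<^sub>R f n" using sums_unique2 by metis
  then have "\<bar>\<sigma>\<bar> = 1" using 0(1,2) by simp
  then have \<sigma>: "\<sigma>\<^sup>2 = 1" by (metis abs_1 power2_abs power_one)
  \<comment> \<open>No coordinate other than \<open>n\<close> is left, so \<open>w\<close> is
    \<open>f n\<close> up to sign. The sign change is a reflection in the plane of
    \<open>f (Suc n)\<close> and \<open>f n\<close> that leaves \<open>f (Suc n)\<close>
    fixed.\<close>
  define g where "g = f(n := w)"
  have c: "(1::real)\<^sup>2 + 0\<^sup>2 = 1" "Suc n \<noteq> n" by simp_all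
  have g: "g (Suc n) = 1 *\<^sub>R f (Suc n) + 0 *\<^sub>R f n" "g n = \<sigma> *\<^sub>R (1 *\<^sub>R f n - 0 *\<^sub>R f (Suc n))"
    "\<And>j. j \<noteq> Suc n \<Longrightarrow> j \<noteq> n \<Longrightarrow> g j = f j"
    using w by (simp_all add: g_def)
  have "is_onb g" "dominates f g"
    using onb_plane[OF 0(1) c(1) \<sigma> c(2) g] dominates_plane[OF c(1) \<sigma> c(2) g] by blast+
  moreover have "g n = w" "\<forall>j>n. g j = f j" by (simp_all add: g_def)
  ultimately show ?case by blast
next
  case (Suc k)
  define p q r where "p = w \<bullet> f k" and "q = w \<bullet> f n" and "r = sqrt (p\<^sup>2 + q\<^sup>2)"
  have kn: "n \<noteq> k" "k \<le> n" using Suc.prems(3) by simp_all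
  show ?case
  proof (cases "r = 0")
    case True
    then have "p = 0" by (simp add: r_def add_nonneg_eq_0_iff)
    then have "w \<bullet> f j = 0" if "k \<le> j" "j \<noteq> n" for j
      using Suc.prems(4)[of j] that by (cases "j = k") (auto simp: p_def)
    from Suc.IH[OF Suc.prems(1,2) kn(2) this] show ?thesis .
  next
    case False
    have r2: "r\<^sup>2 = p\<^sup>2 + q\<^sup>2" by (simp add: r_def)
    \<comment> \<open>The rotation in the plane of \<open>f n\<close> and \<open>f k\<close> that
      moves the whole component of \<open>w\<close> onto the new vector \<open>n\<close>, so that
      \<open>w\<close> becomes orthogonal to the new vector \<open>k\<close>.\<close>
    define c s where "c = q / r" and "s = p / r"
    have "c\<^sup>2 + s\<^sup>2 = (p\<^sup>2 + q\<^sup>2) / r\<^sup>2"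
      by (simp add: c_def s_def power_divide add_divide_distrib)
    then have cs: "c\<^sup>2 + s\<^sup>2 = 1" using False unfolding r2[symmetric] by simp
    define g where "g = f(n := c *\<^sub>R f n + s *\<^sub>R f k, k := 1 *\<^sub>R (c *\<^sub>R f k - s *\<^sub>R f n))"
    have g: "g n = c *\<^sub>R f n + s *\<^sub>R f k" "g k = 1 *\<^sub>R (c *\<^sub>R f k - s *\<^sub>R f n)"
      "\<And>j. j \<noteq> n \<Longrightarrow> j \<noteq> k \<Longrightarrow> g j = f j"
      using kn by (simp_all add: g_def)
    have one: "(1::real)\<^sup>2 = 1" by simp
    have onb: "is_onb g" and dom: "dominates f g"
      using onb_plane[OF Suc.prems(1) cs one kn(1) g] dominates_plane[OF cs one kn(1) g] by auto
    have "w \<bullet> g k = 0"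
      by (simp add: g inner_diff_right c_def s_def flip: p_def q_def)
    then have "w \<bullet> g j = 0" if "k \<le> j" "j \<noteq> n" for j
      using Suc.prems(4)[of j] g(3)[of j] that by (cases "j = k") auto
    from Suc.IH[OF onb Suc.prems(2) kn(2) this] obtain h
      where h: "is_onb h" "h n = w" "\<forall>j>n. h j = g j" "dominates g h" by blast
    have "\<forall>j>n. h j = f j" using h(3) g(3) kn by auto
    with h dominates_trans[OF dom h(4)] show ?thesis by blast
  qed
qed

section \<open>Slanted boxes\<close>

lemma bounded_range_finite_modification:
  fixes a a' :: "nat \<Rightarrow> real"
  assumes "bounded (range a)" "\<And>j. j > n \<Longrightarrow> a' j = a j"
  shows "bounded (range a')"
proof (rule bounded_subset)
  show "bounded (a' ` {..n} \<union> range a)" using assms(1) by (simp add: finite_imp_bounded)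
  show "range a' \<subseteq> a' ` {..n} \<union> range a"
  proof
    fix y assume "y \<in> range a'"
    then obtain j where "y = a' j" by blast
    then show "y \<in> a' ` {..n} \<union> range a"
      using assms(2)[of j] by (cases "j \<le> n") auto
  qed
qed

lemma abs_ln_add_diff:
  fixes x d \<kappa> :: real
  assumes "0 < \<kappa>" "\<kappa> \<le> x" "0 \<le> d"
  shows "\<bar>ln (x + d) - ln x\<bar> \<le> d / \<kappa>"
proof -
  have "ln x \<le> ln (x + d)" using assms by simp
  moreover have "ln (x + d) - ln x = ln (1 + d / x)"
    using assms by (subst ln_divide_pos[symmetric]) (simp_all add: add_divide_distrib)
  moreover have "ln (1 + d / x) \<le> d / x" by (rule ln_add_one_self_le_self) (use assms in simp)
  moreover have "d / x \<le> d / \<kappa>" using assms by (intro divide_left_mono) auto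
  ultimately show ?thesis by linarith
qed

text \<open>The left side is half of \<bar>ln (1 + u)\<bar> with u =
  \<open>w \<bullet> w - 1\<close>; the quadratic remainder is at most \<bar>u\<bar> / 2 in this
  range, so the factor 1/2 leaves room.\<close>

lemma abs_ln_norm_le:
  fixes w :: "'a::real_inner"
  assumes "\<bar>w \<bullet> w - 1\<bar> \<le> 1 / 4"
  shows "\<bar>ln (norm w)\<bar> \<le> \<bar>w \<bullet> w - 1\<bar>"
proof -
  define u where "u = w \<bullet> w - 1"
  have u: "\<bar>u\<bar> \<le> 1 / 4" using assms by (simp add: u_def)
  have "\<bar>u\<bar> * \<bar>u\<bar> \<le> \<bar>u\<bar> * (1 / 4)" by (rule mult_left_mono) (use u in auto)
  then have "u\<^sup>2 \<le> \<bar>u\<bar> * (1 / 4)" by (simp add: power2_eq_square)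
  moreover have "\<bar>ln (1 + u) - u\<bar> \<le> 2 * u\<^sup>2"
    by (rule abs_ln_one_plus_x_minus_x_bound) (use u in simp)
  moreover have "norm w > 0" using assms by (cases "w = 0") auto
  moreover have "ln (1 + u) = ln ((norm w)\<^sup>2)" by (simp add: u_def power2_norm_eq_inner)
  ultimately show ?thesis using u unfolding u_def[symmetric] by (simp add: ln_realpow)
qed

text \<open>The vectors \<open>v i\<close>, \<open>i < n\<close>, form an almost orthonormal basis of the span of the first \<open>n\<close>
  basis vectors, so this is a bound for the volume of an \<open>n\<close>-dimensional parallelepiped; it is
  proved by Gram--Schmidt, where \<open>\<rho>\<close> bounds the total of all enlargements still to be made.\<close>

lemma outer_le_slanted_box:
  fixes f v :: "nat \<Rightarrow> 'a::real_inner"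
  assumes "is_onb f" "admissible a b"
    and "\<And>i. n \<le> i \<Longrightarrow> v i = f i" "\<And>i j. i < n \<Longrightarrow> n \<le> j \<Longrightarrow> v i \<bullet> f j = 0"
    and "(\<Sum>i<n. \<Sum>k<n. \<bar>v i \<bullet> v k - (if i = k then 1 else 0)\<bar>) \<le> \<rho>" "\<rho> \<le> 1 / 4"
    and \<kappa>: "\<kappa> > 0" and "\<And>i. i < n \<Longrightarrow> \<kappa> \<le> b i - a i"
    and "\<And>i. i < n \<Longrightarrow> - (K - 2 * K * \<rho>) \<le> a i" "\<And>i. i < n \<Longrightarrow> b i \<le> K - 2 * K * \<rho>"
    and K: "K \<ge> 0"
  shows "outer_le f (box_set v a b) (exp ((4 * K / \<kappa> + 1) * \<rho>) * box_volume a b)"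
  using assms(1-6,8-10)
proof (induction n arbitrary: f v a b \<rho>)
  case 0
  have "v = f" using 0(3) by auto
  moreover have "1 \<le> exp ((4 * K / \<kappa> + 1) * \<rho>)" using 0(5) K \<kappa> by simp
  then have "box_volume a b \<le> exp ((4 * K / \<kappa> + 1) * \<rho>) * box_volume a b"
    using mult_right_mono[of 1 _ "box_volume a b"] by simp
  ultimately show ?case using outer_le_mono[OF outer_le_box[OF 0(2)] subset_refl] by blast
next
  case (Suc n)
  define w where "w = v n"
  define R where "R = \<bar>w \<bullet> w - 1\<bar>"
  define r where "r i = \<bar>v i \<bullet> w\<bar>" for i
  define s where "s = (\<Sum>i<n. r i)"
  define S where "S = (\<Sum>i<n. \<Sum>k<n. \<bar>v i \<bullet> v k - (if i = k then 1 else 0)\<bar>)"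
  \<comment> \<open>The row and column of \<open>w\<close> contribute \<open>2 * s + R\<close> to
    the budget. One \<open>s\<close> pays for the growth of the other Gram entries;
    \<open>s + R\<close> pays for the enlargement of the box in the present step.\<close>
  define \<rho>' where "\<rho>' = \<rho> - s - R"
  have r0: "r i \<ge> 0" for i by (simp add: r_def)
  have s0: "s \<ge> 0" unfolding s_def by (rule sum_nonneg) (rule r0)
  have S0: "S \<ge> 0" unfolding S_def by (intro sum_nonneg) simp
  have R0: "R \<ge> 0" by (simp add: R_def)
  have "(\<Sum>i<Suc n. \<Sum>k<Suc n. \<bar>v i \<bullet> v k - (if i = k then 1 else 0)\<bar>) = S + 2 * s + R"
  proof -
    have "(\<Sum>i<n. \<bar>v i \<bullet> v n - (if i = n then 1 else 0)\<bar>) = s"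
      unfolding s_def r_def w_def by (intro sum.cong) auto
    moreover have "(\<Sum>k<n. \<bar>v n \<bullet> v k - (if n = k then 1 else 0)\<bar>) = s"
      unfolding s_def r_def w_def by (intro sum.cong) (auto simp: inner_commute)
    ultimately show ?thesis by (simp add: S_def R_def w_def sum.distrib)
  qed
  then have tot: "S + 2 * s + R \<le> \<rho>" using Suc.prems(5) by simp
  have R4: "R \<le> 1 / 4" and s8: "s \<le> 1 / 8" using tot S0 s0 R0 Suc.prems(6) by linarith+
  have ww: "3 / 4 \<le> w \<bullet> w" using R4 unfolding R_def by linarith
  then have w0: "w \<noteq> 0" by auto
  then have nw: "norm w > 0" by simp
  have wf: "w \<bullet> f j = 0" if "j > n" for j using Suc.prems(4)[of n j] that by (simp add: w_def)
  have "\<exists>g. is_onb g \<and> g n = w /\<^sub>R norm w \<and> (\<forall>j>n. g j = f j) \<and> dominates f g"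
    by (rule rotate_onb[OF Suc.prems(1), of _ n]) (use nw wf in auto)
  then obtain g where g: "is_onb g" "g n = w /\<^sub>R norm w" "\<And>j. j > n \<Longrightarrow> g j = f j" "dominates f g"
    by blast
  define v' where "v' i = (if i < n then v i - ((v i \<bullet> w) / (w \<bullet> w)) *\<^sub>R w else g i)" for i
  \<comment> \<open>Removing the \<open>w\<close> component changes \<open>x \<bullet> v i\<close>
    by at most \<open>2 * K * r i\<close>, because \<bar>\<open>x \<bullet> w\<close>\<bar> \<le>
    \<open>K\<close> and \<open>w \<bullet> w\<close> \<ge> 1/2. Side \<open>n\<close> is merely
    rescaled to the normalized vector.\<close>
  define a' where "a' i = (if i < n then a i - 2 * K * r i else if i = n then a n / norm w else a i)" for i
  define b' where "b' i = (if i < n then b i + 2 * K * r i else if i = n then b n / norm w else b i)" for i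
  \<comment> \<open>Bounds for the changes of the logarithms: a side of length at least
    \<open>\<kappa>\<close> grows by \<open>4 * K * r i\<close>, and normalizing \<open>w\<close>
    costs at most \<open>R\<close>.\<close>
  define t where "t i = (if i < n then 4 * K * r i / \<kappa> else if i = n then R else 0)" for i
  have "(\<Sum>i\<in>{..n}. t i) = (\<Sum>i<n. 4 * K / \<kappa> * r i) + R"
    by (simp add: lessThan_Suc_atMost[symmetric] t_def)
  then have "(\<Sum>i\<in>{..n}. t i) = 4 * K / \<kappa> * s + R" by (simp add: s_def sum_distrib_left)
  then have t_sums: "t sums (4 * K / \<kappa> * s + R)"
    using sums_finite[of "{..n}" t] by (simp add: t_def)
  have ab: "a i < b i" for i by (rule admissible_less[OF Suc.prems(2)])
  have t: "\<bar>ln (b' j - a' j) - ln (b j - a j)\<bar> \<le> t j" for j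
  proof -
    consider "j < n" | "j = n" | "j > n" by linarith
    then show ?thesis
    proof cases
      case 1
      have "\<bar>ln ((b j - a j) + 4 * K * r j) - ln (b j - a j)\<bar> \<le> 4 * K * r j / \<kappa>"
        using 1 Suc.prems(7)[of j] \<kappa> K r0 by (intro abs_ln_add_diff) auto
      then show ?thesis using 1 by (simp add: a'_def b'_def t_def algebra_simps)
    next
      case 2
      have "ln (b' n - a' n) = ln (b n - a n) - ln (norm w)"
        using nw ab[of n] by (simp add: a'_def b'_def ln_div flip: diff_divide_distrib)
      then show ?thesis using 2 abs_ln_norm_le[of w] R4 by (simp add: t_def R_def)
    qed (simp add: a'_def b'_def t_def)
  qed
  have adm: "admissible a' b'"
    unfolding admissible_def
  proof (intro conjI allI)
    show "bounded (range a')"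
      by (rule bounded_range_finite_modification[of a n])
         (use Suc.prems(2) in \<open>simp_all add: admissible_def a'_def\<close>)
    show "bounded (range b')"
      by (rule bounded_range_finite_modification[of b n])
         (use Suc.prems(2) in \<open>simp_all add: admissible_def b'_def\<close>)
    show "a' j < b' j" for j
      using ab[of j] nw mult_nonneg_nonneg[OF K r0, of j] by (auto simp: a'_def b'_def divide_strict_right_mono)
    show "summable (\<lambda>j. max 0 (ln (b' j - a' j)))"
      using summable_pos_ln_perturb[OF sums_summable[OF t_sums] t] Suc.prems(2)
      by (simp add: admissible_def)
  qed
  have gram: "(\<Sum>i<n. \<Sum>k<n. \<bar>v' i \<bullet> v' k - (if i = k then 1 else 0)\<bar>) \<le> \<rho>'"
  proof -
    have "\<bar>v' i \<bullet> v' k - (if i = k then 1 else 0)\<bar> \<le>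
        \<bar>v i \<bullet> v k - (if i = k then 1 else 0)\<bar> + 2 * (r i * r k)" if "i < n" "k < n" for i k
    proof -
      have "v' i \<bullet> v' k = v i \<bullet> v k - (v i \<bullet> w) * (v k \<bullet> w) / (w \<bullet> w)"
        using w0 that by (simp add: v'_def inner_diff_left inner_diff_right inner_commute field_simps)
      moreover have "\<bar>(v i \<bullet> w) * (v k \<bullet> w) / (w \<bullet> w)\<bar> \<le> 2 * (r i * r k)"
      proof -
        have "\<bar>(v i \<bullet> w) * (v k \<bullet> w) / (w \<bullet> w)\<bar> = r i * r k / (w \<bullet> w)"
          using ww by (simp add: r_def abs_mult)
        also have "\<dots> \<le> r i * r k / (1 / 2)"
          using ww r0 by (intro divide_left_mono) auto
        finally show ?thesis by simp
      qed
      ultimately show ?thesis by linarith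
    qed
    then have "(\<Sum>i<n. \<Sum>k<n. \<bar>v' i \<bullet> v' k - (if i = k then 1 else 0)\<bar>) \<le>
        (\<Sum>i<n. \<Sum>k<n. \<bar>v i \<bullet> v k - (if i = k then 1 else 0)\<bar> + 2 * (r i * r k))"
      by (intro sum_mono) auto
    also have "\<dots> = S + 2 * (s * s)"
      by (simp add: S_def s_def sum.distrib sum_product flip: sum_distrib_left)
    also have "2 * (s * s) \<le> s" using mult_right_mono[OF s8 s0] s0 by linarith
    finally show ?thesis using tot by (simp add: \<rho>'_def)
  qed
  \<comment> \<open>The bounds keep a distance \<open>2 * K * \<rho>\<close> from \<open>K\<close>.
    Passing to \<open>\<rho>'\<close> releases \<open>2 * K * (s + R)\<close> of it, enough for the
    shift of every end, so \<bar>\<open>x \<bullet> w\<close>\<bar> \<le> \<open>K\<close> will hold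
    again at each later step.\<close>
  have Kr: "2 * K * \<rho> - 2 * K * \<rho>' = 2 * K * s + 2 * K * R" by (simp add: \<rho>'_def algebra_simps)
  have rs: "2 * K * r i \<le> 2 * K * s" if "i < n" for i
    unfolding s_def using that K r0 by (intro mult_left_mono member_le_sum) auto
  have KR: "0 \<le> 2 * K * R" using K R0 by simp
  have "outer_le g (box_set v' a' b') (exp ((4 * K / \<kappa> + 1) * \<rho>') * box_volume a' b')"
  proof (rule Suc.IH[OF g(1) adm _ _ gram])
    show "v' i = g i" if "n \<le> i" for i using that by (simp add: v'_def)
    show "v' i \<bullet> g j = 0" if "i < n" "n \<le> j" for i j
    proof (cases "j = n")
      case True
      then show ?thesis using that w0 g(2) by (simp add: v'_def inner_diff_left)
    next
      case False
      then show ?thesis using that wf Suc.prems(4)[of i j] g(3) by (simp add: v'_def inner_diff_left)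
    qed
    show "\<rho>' \<le> 1 / 4" using Suc.prems(6) s0 R0 by (simp add: \<rho>'_def)
    show "\<kappa> \<le> b' i - a' i" if "i < n" for i
      using that Suc.prems(7)[of i] mult_nonneg_nonneg[OF K r0, of i] by (simp add: a'_def b'_def)
    show "- (K - 2 * K * \<rho>') \<le> a' i" if "i < n" for i
      using that Suc.prems(8)[of i] Kr rs[of i] KR by (simp add: a'_def)
    show "b' i \<le> K - 2 * K * \<rho>'" if "i < n" for i
      using that Suc.prems(9)[of i] Kr rs[of i] KR by (simp add: b'_def)
  qed
  from outer_le_trans[OF this g(4)]
  have *: "outer_le f (box_set v' a' b') (exp ((4 * K / \<kappa> + 1) * \<rho>') * box_volume a' b')" .
  show ?case
  proof (rule outer_le_mono[OF *])
    show "box_set v a b \<subseteq> box_set v' a' b'"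
    proof
      fix x assume "x \<in> box_set v a b"
      then have x: "a j \<le> x \<bullet> v j" "x \<bullet> v j < b j" for j by (auto simp: box_set_def)
      have "a' j \<le> x \<bullet> v' j \<and> x \<bullet> v' j < b' j" for j
      proof -
        consider "j < n" | "j = n" | "j > n" by linarith
        then show ?thesis
        proof cases
          case 1
          have "\<rho> \<ge> 0" using tot S0 s0 R0 by linarith
          then have "0 \<le> 2 * K * \<rho>" using K by simp
          then have xw: "\<bar>x \<bullet> w\<bar> \<le> K"
            using x[of n] Suc.prems(8,9)[of n] by (simp add: w_def abs_le_iff)
          have "\<bar>(v j \<bullet> w) / (w \<bullet> w) * (x \<bullet> w)\<bar> = r j * \<bar>x \<bullet> w\<bar> / (w \<bullet> w)"
            using ww by (simp add: r_def abs_mult)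
          also have "\<dots> \<le> r j * K / (1 / 2)"
            using ww xw r0 K by (intro frac_le mult_left_mono mult_nonneg_nonneg) auto
          finally have "\<bar>(v j \<bullet> w) / (w \<bullet> w) * (x \<bullet> w)\<bar> \<le> 2 * K * r j" by (simp add: mult_ac)
          then show ?thesis using 1 x[of j] unfolding abs_le_iff
            by (simp add: v'_def a'_def b'_def inner_diff_right)
        next
          case 2
          then show ?thesis using x[of n] nw g(2)
            by (simp add: v'_def a'_def b'_def w_def divide_simps mult.commute)
        next
          case 3
          then show ?thesis using x[of j] g(3) Suc.prems(3)[of j] by (simp add: v'_def a'_def b'_def)
        qed
      qed
      then show "x \<in> box_set v' a' b'" by (simp add: box_set_def)
    qed
    have "box_volume a' b' \<le> exp (4 * K / \<kappa> * s + R) * box_volume a b"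
      using box_volume_perturb[OF sums_summable[OF t_sums] t] sums_unique[OF t_sums] by simp
    also have "exp (4 * K / \<kappa> * s + R) \<le> exp ((4 * K / \<kappa> + 1) * (\<rho> - \<rho>'))"
    proof -
      have "0 \<le> 4 * K / \<kappa> * R" using K \<kappa> R0 by simp
      then show ?thesis using s0 by (simp add: \<rho>'_def distrib_right distrib_left)
    qed
    finally have "box_volume a' b' \<le> exp ((4 * K / \<kappa> + 1) * (\<rho> - \<rho>')) * box_volume a b"
      by (simp add: mult_right_mono)
    then have "exp ((4 * K / \<kappa> + 1) * \<rho>') * box_volume a' b' \<le>
        exp ((4 * K / \<kappa> + 1) * \<rho>') * (exp ((4 * K / \<kappa> + 1) * (\<rho> - \<rho>')) * box_volume a b)"
      by (rule mult_left_mono) simp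
    also have "\<dots> = exp ((4 * K / \<kappa> + 1) * \<rho>) * box_volume a b"
      by (simp add: exp_add[symmetric] mult.assoc[symmetric] distrib_left[symmetric])
    finally show "exp ((4 * K / \<kappa> + 1) * \<rho>') * box_volume a' b' \<le> exp ((4 * K / \<kappa> + 1) * \<rho>) * box_volume a b" .
  qed
qed

section \<open>Matching two equivalent bases\<close>

text \<open>\<open>sums\<close> depends on the order of the terms, \<open>has_sum\<close> does not;
  the permutation is carried out there.\<close>

lemma sums_reindex_bij_nonneg:
  fixes f :: "nat \<Rightarrow> real"
  assumes \<pi>: "bij \<pi>" and f: "f sums s" "\<And>i. 0 \<le> f i"
  shows "(\<lambda>i. f (\<pi> i)) sums s"
proof -
  have "(f has_sum s) UNIV" using f by (intro sums_nonneg_imp_has_sum) auto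
  then have "((\<lambda>i. f (\<pi> i)) has_sum s) UNIV"
    using has_sum_reindex_bij_betw[of \<pi> UNIV UNIV f s] \<pi> by simp
  then show ?thesis by (rule has_sum_imp_sums)
qed

lemma sums_reindex_bij_abs:
  fixes f :: "nat \<Rightarrow> real"
  assumes \<pi>: "bij \<pi>" and f: "summable (\<lambda>i. \<bar>f i\<bar>)"
  shows "(\<lambda>i. f (\<pi> i)) sums suminf f"
proof -
  have "(f has_sum suminf f) UNIV" using f summable_rabs_cancel[OF f]
    by (intro norm_summable_imp_has_sum) (auto intro: summable_sums)
  then have "((\<lambda>i. f (\<pi> i)) has_sum suminf f) UNIV"
    using has_sum_reindex_bij_betw[of \<pi> UNIV UNIV f] \<pi> by simp
  then show ?thesis by (rule has_sum_imp_sums)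
qed

lemma onb_signed_permutation:
  fixes e :: "nat \<Rightarrow> 'a::real_inner"
  assumes e: "is_onb e" and \<pi>: "bij \<pi>" and \<sigma>: "\<And>j. \<bar>\<sigma> j\<bar> = 1"
  shows "is_onb (\<lambda>j. \<sigma> j *\<^sub>R e (\<pi> j))"
proof (rule onbI[OF _ e])
  have \<sigma>2: "\<sigma> j * \<sigma> j = 1" for j using \<sigma>[of j] by (metis abs_mult_self_eq mult_1)
  show "\<sigma> i *\<^sub>R e (\<pi> i) \<bullet> \<sigma> j *\<^sub>R e (\<pi> j) = (if i = j then 1 else 0)" for i j
    using \<pi> \<sigma>2 by (auto simp: onb_inner[OF e] bij_def inj_eq)
  show "e j \<in> span (range (\<lambda>j. \<sigma> j *\<^sub>R e (\<pi> j)))" for j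
  proof -
    obtain k where k: "j = \<pi> k" using \<pi> by (metis bij_pointE)
    have "\<sigma> k *\<^sub>R (\<sigma> k *\<^sub>R e (\<pi> k)) \<in> span (range (\<lambda>j. \<sigma> j *\<^sub>R e (\<pi> j)))"
      by (intro span_scale span_base) auto
    then show ?thesis by (simp add: \<sigma>2 k)
  qed
qed

text \<open>Double counting of the squared coefficients: outside the almost unit entries \<open>c (m j) j\<close>
  both the rows in \<open>T\<close> and the first \<open>J\<close> columns carry all their mass in the block
  \<open>T \<times> {..<J}\<close>.\<close>

lemma unmatched_card:
  fixes c :: "nat \<Rightarrow> nat \<Rightarrow> real" and \<epsilon> :: "nat \<Rightarrow> real"
  assumes rows: "\<And>i. (\<lambda>j. (c i j)\<^sup>2) sums 1" and cols: "\<And>j. (\<lambda>i. (c i j)\<^sup>2) sums 1"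
    and \<epsilon>: "\<And>j. 0 \<le> \<epsilon> j" "summable \<epsilon>" "suminf \<epsilon> \<le> 1 / 4"
    and m: "inj_on m {J..}" "\<And>j. J \<le> j \<Longrightarrow> 1 - 2 * \<epsilon> j \<le> (c (m j) j)\<^sup>2"
  shows "finite (- m ` {J..}) \<and> card (- m ` {J..}) = J"
proof -
  let ?T = "- m ` {J..}"
  have col_le: "(\<Sum>i\<in>I. (c i j)\<^sup>2) \<le> 1" if "finite I" for I j
    using sum_le_suminf[OF sums_summable[OF cols[of j]] that] sums_unique[OF cols[of j]] by simp
  have row_le: "(\<Sum>j\<in>I. (c i j)\<^sup>2) \<le> 1" if "finite I" for I i
    using sum_le_suminf[OF sums_summable[OF rows[of i]] that] sums_unique[OF rows[of i]] by simp
  have upper: "card T' \<le> J" if T': "T' \<subseteq> ?T" "finite T'" for T'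
  proof -
    define q where "q j = (\<Sum>i\<in>T'. (c i j)\<^sup>2)" for j
    have "q sums (\<Sum>i\<in>T'. 1)" unfolding q_def by (intro sums_sum rows)
    then have q: "q sums real (card T')" by simp
    have q1: "q j \<le> 1" for j unfolding q_def by (rule col_le[OF T'(2)])
    have q2: "q j \<le> 2 * \<epsilon> j" if "J \<le> j" for j
    proof -
      have "q j + (c (m j) j)\<^sup>2 = (\<Sum>i\<in>insert (m j) T'. (c i j)\<^sup>2)"
        using T' that by (subst sum.insert) (auto simp: q_def)
      also have "\<dots> \<le> 1" by (rule col_le) (use T' in simp)
      finally show ?thesis using m(2)[OF that] by linarith
    qed
    have le: "q j \<le> (if j < J then 1 else 0) + 2 * \<epsilon> j" for j
      using q1[of j] q2[of j] \<epsilon>(1)[of j] by auto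
    have "(\<lambda>j. if j < J then 1 else 0 :: real) sums real J"
      using sums_If_finite_set[of "{..<J}" "\<lambda>_. 1::real"] by simp
    then have "(\<lambda>j. (if j < J then 1 else 0) + 2 * \<epsilon> j) sums (real J + 2 * suminf \<epsilon>)"
      by (intro sums_add sums_mult summable_sums \<epsilon>(2))
    \<comment> \<open>The surplus \<open>2 * suminf \<epsilon>\<close> is at most 1/2, so
      integrality removes it.\<close>
    from sums_le[OF le q this] have "real (card T') \<le> real J + 2 * suminf \<epsilon>" .
    then show ?thesis using \<epsilon>(3) by linarith
  qed
  have fin: "finite ?T"
    by (rule conjunct1[OF finite_if_finite_subsets_card_bdd]) (rule upper)
  have "real J \<le> real (card ?T) + 2 * suminf \<epsilon>"
  proof -
    define q where "q i = (\<Sum>j<J. (c i j)\<^sup>2)" for i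
    have "q sums (\<Sum>j<J. 1)" unfolding q_def by (intro sums_sum cols)
    then have q: "q sums real J" by simp
    have q1: "q i \<le> 1" for i unfolding q_def by (rule row_le) simp
    have q2: "q (m j) \<le> 2 * \<epsilon> j" if "J \<le> j" for j
    proof -
      have "q (m j) + (c (m j) j)\<^sup>2 = (\<Sum>j'\<in>insert j {..<J}. (c (m j) j')\<^sup>2)"
        using that by (subst sum.insert) (auto simp: q_def)
      also have "\<dots> \<le> 1" by (rule row_le) simp
      finally show ?thesis using m(2)[OF that] by linarith
    qed
    \<comment> \<open>A row below \<open>n\<close> is either unmatched, with mass at most 1 in the
      first \<open>J\<close> columns, or of the form \<open>m j\<close>, with mass at most
      \<open>2 * \<epsilon> j\<close> there.\<close>
    have "(\<Sum>i<n. q i) \<le> real (card ?T) + 2 * suminf \<epsilon>" for n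
    proof -
      define B where "B = {j. J \<le> j \<and> m j < n}"
      have injB: "inj_on m B" by (rule inj_on_subset[OF m(1)]) (auto simp: B_def)
      have "m ` B \<subseteq> {..<n}" by (auto simp: B_def)
      then have finmB: "finite (m ` B)" by (rule finite_subset) simp
      then have finB: "finite B" by (rule finite_imageD[OF _ injB])
      have "{..<n} = ({..<n} \<inter> ?T) \<union> m ` B" by (auto simp: B_def)
      from arg_cong[OF this, of "sum q"]
      have "(\<Sum>i<n. q i) = (\<Sum>i\<in>({..<n} \<inter> ?T) \<union> m ` B. q i)" .
      also have "\<dots> = (\<Sum>i\<in>{..<n} \<inter> ?T. q i) + (\<Sum>i\<in>m ` B. q i)"
        by (rule sum.union_disjoint) (use finmB in \<open>auto simp: B_def\<close>)
      also have "(\<Sum>i\<in>{..<n} \<inter> ?T. q i) \<le> (\<Sum>i\<in>{..<n} \<inter> ?T. 1)" by (rule sum_mono) (rule q1)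
      also have "\<dots> \<le> real (card ?T)" by (simp add: card_mono[OF fin])
      also have "(\<Sum>i\<in>m ` B. q i) = (\<Sum>j\<in>B. q (m j))" by (rule sum.reindex_cong[OF injB refl refl])
      also have "\<dots> \<le> (\<Sum>j\<in>B. 2 * \<epsilon> j)" by (rule sum_mono) (auto simp: B_def q2)
      also have "\<dots> \<le> 2 * suminf \<epsilon>"
        using sum_le_suminf[OF \<epsilon>(2) finB] \<epsilon>(1) by (simp add: sum_distrib_left[symmetric])
      finally show ?thesis by simp
    qed
    then have "suminf q \<le> real (card ?T) + 2 * suminf \<epsilon>"
      by (rule suminf_le_const[OF sums_summable[OF q]])
    then show ?thesis using sums_unique[OF q] by simp
  qed
  then have "J \<le> card ?T" using \<epsilon>(3) by linarith
  with upper[OF subset_refl fin] fin show ?thesis by simp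
qed

text \<open>If every entry were below \<open>1 - \<epsilon>\<close>, the terms
  \<bar>\<open>c i\<close>\<bar> * (1 - \<epsilon> - \<bar>\<open>c i\<close>\<bar>) would be
  nonnegative, yet by the two given sums they add up to \<open>- (\<epsilon> * \<epsilon>)\<close>.
  Hence all vanish, and so does \<open>c\<close>, against its unit l2 norm.\<close>

lemma near_unit_entry:
  fixes c :: "nat \<Rightarrow> real"
  assumes l1: "(\<lambda>i. \<bar>c i\<bar>) sums (1 + \<epsilon>)" and l2: "(\<lambda>i. (c i)\<^sup>2) sums 1"
  shows "\<exists>i. 1 - \<epsilon> \<le> \<bar>c i\<bar>"
proof (rule ccontr)
  assume "\<nexists>i. 1 - \<epsilon> \<le> \<bar>c i\<bar>"
  then have lt: "\<bar>c i\<bar> < 1 - \<epsilon>" for i by (simp add: not_le)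
  define d where "d i = (1 - \<epsilon>) * \<bar>c i\<bar> - (c i)\<^sup>2" for i
  have d: "d sums ((1 - \<epsilon>) * (1 + \<epsilon>) - 1)"
    unfolding d_def by (intro sums_diff sums_mult l1 l2)
  have d_eq: "d i = \<bar>c i\<bar> * (1 - \<epsilon> - \<bar>c i\<bar>)" for i
    by (simp add: d_def algebra_simps power2_eq_square)
  have d0: "0 \<le> d i" for i unfolding d_eq using lt[of i] by simp
  have "suminf d = - (\<epsilon> * \<epsilon>)" using sums_unique[OF d, symmetric] by (simp add: algebra_simps)
  then have "suminf d \<le> 0" using zero_le_square[of \<epsilon>] by linarith
  moreover have "suminf d \<ge> 0" by (rule suminf_nonneg[OF sums_summable[OF d] d0])
  ultimately have "\<forall>i. d i = 0"
    using suminf_eq_zero_iff[OF sums_summable[OF d] d0] by simp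
  then have "c i = 0" for i using lt[of i] unfolding d_eq by fastforce
  then show False using sums_unique2[OF l2, of 0] by simp
qed

text \<open>All but finitely many columns have small defect and thus an entry close to 1 in absolute
  value. The rows of these entries leave exactly \<open>J\<close> rows free, which is what allows
  the matching to be completed to a permutation.\<close>

lemma onb_matching:
  fixes e f :: "nat \<Rightarrow> 'a::real_inner"
  assumes ef: "(e, f) \<in> onb_rel" and \<delta>: "\<delta> > 0"
  obtains J :: nat and \<pi> :: "nat \<Rightarrow> nat" and \<sigma> \<eta> :: "nat \<Rightarrow> real" where
    "bij \<pi>" "\<And>j. \<bar>\<sigma> j\<bar> = 1" "\<And>j. 0 \<le> \<eta> j" "\<And>j. j < J \<Longrightarrow> \<eta> j = 0" "summable \<eta>" "suminf \<eta> \<le> \<delta>"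
    "\<And>j. J \<le> j \<Longrightarrow> (\<lambda>i. \<bar>\<sigma> i *\<^sub>R e (\<pi> i) \<bullet> f j - (if i = j then 1 else 0)\<bar>) sums \<eta> j"
proof -
  have e: "is_onb e" and f: "is_onb f" using onb_relD[OF ef] by auto
  define c where "c i j = e i \<bullet> f j" for i j
  define \<epsilon>0 where "\<epsilon>0 j = enn2real (defect e f j)" for j
  have \<epsilon>0_nonneg: "0 \<le> \<epsilon>0 j" for j by (simp add: \<epsilon>0_def)
  have fin: "(\<Sum>j. defect e f j) < \<infinity>" using ef by (simp only: onb_rel_iff_defect)
  then have def: "defect e f j = ennreal (\<epsilon>0 j)" for j
    using ennreal_suminf_lessD[OF fin, of j] unfolding \<epsilon>0_def by simp
  have "summable \<epsilon>0"
    using fin unfolding def by (intro summable_suminf_not_top) (auto simp: \<epsilon>0_nonneg)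
  have rows: "(\<lambda>j. (c i j)\<^sup>2) sums 1" for i
    using onb_parseval_sq[OF f, of "e i"] e by (simp add: c_def)
  have cols: "(\<lambda>i. (c i j)\<^sup>2) sums 1" for j
    using onb_parseval_sq[OF e, of "f j"] f by (simp add: c_def inner_commute)
  have l1: "(\<lambda>i. \<bar>c i j\<bar>) sums (1 + \<epsilon>0 j)" for j
  proof -
    have *: "(\<Sum>i. ennreal \<bar>c i j\<bar>) = ennreal (1 + \<epsilon>0 j)"
      unfolding c_def l1_norm_eq_defect[OF e f] def using \<epsilon>0_nonneg[of j] by simp
    then have s: "summable (\<lambda>i. \<bar>c i j\<bar>)" by (intro summable_suminf_not_top) auto
    then have "ennreal (\<Sum>i. \<bar>c i j\<bar>) = ennreal (1 + \<epsilon>0 j)" using * by (simp add: suminf_ennreal2)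
    then have "(\<Sum>i. \<bar>c i j\<bar>) = 1 + \<epsilon>0 j"
      using s \<epsilon>0_nonneg[of j] by (subst (asm) ennreal_inj) (auto intro!: suminf_nonneg)
    with s show ?thesis by (simp add: sums_iff)
  qed
  \<comment> \<open>The distance \<open>\<eta>\<close> to the identity will be at most three times
    the defect, hence \<open>\<delta> / 3\<close>. The bound 1/10 makes the squares of the large
    entries at least 4/5, so that no row contains two of them, and stays below the 1/4 required by
    \<open>unmatched_card\<close>.\<close>
  obtain J where J: "norm (\<Sum>i. \<epsilon>0 (i + J)) < min (\<delta> / 3) (1 / 10)"
    using suminf_exist_split[OF _ \<open>summable \<epsilon>0\<close>, of "min (\<delta> / 3) (1 / 10)"] \<delta> by auto
  define \<epsilon> where "\<epsilon> j = (if j < J then 0 else \<epsilon>0 j)" for j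
  have \<epsilon>_nonneg: "0 \<le> \<epsilon> j" for j by (simp add: \<epsilon>_def \<epsilon>0_nonneg)
  have \<epsilon>_summable: "summable \<epsilon>"
    by (rule summable_comparison_test'[OF \<open>summable \<epsilon>0\<close>, of 0]) (simp add: \<epsilon>_def \<epsilon>0_nonneg)
  have "suminf \<epsilon> = (\<Sum>i. \<epsilon>0 (i + J))"
    using suminf_split_initial_segment[OF \<epsilon>_summable, of J] by (simp add: \<epsilon>_def)
  then have \<epsilon>_sum: "suminf \<epsilon> \<le> \<delta> / 3" "suminf \<epsilon> \<le> 1 / 10"
    using J unfolding real_norm_def by linarith+
  have \<epsilon>10: "\<epsilon> j \<le> 1 / 10" for j
    using sum_le_suminf[OF \<epsilon>_summable, of "{j}"] \<epsilon>_nonneg \<epsilon>_sum(2) by simp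
  have "\<forall>j. \<exists>i. 1 - \<epsilon>0 j \<le> \<bar>c i j\<bar>" using near_unit_entry[OF l1 cols] by blast
  then obtain m where m0: "\<And>j. 1 - \<epsilon>0 j \<le> \<bar>c (m j) j\<bar>" by metis
  have m: "1 - \<epsilon> j \<le> \<bar>c (m j) j\<bar>" if "J \<le> j" for j using m0[of j] that by (simp add: \<epsilon>_def)
  have m2: "1 - 2 * \<epsilon> j \<le> (c (m j) j)\<^sup>2" if "J \<le> j" for j
  proof -
    have "(1 - \<epsilon> j)\<^sup>2 \<le> \<bar>c (m j) j\<bar>\<^sup>2"
      by (rule power_mono[OF m[OF that]]) (use \<epsilon>10[of j] in simp)
    moreover have "(1 - \<epsilon> j)\<^sup>2 = 1 - 2 * \<epsilon> j + (\<epsilon> j)\<^sup>2" by (simp add: power2_eq_square algebra_simps)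
    moreover have "0 \<le> (\<epsilon> j)\<^sup>2" by simp
    ultimately show ?thesis by (simp only: power2_abs)
  qed
  have inj: "inj_on m {J..}"
  proof (rule inj_onI, rule ccontr)
    fix j k assume jk: "j \<in> {J..}" "k \<in> {J..}" "m j = m k" "j \<noteq> k"
    have "(\<Sum>l\<in>{j, k}. (c (m j) l)\<^sup>2) \<le> 1"
      using sum_le_suminf[OF sums_summable[OF rows[of "m j"]], of "{j, k}"] sums_unique[OF rows[of "m j"]] by simp
    then have "(c (m j) j)\<^sup>2 + (c (m k) k)\<^sup>2 \<le> 1" using jk by simp
    then show False using m2[of j] m2[of k] jk \<epsilon>10[of j] \<epsilon>10[of k] by simp
  qed
  have T: "finite (- m ` {J..})" "card (- m ` {J..}) = J"
    using unmatched_card[OF rows cols \<epsilon>_nonneg \<epsilon>_summable _ inj m2] \<epsilon>_sum(2) by auto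
  then obtain h where h: "bij_betw h {..<J} (- m ` {J..})"
    by (metis card_lessThan finite_lessThan finite_same_card_bij)
  \<comment> \<open>The free rows are assigned to the first \<open>J\<close> columns arbitrarily; no
    closeness is claimed for these columns.\<close>
  define \<pi> where "\<pi> j = (if j < J then h j else m j)" for j
  have "bij_betw \<pi> {..<J} (- m ` {J..})"
    using h by (subst bij_betw_cong[of _ _ h]) (auto simp: \<pi>_def)
  moreover have "bij_betw \<pi> {J..} (m ` {J..})"
    using inj by (subst bij_betw_cong[of _ _ m]) (auto simp: \<pi>_def bij_betw_def)
  ultimately have "bij_betw \<pi> ({..<J} \<union> {J..}) (- m ` {J..} \<union> m ` {J..})"
    by (rule bij_betw_combine) auto
  moreover have "{..<J} \<union> {J..} = UNIV" by auto
  ultimately have \<pi>: "bij \<pi>" by simp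
  define \<sigma> :: "nat \<Rightarrow> real" where "\<sigma> i = (if c (\<pi> i) i < 0 then -1 else 1)" for i
  \<comment> \<open>The l1 distance of column \<open>j\<close> to the unit vector: the off-diagonal
    entries sum to 1 + \<open>\<epsilon>0 j\<close> - \<bar>\<open>c (\<pi> j) j\<close>\<bar>, and
    the diagonal entry, made nonnegative by the sign, is off by 1 -
    \<bar>\<open>c (\<pi> j) j\<close>\<bar>.\<close>
  define \<eta> where "\<eta> j = (if j < J then 0 else \<epsilon>0 j + 2 - 2 * \<bar>c (\<pi> j) j\<bar>)" for j
  have \<eta>: "(\<lambda>i. \<bar>\<sigma> i *\<^sub>R e (\<pi> i) \<bullet> f j - (if i = j then 1 else 0)\<bar>) sums \<eta> j" if "J \<le> j" for j
  proof -
    have c1: "\<bar>c (\<pi> j) j\<bar> \<le> 1" unfolding c_def by (rule onb_coeff_le[OF e f])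
    have "(\<lambda>i. \<bar>c (\<pi> i) j\<bar>) sums (1 + \<epsilon>0 j)"
      by (rule sums_reindex_bij_nonneg[OF \<pi> l1]) simp
    moreover have "(\<lambda>i. if i = j then 1 - 2 * \<bar>c (\<pi> j) j\<bar> else 0) sums (1 - 2 * \<bar>c (\<pi> j) j\<bar>)"
      using sums_single[of j "\<lambda>_. 1 - 2 * \<bar>c (\<pi> j) j\<bar>"] by simp
    ultimately have "(\<lambda>i. \<bar>c (\<pi> i) j\<bar> + (if i = j then 1 - 2 * \<bar>c (\<pi> j) j\<bar> else 0)) sums
        (1 + \<epsilon>0 j + (1 - 2 * \<bar>c (\<pi> j) j\<bar>))" by (rule sums_add)
    moreover have "\<bar>c (\<pi> i) j\<bar> + (if i = j then 1 - 2 * \<bar>c (\<pi> j) j\<bar> else 0) =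
        \<bar>\<sigma> i *\<^sub>R e (\<pi> i) \<bullet> f j - (if i = j then 1 else 0)\<bar>" for i
      using c1 by (auto simp: \<sigma>_def c_def[symmetric] abs_if)
    ultimately show ?thesis using that by (simp add: \<eta>_def algebra_simps)
  qed
  have \<eta>_nonneg: "0 \<le> \<eta> j" for j
    using sums_le[OF _ sums_zero \<eta>[of j]] by (cases "j < J") (auto simp: \<eta>_def)
  have \<eta>_le: "\<eta> j \<le> 3 * \<epsilon> j" for j using m[of j] by (auto simp: \<eta>_def \<epsilon>_def \<pi>_def)
  have \<eta>_summable: "summable \<eta>"
    by (rule summable_comparison_test'[OF summable_mult[OF \<epsilon>_summable, of 3], of 0])
       (use \<eta>_nonneg \<eta>_le in simp)
  have "suminf \<eta> \<le> (\<Sum>j. 3 * \<epsilon> j)"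
    by (rule suminf_le[OF \<eta>_le \<eta>_summable summable_mult[OF \<epsilon>_summable]])
  also have "\<dots> = 3 * suminf \<epsilon>" by (rule suminf_mult[OF \<epsilon>_summable])
  finally have "suminf \<eta> \<le> \<delta>" using \<epsilon>_sum(1) by linarith
  moreover have "\<bar>\<sigma> j\<bar> = 1" for j by (simp add: \<sigma>_def)
  ultimately show ?thesis
    by (intro that[of \<pi> \<sigma> \<eta> J]) (use \<pi> \<eta> \<eta>_nonneg \<eta>_summable in \<open>auto simp: \<eta>_def\<close>)
qed

section \<open>Boxes of equivalent bases\<close>

lemma summable_abs_if_pos_part:
  fixes u :: "nat \<Rightarrow> real"
  assumes "summable u" "summable (\<lambda>j. max 0 (u j))"
  shows "summable (\<lambda>j. \<bar>u j\<bar>)"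
proof -
  have "summable (\<lambda>j. 2 * max 0 (u j) - u j)" by (intro summable_diff summable_mult assms)
  moreover have "(\<lambda>j. 2 * max 0 (u j) - u j) = (\<lambda>j. \<bar>u j\<bar>)" by (auto simp: max_def)
  ultimately show ?thesis by simp
qed

text \<open>Positive volume enters here: convergence of the series makes the logarithms bounded. An
  error in the bounds then changes a logarithm by at most the error divided by
  \<open>\<kappa>\<close>.\<close>

lemma admissible_summable_lower_bound:
  assumes "summable (\<lambda>j. ln (b j - a j))" "\<And>j. a j < b j"
  obtains \<kappa> :: real where "\<kappa> > 0" "\<And>j. \<kappa> \<le> b j - a j"
proof -
  have "(\<lambda>j. ln (b j - a j)) \<longlonglongrightarrow> 0" by (rule summable_LIMSEQ_zero[OF assms(1)])
  then have "Bseq (\<lambda>j. ln (b j - a j))" by (intro convergent_imp_Bseq convergentI)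
  then obtain L where L: "\<And>j. norm (ln (b j - a j)) \<le> L" by (auto simp: Bseq_def)
  have "exp (- L) \<le> b j - a j" for j
  proof -
    have "- L \<le> ln (b j - a j)" using L[of j] by simp
    then have "exp (- L) \<le> exp (ln (b j - a j))" by simp
    then show ?thesis using assms(2)[of j] by simp
  qed
  then show ?thesis by (intro that[of "exp (- L)"]) auto
qed

text \<open>The constant 24 is 16 + 8: the slanted box is treated with \<open>K = 4 * M\<close>,
  which costs \<open>16 * M / \<kappa>\<close>, and the preceding enlargement of all sides by
  \<open>\<theta>\<close> costs \<open>8 * M / \<kappa>\<close>.\<close>

lemma outer_le_onb_rel_approx:
  fixes e f :: "nat \<Rightarrow> 'a::real_inner"
  assumes ef: "(e, f) \<in> onb_rel" and ab: "admissible a b"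
    and summ: "summable (\<lambda>j. ln (b j - a j))"
    and \<kappa>: "\<kappa> > 0" "\<And>j. \<kappa> \<le> b j - a j"
    and M: "M \<ge> 1" "\<And>j. \<bar>a j\<bar> \<le> M" "\<And>j. \<bar>b j\<bar> \<le> M"
    and \<delta>: "0 < \<delta>" "\<delta> \<le> 1 / 4"
  shows "outer_le f (box_set e a b) (exp ((24 * M / \<kappa> + 1) * \<delta>) * box_volume a b)"
proof -
  have e: "is_onb e" and f: "is_onb f" using onb_relD[OF ef] by auto
  obtain \<pi> \<sigma> \<eta> J where \<pi>: "bij \<pi>" and \<sigma>: "\<And>j. \<bar>\<sigma> j\<bar> = 1" and \<eta>: "\<And>j. 0 \<le> \<eta> j" "\<And>j. j < J \<Longrightarrow> \<eta> j = 0"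
      "summable \<eta>" "suminf \<eta> \<le> \<delta>"
    and entries: "\<And>j. J \<le> j \<Longrightarrow> (\<lambda>i. \<bar>\<sigma> i *\<^sub>R e (\<pi> i) \<bullet> f j - (if i = j then 1 else 0)\<bar>) sums \<eta> j"
    by (rule onb_matching[OF ef \<delta>(1)], rule that)
  define e' where "e' i = \<sigma> i *\<^sub>R e (\<pi> i)" for i
  have e': "is_onb e'" unfolding e'_def by (rule onb_signed_permutation[OF e \<pi> \<sigma>])
  define c where "c i j = e' i \<bullet> f j" for i j
  \<comment> \<open>Deviation from the identity matrix. Columns below \<open>J\<close> are set to 0,
    in accordance with \<open>\<eta> j = 0\<close> there, so that the column sums are
    \<open>\<eta> j\<close> throughout.\<close>
  define D where "D i j = (if J \<le> j then \<bar>c i j - (if i = j then 1 else 0)\<bar> else 0)" for i j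
  have D0: "0 \<le> D i j" for i j by (simp add: D_def)
  have D_sums: "(\<lambda>i. D i j) sums \<eta> j" for j
  proof (cases "J \<le> j")
    case True
    then show ?thesis using entries[OF True] by (simp add: D_def c_def e'_def)
  next
    case False
    then show ?thesis using \<eta>(2)[of j] by (simp add: D_def)
  qed
  have D_partial: "(\<Sum>i\<in>I. D i j) \<le> \<eta> j" if "finite I" for I j
    using sum_le_suminf[OF sums_summable[OF D_sums[of j]] that] D0 sums_unique[OF D_sums[of j]] by simp
  have D_le: "D i j \<le> \<eta> j" for i j using D_partial[of "{i}" j] by simp
  have D_summable: "summable (\<lambda>j. D i j)" for i
    by (rule summable_comparison_test'[OF \<eta>(3), of 0]) (use D0 D_le in simp)
  have c_D: "\<bar>c i j\<bar> = D i j" if "i < J" "J \<le> j" for i j using that by (simp add: D_def)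
  have \<eta>_le1: "\<eta> j \<le> 1" for j
    using sum_le_suminf[OF \<eta>(3), of "{j}"] \<eta>(1,4) \<delta>(2) by simp
  \<comment> \<open>For \<open>i < J\<close>, the l1 mass of row \<open>i\<close> in the columns
    from \<open>J\<close> on, which is lost by projecting \<open>e' i\<close> onto the span of the
    first \<open>J\<close> vectors of \<open>f\<close>.\<close>
  define \<tau> where "\<tau> i = (\<Sum>j. D i j)" for i
  have \<tau>0: "0 \<le> \<tau> i" for i unfolding \<tau>_def by (rule suminf_nonneg[OF D_summable D0])
  have \<tau>_sum: "(\<Sum>i<J. \<tau> i) \<le> \<delta>"
  proof -
    have "(\<Sum>i<J. \<tau> i) = (\<Sum>j. \<Sum>i<J. D i j)"
      unfolding \<tau>_def by (rule suminf_sum[symmetric]) (rule D_summable)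
    also have "\<dots> \<le> suminf \<eta>"
      by (rule suminf_le[OF _ summable_sum \<eta>(3)]) (auto intro: D_partial D_summable)
    finally show ?thesis using \<eta>(4) by simp
  qed
  define v where "v j = (if J \<le> j then f j else \<Sum>k<J. c j k *\<^sub>R f k)" for j
  \<comment> \<open>Bounds relative to \<open>e'\<close>: a negative sign exchanges the ends of the
    interval.\<close>
  define a1 where "a1 i = (if \<sigma> i = 1 then a (\<pi> i) else - b (\<pi> i))" for i
  define b1 where "b1 i = (if \<sigma> i = 1 then b (\<pi> i) else - a (\<pi> i))" for i
  \<comment> \<open>The first two terms bound the change of a coordinate when \<open>e' i\<close> is
    replaced by \<open>v i\<close>, for \<open>J \<le> i\<close> and for \<open>i < J\<close>
    respectively. The geometric term makes the enlargement strict, because a reflected half-open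
    interval contains the wrong end.\<close>
  define \<theta> where "\<theta> i = M * \<eta> i + (if i < J then 2 * M * \<tau> i else 0) + \<delta> * (1 / 2) ^ Suc i" for i
  define a2 where "a2 i = a1 i - \<theta> i" for i
  define b2 where "b2 i = b1 i + \<theta> i" for i
  have "(\<lambda>i. if i < J then 2 * M * \<tau> i else 0) sums (\<Sum>i<J. 2 * M * \<tau> i)"
    using sums_If_finite_set[of "{..<J}" "\<lambda>i. 2 * M * \<tau> i"] by simp
  then have "(\<lambda>i. if i < J then 2 * M * \<tau> i else 0) sums (2 * M * (\<Sum>i<J. \<tau> i))"
    by (simp add: sum_distrib_left)
  then have \<theta>_sums: "\<theta> sums (M * suminf \<eta> + 2 * M * (\<Sum>i<J. \<tau> i) + \<delta> * 1)"
    unfolding \<theta>_def by (intro sums_add sums_mult summable_sums[OF \<eta>(3)] power_half_series)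
  have \<theta>pos: "\<theta> i > 0" for i
    unfolding \<theta>_def using M(1) \<eta>(1)[of i] \<tau>0[of i] \<delta>(1) by (intro add_nonneg_pos add_nonneg_nonneg) auto
  have \<theta>_suminf: "suminf \<theta> \<le> 4 * M * \<delta>"
  proof -
    have "M * suminf \<eta> \<le> M * \<delta>" "2 * M * (\<Sum>i<J. \<tau> i) \<le> 2 * M * \<delta>" "\<delta> \<le> M * \<delta>"
      using M(1) \<eta>(4) \<tau>_sum \<delta>(1) by (auto intro: mult_left_mono)
    then show ?thesis using sums_unique[OF \<theta>_sums] by simp
  qed
  have \<theta>_le: "\<theta> i \<le> 4 * M * \<delta>" for i
    using sum_le_suminf[OF sums_summable[OF \<theta>_sums], of "{i}"] \<theta>pos \<theta>_suminf by (simp add: less_imp_le)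
  have \<theta>_leM: "\<theta> i \<le> M" for i
  proof -
    have "4 * M * \<delta> \<le> 4 * M * (1 / 4)" by (rule mult_left_mono) (use M(1) \<delta> in auto)
    then show ?thesis using \<theta>_le[of i] by simp
  qed
  have len1: "b1 i - a1 i = b (\<pi> i) - a (\<pi> i)" for i by (simp add: a1_def b1_def)
  have len2: "b2 i - a2 i = (b (\<pi> i) - a (\<pi> i)) + 2 * \<theta> i" for i
    using len1[of i] by (simp add: a2_def b2_def)
  have bd1: "\<bar>a1 i\<bar> \<le> M" "\<bar>b1 i\<bar> \<le> M" for i using M(2,3)[of "\<pi> i"] by (simp_all add: a1_def b1_def)
  have bd2: "\<bar>a2 i\<bar> \<le> 2 * M" "\<bar>b2 i\<bar> \<le> 2 * M" for i
    using bd1[of i] \<theta>_leM[of i] \<theta>pos[of i] unfolding a2_def b2_def by linarith+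
  let ?u = "\<lambda>j. ln (b j - a j)"
  have pos_part: "summable (\<lambda>j. max 0 (?u j))" using ab by (simp add: admissible_def)
  \<comment> \<open>The volume may be permuted because a convergent series with summable positive
    parts converges absolutely.\<close>
  have perm: "(\<lambda>i. ?u (\<pi> i)) sums suminf ?u"
    by (rule sums_reindex_bij_abs[OF \<pi> summable_abs_if_pos_part[OF summ pos_part]])
  have vol1: "box_volume a1 b1 = box_volume a b"
    using perm summ by (simp add: box_volume_def len1 sums_iff)
  have pos_part1: "summable (\<lambda>j. max 0 (ln (b1 j - a1 j)))"
    unfolding len1 using sums_reindex_bij_nonneg[OF \<pi> summable_sums[OF pos_part]] by (simp add: sums_iff)
  have pert: "\<bar>ln (b2 j - a2 j) - ln (b1 j - a1 j)\<bar> \<le> 2 * \<theta> j / \<kappa>" for j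
    unfolding len1 len2 using \<kappa> \<theta>pos[of j] by (intro abs_ln_add_diff) auto
  have t_sums: "(\<lambda>j. 2 * \<theta> j / \<kappa>) sums (2 * suminf \<theta> / \<kappa>)"
    by (intro sums_divide sums_mult summable_sums sums_summable[OF \<theta>_sums])
  have adm2: "admissible a2 b2"
    unfolding admissible_def
  proof (intro conjI allI)
    show "bounded (range a2)" "bounded (range b2)"
      using bd2 by (auto intro!: boundedI[of _ "2 * M"])
    show "a2 j < b2 j" for j using len2[of j] \<theta>pos[of j] \<kappa>(1) \<kappa>(2)[of "\<pi> j"] by linarith
    show "summable (\<lambda>j. max 0 (ln (b2 j - a2 j)))"
      by (rule summable_pos_ln_perturb[OF sums_summable[OF t_sums] pert pos_part1])
  qed
  have vol2: "box_volume a2 b2 \<le> exp (8 * M / \<kappa> * \<delta>) * box_volume a b"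
  proof -
    have "box_volume a2 b2 \<le> exp (2 * suminf \<theta> / \<kappa>) * box_volume a1 b1"
      using box_volume_perturb[OF sums_summable[OF t_sums] pert] sums_unique[OF t_sums] by simp
    moreover have "2 * suminf \<theta> / \<kappa> \<le> 8 * M / \<kappa> * \<delta>"
      using \<theta>_suminf \<kappa>(1) by (simp add: field_simps)
    ultimately show ?thesis
      unfolding vol1 by (meson box_volume_nonneg exp_le_cancel_iff mult_right_mono order_trans)
  qed
  \<comment> \<open>The full rows of \<open>c\<close> are orthonormal by Parseval, so the Gram
    matrix of the truncated rows misses the identity exactly by the inner products of the
    tails.\<close>
  have gram_entry: "\<bar>v i \<bullet> v k - (if i = k then 1 else 0)\<bar> \<le> (\<Sum>j. D i j * D k j)"
    and gram_summable: "summable (\<lambda>j. D i j * D k j)" if "i < J" "k < J" for i k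
  proof -
    show s: "summable (\<lambda>j. D i j * D k j)"
    proof (rule summable_comparison_test'[OF \<eta>(3), of 0])
      show "norm (D i j * D k j) \<le> \<eta> j" for j
        using mult_mono[OF D_le[of i j] order_trans[OF D_le[of k j] \<eta>_le1[of j]]] D0 \<eta>(1) by simp
    qed
    have p: "(\<lambda>j. c i j * c k j) sums (if i = k then 1 else 0)"
      using onb_parseval[OF f, of "e' i" "e' k"] by (simp add: c_def onb_inner[OF e'])
    have vv: "v i \<bullet> v k = (\<Sum>j<J. c i j * c k j)"
      using that by (simp add: v_def inner_sum_left inner_sum_right onb_inner[OF f] if_distrib sum.delta mult.commute cong: if_cong)
    have tail: "(\<lambda>j. if j < J then c i j * c k j else 0) sums (\<Sum>j<J. c i j * c k j)"
      using sums_If_finite_set[of "{..<J}" "\<lambda>j. c i j * c k j"] by simp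
    from sums_diff[OF this p]
    have d: "(\<lambda>j. (if j < J then c i j * c k j else 0) - c i j * c k j) sums (v i \<bullet> v k - (if i = k then 1 else 0))"
      unfolding vv .
    have "\<bar>(if j < J then c i j * c k j else 0) - c i j * c k j\<bar> = D i j * D k j" for j
      using c_D[OF that(1), of j] c_D[OF that(2), of j] by (auto simp: abs_mult D_def)
    then have eq: "(\<lambda>j. \<bar>(if j < J then c i j * c k j else 0) - c i j * c k j\<bar>) = (\<lambda>j. D i j * D k j)" by (rule ext)
    show "\<bar>v i \<bullet> v k - (if i = k then 1 else 0)\<bar> \<le> (\<Sum>j. D i j * D k j)"
      using summable_rabs[of "\<lambda>j. (if j < J then c i j * c k j else 0) - c i j * c k j", unfolded eq, OF s]
      unfolding sums_unique[OF d] .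
  qed
  have gram: "(\<Sum>i<J. \<Sum>k<J. \<bar>v i \<bullet> v k - (if i = k then 1 else 0)\<bar>) \<le> \<delta>"
  proof -
    have "(\<Sum>i<J. \<Sum>k<J. \<bar>v i \<bullet> v k - (if i = k then 1 else 0)\<bar>) \<le> (\<Sum>i<J. \<Sum>k<J. \<Sum>j. D i j * D k j)"
      by (intro sum_mono gram_entry) auto
    also have "\<dots> = (\<Sum>i<J. \<Sum>j. \<Sum>k<J. D i j * D k j)"
      by (intro sum.cong refl suminf_sum[symmetric] gram_summable) auto
    also have "\<dots> = (\<Sum>j. \<Sum>i<J. \<Sum>k<J. D i j * D k j)"
      by (intro suminf_sum[symmetric] summable_sum gram_summable) auto
    also have "\<dots> \<le> suminf \<eta>"
    proof (rule suminf_le[OF _ _ \<eta>(3)])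
      show "summable (\<lambda>j. \<Sum>i<J. \<Sum>k<J. D i j * D k j)"
        by (intro summable_sum gram_summable) auto
      show "(\<Sum>i<J. \<Sum>k<J. D i j * D k j) \<le> \<eta> j" for j
      proof -
        have "(\<Sum>i<J. \<Sum>k<J. D i j * D k j) = (\<Sum>i<J. D i j) * (\<Sum>k<J. D k j)"
          by (simp add: sum_product)
        also have "\<dots> \<le> \<eta> j * 1"
          using \<eta>_le1[of j] \<eta>(1)[of j] D_partial[of "{..<J}" j] D0
          by (intro mult_mono) (auto intro!: sum_nonneg)
        finally show ?thesis by simp
      qed
    qed
    finally show ?thesis using \<eta>(4) by simp
  qed
  have sub: "box_set e a b \<subseteq> box_set v a2 b2"
  proof
    fix x assume "x \<in> box_set e a b"
    then have x: "a j \<le> x \<bullet> e j" "x \<bullet> e j < b j" for j by (auto simp: box_set_def)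
    have \<sigma>cases: "\<sigma> i = 1 \<or> \<sigma> i = -1" for i using \<sigma>[of i] by linarith
    have x1: "a1 i \<le> x \<bullet> e' i" "x \<bullet> e' i \<le> b1 i" for i
      using \<sigma>cases[of i] x[of "\<pi> i"] by (auto simp: a1_def b1_def e'_def)
    have xM: "\<bar>x \<bullet> e' i\<bar> \<le> M" for i using x1[of i] bd1[of i] by linarith
    have xf: "\<bar>x \<bullet> f j - x \<bullet> e' j\<bar> \<le> M * \<eta> j" if "J \<le> j" for j
    proof -
      have p: "(\<lambda>i. (x \<bullet> e' i) * c i j) sums (x \<bullet> f j)"
        using onb_parseval[OF e', of x "f j"] by (simp add: c_def inner_commute)
      have q: "(\<lambda>i. (x \<bullet> e' i) * (if i = j then 1 else 0)) sums (x \<bullet> e' j)"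
        using sums_single[of j "\<lambda>i. x \<bullet> e' i"] by (simp add: if_distrib cong: if_cong)
      have d: "(\<lambda>i. (x \<bullet> e' i) * (c i j - (if i = j then 1 else 0))) sums (x \<bullet> f j - x \<bullet> e' j)"
        using sums_diff[OF p q] by (simp only: right_diff_distrib)
      have le: "\<bar>(x \<bullet> e' i) * (c i j - (if i = j then 1 else 0))\<bar> \<le> M * D i j" for i
        using xM[of i] that by (simp add: D_def abs_mult mult_right_mono)
      have s: "summable (\<lambda>i. \<bar>(x \<bullet> e' i) * (c i j - (if i = j then 1 else 0))\<bar>)"
        by (rule summable_comparison_test'[OF summable_mult[OF sums_summable[OF D_sums[of j]], of M], of 0])
           (use le in simp)
      have "\<bar>x \<bullet> f j - x \<bullet> e' j\<bar> \<le> (\<Sum>i. \<bar>(x \<bullet> e' i) * (c i j - (if i = j then 1 else 0))\<bar>)"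
        using summable_rabs[OF s] unfolding sums_unique[OF d] .
      also have "\<dots> \<le> (\<Sum>i. M * D i j)"
        by (rule suminf_le[OF le s summable_mult[OF sums_summable[OF D_sums]]])
      also have "\<dots> = M * \<eta> j"
        using sums_unique[OF sums_mult[OF D_sums[of j], of M]] by simp
      finally show ?thesis .
    qed
    have xf2: "\<bar>x \<bullet> f j\<bar> \<le> 2 * M" if "J \<le> j" for j
    proof -
      have "M * \<eta> j \<le> M * 1" by (rule mult_left_mono) (use \<eta>_le1 M(1) in auto)
      then show ?thesis using xf[OF that] xM[of j] by linarith
    qed
    have xv: "\<bar>x \<bullet> v i - x \<bullet> e' i\<bar> \<le> 2 * M * \<tau> i" if "i < J" for i
    proof -
      have p: "(\<lambda>j. (x \<bullet> f j) * c i j) sums (x \<bullet> e' i)"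
        using onb_parseval[OF f, of x "e' i"] by (simp add: c_def)
      have q: "(\<lambda>j. if j < J then (x \<bullet> f j) * c i j else 0) sums (x \<bullet> v i)"
        using sums_If_finite_set[of "{..<J}" "\<lambda>j. (x \<bullet> f j) * c i j"] that
        by (simp add: v_def inner_sum_right mult.commute)
      note d = sums_diff[OF q p]
      have le: "\<bar>(if j < J then (x \<bullet> f j) * c i j else 0) - (x \<bullet> f j) * c i j\<bar> \<le> 2 * M * D i j" for j
      proof (cases "j < J")
        case False
        then show ?thesis using xf2[of j] c_D[OF that, of j] D0[of i j]
          by (simp add: abs_mult mult_right_mono)
      qed (use M(1) D0[of i j] in simp)
      have s: "summable (\<lambda>j. \<bar>(if j < J then (x \<bullet> f j) * c i j else 0) - (x \<bullet> f j) * c i j\<bar>)"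
        by (rule summable_comparison_test'[OF summable_mult[OF D_summable[of i], of "2 * M"], of 0])
           (use le in simp)
      have "\<bar>x \<bullet> v i - x \<bullet> e' i\<bar> \<le> (\<Sum>j. \<bar>(if j < J then (x \<bullet> f j) * c i j else 0) - (x \<bullet> f j) * c i j\<bar>)"
        using summable_rabs[OF s] unfolding sums_unique[OF d] .
      also have "\<dots> \<le> (\<Sum>j. 2 * M * D i j)"
        by (rule suminf_le[OF le s summable_mult[OF D_summable]])
      also have "\<dots> = 2 * M * \<tau> i" unfolding \<tau>_def by (rule suminf_mult[OF D_summable])
      finally show ?thesis .
    qed
    have "\<bar>x \<bullet> v i - x \<bullet> e' i\<bar> < \<theta> i" for i
    proof -
      have "\<delta> * (1 / 2) ^ Suc i > 0" using \<delta>(1) by simp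
      moreover have "M * \<eta> i \<ge> 0" using M(1) \<eta>(1)[of i] by simp
      ultimately show ?thesis using xf[of i] xv[of i]
        by (cases "i < J") (simp_all add: \<theta>_def v_def not_less del: power_Suc)
    qed
    then have "a2 i \<le> x \<bullet> v i \<and> x \<bullet> v i < b2 i" for i
      using x1[of i] unfolding a2_def b2_def abs_less_iff by (smt (verit))
    then show "x \<in> box_set v a2 b2" by (simp add: box_set_def)
  qed
  \<comment> \<open>Since \<open>\<delta> \<le> 1 / 4\<close>, the value \<open>4 * M\<close> for
    \<open>K\<close> leaves \<open>K - 2 * K * \<delta>\<close> at least \<open>2 * M\<close>, which
    bounds the ends of the enlarged sides.\<close>
  have "outer_le f (box_set v a2 b2) (exp ((4 * (4 * M) / \<kappa> + 1) * \<delta>) * box_volume a2 b2)"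
  proof (rule outer_le_slanted_box[OF f adm2, of J])
    show "v i = f i" if "J \<le> i" for i using that by (simp add: v_def)
    show "v i \<bullet> f j = 0" if "i < J" "J \<le> j" for i j
      using that by (simp add: v_def inner_sum_left onb_inner[OF f])
    show "\<kappa> \<le> b2 i - a2 i" for i using len2[of i] \<theta>pos[of i] \<kappa>(2)[of "\<pi> i"] by linarith
    have "8 * M * \<delta> \<le> 8 * M * (1 / 4)" by (rule mult_left_mono) (use M(1) \<delta> in auto)
    then have "2 * M \<le> 4 * M - 2 * (4 * M) * \<delta>" by simp
    then show "- (4 * M - 2 * (4 * M) * \<delta>) \<le> a2 i" "b2 i \<le> 4 * M - 2 * (4 * M) * \<delta>" for i
      using bd2[of i] by linarith+
  qed (use gram \<delta> \<kappa> M in auto)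
  moreover have "exp ((4 * (4 * M) / \<kappa> + 1) * \<delta>) * box_volume a2 b2 \<le> exp ((24 * M / \<kappa> + 1) * \<delta>) * box_volume a b"
  proof -
    have "exp ((4 * (4 * M) / \<kappa> + 1) * \<delta>) * box_volume a2 b2 \<le>
        exp ((4 * (4 * M) / \<kappa> + 1) * \<delta>) * (exp (8 * M / \<kappa> * \<delta>) * box_volume a b)"
      by (rule mult_left_mono[OF vol2]) simp
    also have "\<dots> = exp ((4 * (4 * M) / \<kappa> + 1) * \<delta> + 8 * M / \<kappa> * \<delta>) * box_volume a b"
      by (simp only: exp_add mult.assoc)
    also have "(4 * (4 * M) / \<kappa> + 1) * \<delta> + 8 * M / \<kappa> * \<delta> = (24 * M / \<kappa> + 1) * \<delta>"
      using \<kappa>(1) by (simp add: field_simps)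
    finally show ?thesis .
  qed
  ultimately show ?thesis using outer_le_mono sub by blast
qed

theorem outer_le_onb_rel:
  fixes e f :: "nat \<Rightarrow> 'a::real_inner"
  assumes ef: "(e, f) \<in> onb_rel" and ab: "admissible a b"
    and summ: "summable (\<lambda>j. ln (b j - a j))"
  shows "outer_le f (box_set e a b) (box_volume a b)"
proof (rule outer_le_closed)
  fix \<epsilon> :: real assume \<epsilon>: "\<epsilon> > 0"
  obtain \<kappa> where \<kappa>: "\<kappa> > 0" "\<And>j. \<kappa> \<le> b j - a j"
    using admissible_summable_lower_bound[OF summ admissible_less[OF ab]] by metis
  obtain Ma Mb where "\<And>j. \<bar>a j\<bar> \<le> Ma" "\<And>j. \<bar>b j\<bar> \<le> Mb"
    using ab by (auto simp: admissible_def bounded_iff)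
  define M where "M = max 1 (max Ma Mb)"
  have M: "M \<ge> 1" "\<bar>a j\<bar> \<le> M" "\<bar>b j\<bar> \<le> M" for j
    using \<open>\<And>j. \<bar>a j\<bar> \<le> Ma\<close>[of j] \<open>\<And>j. \<bar>b j\<bar> \<le> Mb\<close>[of j] by (auto simp: M_def)
  define C where "C = 24 * M / \<kappa> + 1"
  have C: "C > 0" using M(1) \<kappa>(1) unfolding C_def by (intro add_nonneg_pos) auto
  define V where "V = box_volume a b"
  have V: "V \<ge> 0" by (simp add: V_def)
  \<comment> \<open>Chosen so that \<open>exp (C * \<delta>)\<close> is at most
    \<open>1 + \<epsilon> / (V + 1)\<close>; the excess volume is then at most
    \<open>\<epsilon>\<close>, also when \<open>V\<close> is small.\<close>
  define \<delta> where "\<delta> = min (1 / 4) (ln (1 + \<epsilon> / (V + 1)) / C)"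
  have pos: "\<epsilon> / (V + 1) > 0" using \<epsilon> V by simp
  then have "ln (1 + \<epsilon> / (V + 1)) > 0" by (intro ln_gt_zero) simp
  then have \<delta>: "0 < \<delta>" "\<delta> \<le> 1 / 4" "C * \<delta> \<le> ln (1 + \<epsilon> / (V + 1))"
    using C by (auto simp: \<delta>_def min_def field_simps)
  have "exp (C * \<delta>) \<le> exp (ln (1 + \<epsilon> / (V + 1)))" using \<delta>(3) by simp
  also have "\<dots> = 1 + \<epsilon> / (V + 1)" using pos by simp
  finally have "exp (C * \<delta>) * V \<le> (1 + \<epsilon> / (V + 1)) * V" by (rule mult_right_mono[OF _ V])
  also have "\<dots> \<le> V + \<epsilon>" using V \<epsilon> by (simp add: field_simps)
  finally have "exp (C * \<delta>) * V \<le> V + \<epsilon>" .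
  with outer_le_onb_rel_approx[OF ef ab summ \<kappa> M \<delta>(1,2)]
  show "outer_le f (box_set e a b) (box_volume a b + \<epsilon>)"
    unfolding C_def[symmetric] V_def[symmetric] using outer_le_mono subset_refl by blast
qed

section \<open>Finitely additive measures, simple functions and their completion\<close>

lemma generated_set_ring_superset: "K \<subseteq> generated_set_ring K"
  unfolding generated_set_ring_def by blast

lemma generated_set_ring_least: "ring_of_sets UNIV M \<Longrightarrow> K \<subseteq> M \<Longrightarrow> generated_set_ring K \<subseteq> M"
  unfolding generated_set_ring_def by blast

lemma fa_measure_ring: "fa_measure R m \<Longrightarrow> ring_of_sets UNIV R"
  by (simp add: fa_measure_def)

lemma fa_measure_nonneg: "fa_measure R m \<Longrightarrow> A \<in> R \<Longrightarrow> 0 \<le> m A"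
  by (simp add: fa_measure_def)

lemma fa_measure_add:
  "fa_measure R m \<Longrightarrow> A \<in> R \<Longrightarrow> B \<in> R \<Longrightarrow> A \<inter> B = {} \<Longrightarrow> m (A \<union> B) = m A + m B"
  by (simp add: fa_measure_def)

lemma fa_measure_empty: "fa_measure R m \<Longrightarrow> m {} = 0"
  unfolding fa_measure_def ring_of_sets_iff by (metis add_cancel_right_right inf_bot_right sup_bot_right)

lemma fa_measure_split:
  assumes m: "fa_measure R m" and AB: "A \<in> R" "B \<in> R"
  shows "m A = m (A \<inter> B) + m (A - B)"
proof -
  interpret ring_of_sets UNIV R by (rule fa_measure_ring[OF m])
  have "m ((A \<inter> B) \<union> (A - B)) = m (A \<inter> B) + m (A - B)"
    by (rule fa_measure_add[OF m]) (use AB in auto)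
  moreover have "(A \<inter> B) \<union> (A - B) = A" by blast
  ultimately show ?thesis by simp
qed

lemma fa_measure_Diff:
  "fa_measure R m \<Longrightarrow> A \<in> R \<Longrightarrow> B \<in> R \<Longrightarrow> B \<subseteq> A \<Longrightarrow> m (A - B) = m A - m B"
  using fa_measure_split[of R m A B] by (simp add: Int_absorb1)

lemma fa_measure_mono:
  assumes "fa_measure R m" "A \<in> R" "B \<in> R" "A \<subseteq> B"
  shows "m A \<le> m B"
proof -
  interpret ring_of_sets UNIV R by (rule fa_measure_ring[OF assms(1)])
  show ?thesis
    using fa_measure_Diff[OF assms(1,3,2,4)] fa_measure_nonneg[OF assms(1), of "B - A"] assms by auto
qed

lemma fa_measure_Un_le:
  assumes m: "fa_measure R m" and A: "A \<in> R" and B: "B \<in> R"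
  shows "m (A \<union> B) \<le> m A + m B"
proof -
  interpret ring_of_sets UNIV R by (rule fa_measure_ring[OF m])
  have "m ((A - B) \<union> B) = m (A - B) + m B"
    by (rule fa_measure_add[OF m]) (use A B in auto)
  moreover have "m (A - B) \<le> m A" by (rule fa_measure_mono[OF m]) (use A B in auto)
  ultimately show ?thesis by simp
qed

lemma fa_measure_UN_le:
  assumes m: "fa_measure R m" and "finite I" "\<And>i. i \<in> I \<Longrightarrow> A i \<in> R"
  shows "(\<Union>i\<in>I. A i) \<in> R \<and> m (\<Union>i\<in>I. A i) \<le> (\<Sum>i\<in>I. m (A i))"
  using assms(2,3)
proof (induction I rule: finite_induct)
  case empty
  then show ?case using fa_measure_empty[OF m] fa_measure_ring[OF m] by (simp add: ring_of_sets_iff)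
next
  case (insert i I)
  interpret ring_of_sets UNIV R by (rule fa_measure_ring[OF m])
  let ?U = "\<Union>i\<in>I. A i"
  have IH: "?U \<in> R" "m ?U \<le> (\<Sum>i\<in>I. m (A i))" and Ai: "A i \<in> R" using insert by auto
  show ?case using IH Ai insert(1,2) fa_measure_Un_le[OF m Ai IH(1)] by auto
qed

lemma completed_ring_superset:
  assumes "fa_measure R m"
  shows "R \<subseteq> completed_ring R m"
  using fa_measure_empty[OF assms] unfolding completed_ring_def by force

lemma completed_measure_le:
  assumes "fa_measure R m" "B \<in> R" "A \<subseteq> B"
  shows "completed_measure R m A \<le> m B"
  unfolding completed_measure_def
  by (rule cInf_lower) (use assms fa_measure_nonneg[OF assms(1)] in \<open>auto intro!: bdd_belowI[of _ 0]\<close>)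

lemma completed_measure_eq:
  assumes "fa_measure R m" "A \<in> R"
  shows "completed_measure R m A = m A"
  unfolding completed_measure_def
  by (rule cInf_eq_minimum) (use assms fa_measure_mono[OF assms] in auto)

lemma completed_ring_Int:
  assumes m: "fa_measure R m" and A: "A \<in> completed_ring R m" and B: "B \<in> completed_ring R m"
  shows "A \<inter> B \<in> completed_ring R m"
  unfolding completed_ring_def
proof (rule CollectI, intro allI impI)
  interpret ring_of_sets UNIV R by (rule fa_measure_ring[OF m])
  fix \<epsilon> :: real assume "\<epsilon> > 0"
  then have "\<epsilon> / 2 > 0" by simp
  then obtain A1 A2 B1 B2 where 1: "A1 \<in> R" "A2 \<in> R" "A1 \<subseteq> A" "A \<subseteq> A2" "m (A2 - A1) < \<epsilon> / 2"
    and 2: "B1 \<in> R" "B2 \<in> R" "B1 \<subseteq> B" "B \<subseteq> B2" "m (B2 - B1) < \<epsilon> / 2"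
    using A B unfolding completed_ring_def mem_Collect_eq by meson
  have "m (A2 \<inter> B2 - A1 \<inter> B1) \<le> m ((A2 - A1) \<union> (B2 - B1))"
    by (rule fa_measure_mono[OF m]) (use 1 2 in auto)
  also have "\<dots> \<le> m (A2 - A1) + m (B2 - B1)"
    by (rule fa_measure_Un_le[OF m]) (use 1 2 in auto)
  finally have "m (A2 \<inter> B2 - A1 \<inter> B1) < \<epsilon>" using 1 2 by simp
  then show "\<exists>C1\<in>R. \<exists>C2\<in>R. C1 \<subseteq> A \<inter> B \<and> A \<inter> B \<subseteq> C2 \<and> m (C2 - C1) < \<epsilon>"
    using 1 2 by (intro bexI[of _ "A1 \<inter> B1"] bexI[of _ "A2 \<inter> B2"]) auto
qed

section \<open>Simple functions over a family of sets\<close>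

lemma simple_functions_zero: "(\<lambda>x. 0) \<in> simple_functions R"
  unfolding simple_functions_def by (intro CollectI exI[of _ "{}"] exI[of _ "\<lambda>_. 0"]) auto

lemma simple_functions_add_indicator:
  assumes A: "A \<in> R" and f: "f \<in> simple_functions R"
  shows "(\<lambda>x. c * indicator A x + f x) \<in> simple_functions R"
proof -
  obtain F d where F: "finite F" "F \<subseteq> R" and f: "f = (\<lambda>x. \<Sum>B\<in>F. d B * indicator B x)"
    using f unfolding simple_functions_def by blast
  \<comment> \<open>Extending the coefficients by 0 treats uniformly the cases where
    \<open>A\<close> already occurs in \<open>F\<close> and where it is new.\<close>
  define d0 where "d0 B = (if B \<in> F then d B else 0)" for B
  have "(\<lambda>x. c * indicator A x + f x) = (\<lambda>x. \<Sum>B\<in>insert A F. (d0(A := c + d0 A)) B * indicator B x)"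
  proof
    fix x
    have "f x = (\<Sum>B\<in>insert A F. d0 B * indicator B x)"
      unfolding f by (rule sum.mono_neutral_cong_left) (use F in \<open>auto simp: d0_def\<close>)
    also have "\<dots> = d0 A * indicator A x + (\<Sum>B\<in>F - {A}. d0 B * indicator B x)"
      by (rule sum.insert_remove[OF F(1)])
    also have "(\<Sum>B\<in>F - {A}. d0 B * indicator B x) = (\<Sum>B\<in>F - {A}. (d0(A := c + d0 A)) B * indicator B x)"
      by (rule sum.cong) auto
    finally show "c * indicator A x + f x = (\<Sum>B\<in>insert A F. (d0(A := c + d0 A)) B * indicator B x)"
      by (simp only: sum.insert_remove[OF F(1)] fun_upd_same distrib_right add.assoc)
  qed
  then show ?thesis
    unfolding simple_functions_def using F A by (intro CollectI exI[of _ "insert A F"] exI) auto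
qed

text \<open>Adapted to \<open>is_L2\<close>, which gives linearity of the canonical map only for two
  summands and for multiples.\<close>

lemma simple_functions_induct [consumes 1, case_names zero add]:
  assumes "f \<in> simple_functions R"
    and "P (\<lambda>x. 0)"
    and step: "\<And>c A g. A \<in> R \<Longrightarrow> g \<in> simple_functions R \<Longrightarrow> P g \<Longrightarrow> P (\<lambda>x. c * indicator A x + g x)"
  shows "P f"
proof -
  obtain F c where F: "finite F" "F \<subseteq> R" and f: "f = (\<lambda>x. \<Sum>A\<in>F. c A * indicator A x)"
    using assms(1) unfolding simple_functions_def by blast
  have "P (\<lambda>x. \<Sum>A\<in>F. c A * indicator A x)"
    using F
  proof (induction F rule: finite_induct)
    case (insert A F)
    then have "(\<lambda>x. \<Sum>A\<in>F. c A * indicator A x) \<in> simple_functions R"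
      unfolding simple_functions_def by blast
    then show ?case using insert step[of A _ "c A"] by (simp only: sum.insert[OF insert(1,2)] insert_subset)
  qed (simp add: assms(2))
  then show ?thesis by (simp add: f)
qed

lemma simple_functions_indicator: "A \<in> R \<Longrightarrow> indicator A \<in> simple_functions R"
  using simple_functions_add_indicator[OF _ simple_functions_zero, of A R 1] by simp

lemma simple_functions_add:
  assumes "f \<in> simple_functions R" "g \<in> simple_functions R"
  shows "(\<lambda>x. f x + g x) \<in> simple_functions R"
  using assms(1)
proof (induction rule: simple_functions_induct)
  case (add c A h)
  then show ?case using simple_functions_add_indicator[OF add(1,3), of c] by (simp add: add.assoc)
qed (simp add: assms(2))

lemma simple_functions_cmult:
  assumes "f \<in> simple_functions R"
  shows "(\<lambda>x. c * f x) \<in> simple_functions R"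
  using assms
proof (induction rule: simple_functions_induct)
  case (add d A h)
  then show ?case using simple_functions_add_indicator[OF add(1,3), of "c * d"] by (simp add: algebra_simps)
qed (simp add: simple_functions_zero)

lemma simple_functions_diff:
  assumes "f \<in> simple_functions R" "g \<in> simple_functions R"
  shows "(\<lambda>x. f x - g x) \<in> simple_functions R"
  using simple_functions_add[OF assms(1) simple_functions_cmult[OF assms(2), of "-1"]] by simp

lemma simple_functions_mono: "R \<subseteq> R' \<Longrightarrow> simple_functions R \<subseteq> simple_functions R'"
  unfolding simple_functions_def by blast

text \<open>\<open>Q\<close> itself may lie outside \<open>R\<close>; this admits the complement of
  a member of a ring.\<close>

lemma indicator_mult_simple:
  assumes f: "f \<in> simple_functions R" and Q: "\<And>B. B \<in> R \<Longrightarrow> Q \<inter> B \<in> R"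
  shows "(\<lambda>x. indicator Q x * f x) \<in> simple_functions R"
  using f
proof (induction rule: simple_functions_induct)
  case (add c A h)
  have "(\<lambda>x. indicator Q x * (c * indicator A x + h x)) = (\<lambda>x. c * indicator (Q \<inter> A) x + indicator Q x * h x)"
    by (auto simp: indicator_def)
  then show ?case using simple_functions_add_indicator[OF Q[OF add(1)] add(3)] by simp
qed (simp add: simple_functions_zero)

lemma simple_functions_mult:
  assumes f: "f \<in> simple_functions R" and g: "g \<in> simple_functions R"
    and Int: "\<And>A B. A \<in> R \<Longrightarrow> B \<in> R \<Longrightarrow> A \<inter> B \<in> R"
  shows "(\<lambda>x. f x * g x) \<in> simple_functions R"
  using f
proof (induction rule: simple_functions_induct)
  case (add c A h)
  have "(\<lambda>x. c * (indicator A x * g x)) \<in> simple_functions R"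
    by (intro simple_functions_cmult indicator_mult_simple g Int add)
  from simple_functions_add[OF this add(3)] show ?case by (simp add: algebra_simps)
qed (simp add: simple_functions_zero)

text \<open>Over an intersection-stable family the simple functions form an algebra, so the sets
  with simple indicator form a ring. Membership of images in a subspace thus need only be checked on
  the generators.\<close>

lemma indicator_generated_ring_simple:
  fixes K :: "'e set set"
  assumes Int: "\<And>A B. A \<in> K \<Longrightarrow> B \<in> K \<Longrightarrow> A \<inter> B \<in> K" and "A \<in> generated_set_ring K"
  shows "indicator A \<in> simple_functions K"
proof -
  define M where "M = {B. (indicator B :: _ \<Rightarrow> complex) \<in> simple_functions K}"
  have Int': "(\<lambda>x. indicator A x * indicator B x :: complex) \<in> simple_functions K" if "A \<in> M" "B \<in> M" for A B
    using that simple_functions_mult[OF _ _ Int] by (simp add: M_def)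
  have "ring_of_sets UNIV M"
    unfolding ring_of_sets_iff
  proof (intro conjI ballI)
    have "(indicator {} :: 'e \<Rightarrow> complex) = (\<lambda>x. 0)" by (simp add: fun_eq_iff)
    then show "{} \<in> M" using simple_functions_zero[of K] by (simp only: M_def mem_Collect_eq)
    fix A B assume AB: "A \<in> M" "B \<in> M"
    have "indicator (A \<union> B) = (\<lambda>x. (indicator A x + indicator B x) - indicator A x * indicator B x :: complex)"
      "indicator (A - B) = (\<lambda>x. indicator A x - indicator A x * indicator B x :: complex)"
      by (auto simp: indicator_def fun_eq_iff)
    then show "A \<union> B \<in> M" "A - B \<in> M"
      using AB Int'[OF AB] unfolding M_def by (auto intro: simple_functions_diff simple_functions_add)
  qed simp
  moreover have "K \<subseteq> M" by (auto simp: M_def simple_functions_indicator)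
  ultimately have "generated_set_ring K \<subseteq> M" by (rule generated_set_ring_least)
  then show ?thesis using assms(2) by (auto simp: M_def)
qed

section \<open>Geometry of the complex Hilbert space\<close>

context complex_hilbert_space
begin

lemma ip_add_right: "ip x (y + z) = ip x y + ip x z"
  by (metis complex_cnj_add ip_add_left ip_commute)

lemma ip_scale_right: "ip x (scale c y) = cnj c * ip x y"
  by (metis complex_cnj_mult ip_commute ip_scale_left)

lemma ip_zero_left [simp]: "ip 0 y = 0"
  using ip_add_left[of 0 0 y] by simp

lemma ip_zero_right [simp]: "ip y 0 = 0"
  using ip_add_right[of y 0 0] by simp

lemma norm_scale: "norm (scale c x) = cmod c * norm x"
proof -
  have "complex_of_real ((norm (scale c x))\<^sup>2) = ip (scale c x) (scale c x)" by (simp only: ip_self)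
  also have "\<dots> = (c * cnj c) * ip x x" by (simp add: ip_scale_left ip_scale_right)
  also have "\<dots> = complex_of_real ((cmod c * norm x)\<^sup>2)"
    by (simp add: ip_self complex_norm_square[symmetric] power_mult_distrib)
  finally have "(norm (scale c x))\<^sup>2 = (cmod c * norm x)\<^sup>2" by (simp only: of_real_eq_iff)
  then show ?thesis by (simp add: power2_eq_iff_nonneg)
qed

lemma bounded_linear_scale: "bounded_linear (scale c)"
proof (rule bounded_linear_intro)
  show "scale c (x + y) = scale c x + scale c y" for x y by (rule scale_right_distrib)
  show "scale c (r *\<^sub>R x) = r *\<^sub>R scale c x" for r x
    by (simp only: scale_of_real[symmetric] scale_left_commute)
  show "norm (scale c x) \<le> norm x * cmod c" for x by (simp add: norm_scale)
qed

text \<open>Polarization. The topology is given by the norm, so continuity of the inner product is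
  obtained from this formula.\<close>

lemma Re_ip: "Re (ip x y) = ((norm (x + y))\<^sup>2 - (norm x)\<^sup>2 - (norm y)\<^sup>2) / 2"
proof -
  have "ip (x + y) (x + y) = ip x x + ip x y + ip y x + ip y y"
    by (simp add: ip_add_left ip_add_right)
  moreover have "Re (ip y x) = Re (ip x y)" by (metis complex_cnj ip_commute complex.sel(1) cnj.sel(1))
  ultimately show ?thesis
    by (simp add: ip_self complex_eq_iff)
qed

lemma Im_ip: "Im (ip x y) = Re (ip x (scale \<i> y))"
  by (simp add: ip_scale_right)

lemma ip_zero_iff: "ip x y = 0 \<longleftrightarrow> Re (ip x y) = 0 \<and> Re (ip x (scale \<i> y)) = 0"
  by (simp add: complex_eq_iff Im_ip[symmetric])

lemma closed_ip_zero: "closed {x. ip x y = 0}"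
  unfolding ip_zero_iff Re_ip by (intro closed_Collect_conj closed_Collect_eq continuous_intros) auto

lemma ip_zero_closure:
  assumes "\<And>x y. x \<in> X \<Longrightarrow> y \<in> Y \<Longrightarrow> ip x y = 0" "x \<in> closure X" "y \<in> closure Y"
  shows "ip x y = 0"
proof -
  have *: "ip x y = 0" if "x \<in> closure X" "y \<in> Y" for x y
    using closure_minimal[of X "{x. ip x y = 0}"] closed_ip_zero that assms(1) by blast
  have "closure Y \<subseteq> {y. ip y x = 0}"
    using * assms(2) by (intro closure_minimal closed_ip_zero) (metis (mono_tags) complex_cnj_zero ip_commute mem_Collect_eq subsetI)
  then show ?thesis using assms(3) by (metis (mono_tags) complex_cnj_zero ip_commute mem_Collect_eq subsetD)
qed

lemma subspace_closure:
  assumes V: "subspace V"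
  shows "subspace (closure V)"
proof -
  have "x + y \<in> closure V" if "x \<in> closure V" "y \<in> closure V" for x y
  proof -
    from that obtain f g where "\<And>n. f n \<in> V" "f \<longlonglongrightarrow> x" "\<And>n. g n \<in> V" "g \<longlonglongrightarrow> y"
      by (auto simp: closure_sequential)
    then have "\<And>n. f n + g n \<in> V" "(\<lambda>n. f n + g n) \<longlonglongrightarrow> x + y"
      using V by (auto intro: tendsto_add simp: subspace_def)
    then show ?thesis unfolding closure_sequential by (intro exI[of _ "\<lambda>n. f n + g n"]) auto
  qed
  moreover have "scale c x \<in> closure V" if "x \<in> closure V" for c x
  proof -
    have "scale c ` closure V \<subseteq> closure (scale c ` V)"
      by (rule closure_bounded_linear_image_subset[OF bounded_linear_scale])
    also have "\<dots> \<subseteq> closure V" by (rule closure_mono) (use V in \<open>auto simp: subspace_def\<close>)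
    finally show ?thesis using that by blast
  qed
  moreover have "0 \<in> closure V" using V closure_subset by (auto simp: subspace_def)
  ultimately show ?thesis by (simp add: subspace_def)
qed

text \<open>Stated with squares because the squared distance of nested indicators is a difference of
  measures.\<close>

lemma norm_diff_sq_approx:
  assumes "\<And>\<epsilon>. \<epsilon> > 0 \<Longrightarrow> \<exists>y\<in>V. (norm (x - y))\<^sup>2 \<le> \<epsilon>"
  shows "x \<in> closure V"
  unfolding closure_approachable
proof (intro allI impI)
  fix \<epsilon> :: real assume \<epsilon>: "\<epsilon> > 0"
  then obtain y where y: "y \<in> V" "(norm (x - y))\<^sup>2 \<le> (\<epsilon> / 2)\<^sup>2" using assms[of "(\<epsilon> / 2)\<^sup>2"] by auto
  then have "norm (x - y) \<le> \<epsilon> / 2" using \<epsilon> by (intro power2_le_imp_le[OF y(2)]) simp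
  then have "dist y x < \<epsilon>" using \<epsilon> by (simp add: dist_norm norm_minus_commute)
  then show "\<exists>y\<in>V. dist y x < \<epsilon>" using y(1) by blast
qed

section \<open>Canonical maps of simple functions\<close>

lemma is_L2_add: "is_L2 R \<mu> \<iota> V \<Longrightarrow> f \<in> simple_functions R \<Longrightarrow> g \<in> simple_functions R \<Longrightarrow>
    \<iota> (\<lambda>x. f x + g x) = \<iota> f + \<iota> g"
  by (simp add: is_L2_def)

lemma is_L2_cmult: "is_L2 R \<mu> \<iota> V \<Longrightarrow> f \<in> simple_functions R \<Longrightarrow> \<iota> (\<lambda>x. c * f x) = scale c (\<iota> f)"
  by (simp add: is_L2_def)

lemma is_L2_ip: "is_L2 R \<mu> \<iota> V \<Longrightarrow> A \<in> R \<Longrightarrow> B \<in> R \<Longrightarrow>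
    ip (\<iota> (indicator A)) (\<iota> (indicator B)) = complex_of_real (\<mu> (A \<inter> B))"
  by (simp add: is_L2_def)

lemma is_L2_zero: "is_L2 R \<mu> \<iota> V \<Longrightarrow> \<iota> (\<lambda>x. 0) = 0"
  using is_L2_cmult[OF _ simple_functions_zero, of R \<mu> \<iota> V 0] by simp

lemma is_L2_diff:
  assumes "is_L2 R \<mu> \<iota> V" "f \<in> simple_functions R" "g \<in> simple_functions R"
  shows "\<iota> (\<lambda>x. f x - g x) = \<iota> f - \<iota> g"
proof -
  have "\<iota> (\<lambda>x. f x + (-1) * g x) = \<iota> f + scale (-1) (\<iota> g)"
    using assms by (simp only: is_L2_add[OF assms(1)] is_L2_cmult[OF assms(1)] simple_functions_cmult)
  then show ?thesis by simp
qed

lemma is_L2_add_indicator: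
  assumes "is_L2 R \<mu> \<iota> V" "A \<in> R" "f \<in> simple_functions R"
  shows "\<iota> (\<lambda>x. c * indicator A x + f x) = scale c (\<iota> (indicator A)) + \<iota> f"
  using assms is_L2_add[OF assms(1) simple_functions_cmult[OF simple_functions_indicator[OF assms(2)]] assms(3), of c]
    is_L2_cmult[OF assms(1) simple_functions_indicator[OF assms(2)], of c] by simp

lemma subspace_is_L2_image:
  assumes L: "is_L2 R \<mu> \<iota> V"
  shows "subspace (\<iota> ` simple_functions R)"
  unfolding subspace_def
proof (intro conjI ballI allI)
  show "0 \<in> \<iota> ` simple_functions R"
    by (rule image_eqI[where x="\<lambda>x. 0"]) (simp_all add: is_L2_zero[OF L] simple_functions_zero)
  fix x assume "x \<in> \<iota> ` simple_functions R"
  then obtain f where f: "f \<in> simple_functions R" "x = \<iota> f" by blast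
  show "scale c x \<in> \<iota> ` simple_functions R" for c
    unfolding f(2) is_L2_cmult[OF L f(1), symmetric] by (intro imageI simple_functions_cmult f)
  fix y assume "y \<in> \<iota> ` simple_functions R"
  then obtain g where g: "g \<in> simple_functions R" "y = \<iota> g" by blast
  show "x + y \<in> \<iota> ` simple_functions R"
    unfolding f(2) g(2) is_L2_add[OF L f(1) g(1), symmetric] by (intro imageI simple_functions_add f g)
qed

text \<open>\<open>is_L2\<close> evaluates the measure on intersections only, so agreement there
  lets the same map serve the smaller family.\<close>

lemma is_L2_restrict:
  assumes L: "is_L2 R \<mu> \<iota> V" and "R' \<subseteq> R"
    and "\<And>A B. A \<in> R' \<Longrightarrow> B \<in> R' \<Longrightarrow> \<mu> (A \<inter> B) = \<mu>' (A \<inter> B)"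
  shows "is_L2 R' \<mu>' \<iota> (closure (\<iota> ` simple_functions R'))"
  using L simple_functions_mono[OF assms(2)] assms(2,3) unfolding is_L2_def
  by (metis (no_types, lifting) subsetD)

lemma is_L2_in_subspace:
  assumes L: "is_L2 R \<mu> \<iota> V" and "R' \<subseteq> R" and W: "subspace W"
    and "\<And>A. A \<in> R' \<Longrightarrow> \<iota> (indicator A) \<in> W" and "f \<in> simple_functions R'"
  shows "\<iota> f \<in> W"
  using assms(5)
proof (induction rule: simple_functions_induct)
  case zero
  then show ?case using is_L2_zero[OF L] subspace_0[OF W] by simp
next
  case (add c A g)
  then have "A \<in> R" "g \<in> simple_functions R" using assms(2) simple_functions_mono by blast+
  from is_L2_add_indicator[OF L this] show ?case
    using add assms(4) by (simp add: subspace_add[OF W] subspace_scale[OF W])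
qed

lemma is_L2_norm_diff:
  assumes L: "is_L2 R \<mu> \<iota> V" and AB: "A \<in> R" "B \<in> R" "B \<subseteq> A"
  shows "(norm (\<iota> (indicator A) - \<iota> (indicator B)))\<^sup>2 = \<mu> A - \<mu> B"
proof -
  let ?a = "\<iota> (indicator A)" and ?b = "\<iota> (indicator B)"
  have int: "A \<inter> B = B" "B \<inter> A = B" using AB by auto
  have ip: "ip ?a ?a = \<mu> A" "ip ?a ?b = \<mu> B" "ip ?b ?a = \<mu> B" "ip ?b ?b = \<mu> B"
    using is_L2_ip[OF L] AB int by simp_all
  have "?a - ?b = ?a + scale (-1) ?b" by simp
  then have "ip (?a - ?b) (?a - ?b) = complex_of_real (\<mu> A - \<mu> B)"
    by (simp only: ip_add_left ip_add_right ip_scale_left ip_scale_right ip) simp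
  then show ?thesis unfolding ip_self of_real_eq_iff .
qed

lemma is_L2_disjoint:
  assumes L: "is_L2 R \<mu> \<iota> V" and "\<mu> {} = 0" and Q: "Q \<inter> Q' = {}"
    and QR: "\<And>B. B \<in> R \<Longrightarrow> Q \<inter> B \<in> R" "\<And>B. B \<in> R \<Longrightarrow> Q' \<inter> B \<in> R"
    and f: "f \<in> simple_functions R" and g: "g \<in> simple_functions R"
  shows "ip (\<iota> (\<lambda>x. indicator Q x * f x)) (\<iota> (\<lambda>x. indicator Q' x * g x)) = 0"
proof -
  have mult_add: "(\<lambda>x. indicator P x * (c * indicator A x + h x)) = (\<lambda>x. c * indicator (P \<inter> A) x + indicator P x * h x)"
    for P A :: "'a set" and c :: complex and h
    by (auto simp: indicator_def)
  have *: "ip (\<iota> (indicator (Q \<inter> A))) (\<iota> (\<lambda>x. indicator Q' x * g x)) = 0" if A: "A \<in> R" for A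
    using g
  proof (induction rule: simple_functions_induct)
    case (add c B h)
    have "(Q \<inter> A) \<inter> (Q' \<inter> B) = {}" using Q by blast
    then have "ip (\<iota> (indicator (Q \<inter> A))) (\<iota> (indicator (Q' \<inter> B))) = 0"
      using is_L2_ip[OF L QR(1)[OF A] QR(2)[OF add(1)]] assms(2) by simp
    moreover have "\<iota> (\<lambda>x. c * indicator (Q' \<inter> B) x + indicator Q' x * h x) =
        scale c (\<iota> (indicator (Q' \<inter> B))) + \<iota> (\<lambda>x. indicator Q' x * h x)"
      by (rule is_L2_add_indicator[OF L QR(2)[OF add(1)] indicator_mult_simple[OF add(2) QR(2)]])
    ultimately show ?case
      unfolding mult_add using add(3) by (simp add: ip_add_right ip_scale_right)
  qed (simp add: is_L2_zero[OF L])
  show ?thesis using f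
  proof (induction rule: simple_functions_induct)
    case (add c B h)
    have "\<iota> (\<lambda>x. c * indicator (Q \<inter> B) x + indicator Q x * h x) =
        scale c (\<iota> (indicator (Q \<inter> B))) + \<iota> (\<lambda>x. indicator Q x * h x)"
      by (rule is_L2_add_indicator[OF L QR(1)[OF add(1)] indicator_mult_simple[OF add(2) QR(1)]])
    then show ?case
      unfolding mult_add using add(3) *[OF add(1)] by (simp add: ip_add_left ip_scale_left)
  qed (simp add: is_L2_zero[OF L])
qed

text \<open>Pythagoras for the parts of \<open>f\<close> on \<open>A\<close> and on its complement,
  which are orthogonal as functions with disjoint supports. The complement need not be in the ring;
  its intersections with members are.\<close>

lemma is_L2_norm_mult_le:
  assumes L: "is_L2 R \<mu> \<iota> V" and R: "ring_of_sets UNIV R" and "\<mu> {} = 0" and A: "A \<in> R" and f: "f \<in> simple_functions R"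
  shows "norm (\<iota> (\<lambda>x. indicator A x * f x)) \<le> norm (\<iota> f)"
proof -
  interpret ring_of_sets UNIV R by (rule R)
  have QR: "A \<inter> B \<in> R" "- A \<inter> B \<in> R" if "B \<in> R" for B
    using A that Diff[OF that A] by (auto simp: Diff_eq Int_commute)
  let ?g = "\<lambda>x. indicator A x * f x" and ?h = "\<lambda>x. indicator (- A) x * f x"
  have gh: "?g \<in> simple_functions R" "?h \<in> simple_functions R"
    by (rule indicator_mult_simple[OF f QR(1)], assumption) (rule indicator_mult_simple[OF f QR(2)], assumption)
  have "(\<lambda>x. ?g x + ?h x) = f" by (auto simp: indicator_def)
  then have "\<iota> f = \<iota> ?g + \<iota> ?h" using is_L2_add[OF L gh] by simp
  moreover have "ip (\<iota> ?g) (\<iota> ?h) = 0"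
    by (rule is_L2_disjoint[OF L assms(3) _ QR f f]) auto
  ultimately have "(norm (\<iota> f))\<^sup>2 = (norm (\<iota> ?g))\<^sup>2 + (norm (\<iota> ?h))\<^sup>2"
    using Re_ip[of "\<iota> ?g" "\<iota> ?h"] by simp
  then have "(norm (\<iota> ?g))\<^sup>2 \<le> (norm (\<iota> f))\<^sup>2" by (simp only: le_add_same_cancel1 zero_le_power2)
  then show ?thesis by (rule power2_le_imp_le) simp
qed

end

section \<open>The Hilbert sum\<close>

text \<open>Supplies the intersection-stability needed for
  \<open>indicator_generated_ring_simple\<close>. Sides only shrink, so the positive parts of the
  logarithms remain summable.\<close>

lemma box_family_Int:
  fixes e :: "nat \<Rightarrow> 'a::real_inner"
  assumes "A \<in> box_family e" "B \<in> box_family e"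
  shows "A \<inter> B \<in> box_family e"
proof (cases "A \<inter> B = {}")
  case False
  then obtain a b a' b' where A: "A = box_set e a b" "box_bounds e a b"
    and B: "B = box_set e a' b'" "box_bounds e a' b'"
    using assms unfolding box_family_def by blast
  let ?a = "\<lambda>j. max (a j) (a' j)" and ?b = "\<lambda>j. min (b j) (b' j)"
  have eq: "A \<inter> B = box_set e ?a ?b" unfolding A B box_set_def by auto
  with False obtain x where "x \<in> box_set e ?a ?b" by blast
  then have lt: "?a j < ?b j" for j unfolding box_set_def mem_Collect_eq by (meson le_less_trans)
  have bd: "bounded (range (\<lambda>j. f (u j) (w j)))"
    if "bounded (range u)" "bounded (range w)" "\<And>s t. f s t \<in> {s, t}" for u w :: "nat \<Rightarrow> real" and f
    by (rule bounded_subset[of "range u \<union> range w"]) (use that in auto)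
  have "summable (\<lambda>j. max 0 (ln (?b j - ?a j)))"
  proof (rule summable_comparison_test'[of "\<lambda>j. max 0 (ln (b j - a j))" 0])
    show "summable (\<lambda>j. max 0 (ln (b j - a j)))" using A by (simp add: box_bounds_def)
    fix j
    have "ln (?b j - ?a j) \<le> ln (b j - a j)"
      using lt[of j] by (subst ln_le_cancel_iff) auto
    then show "norm (max 0 (ln (?b j - ?a j))) \<le> max 0 (ln (b j - a j))" by auto
  qed
  moreover have "bounded (range ?a)" "bounded (range ?b)"
  proof -
    have "bounded (range a)" "bounded (range a')" "bounded (range b)" "bounded (range b')"
      using A B by (simp_all only: box_bounds_def)
    then show "bounded (range ?a)" "bounded (range ?b)"
      using bd[of a a' max] bd[of b b' min] by (simp_all add: max_def min_def)
  qed
  ultimately have "box_bounds e ?a ?b" using False eq by (simp add: box_bounds_def)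
  then show ?thesis unfolding eq box_family_def by blast
qed (simp add: box_family_def)

lemma box_bounds_imp_admissible:
  assumes "box_bounds e a b"
  shows "admissible a b"
proof -
  obtain x where "x \<in> box_set e a b" using assms by (auto simp: box_bounds_def)
  then have "a j < b j" for j unfolding box_set_def mem_Collect_eq by (meson le_less_trans)
  then show ?thesis using assms by (simp add: box_bounds_def admissible_def)
qed

lemma admissible_imp_box_bounds: "admissible a b \<Longrightarrow> box_set e a b \<noteq> {} \<Longrightarrow> box_bounds e a b"
  by (simp add: box_bounds_def admissible_def)

lemma box_in_box_ring: "box_bounds e a b \<Longrightarrow> box_set e a b \<in> box_ring e"
  unfolding box_ring_def using generated_set_ring_superset[of "box_family e"] by (auto simp: box_family_def)

section \<open>The closed subspaces attached to the bases\<close>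

locale total_measure_L2 = complex_hilbert_space scale ip
  for scale :: "complex \<Rightarrow> 'h::banach \<Rightarrow> 'h" and ip :: "'h \<Rightarrow> 'h \<Rightarrow> complex" +
  fixes l :: "(nat \<Rightarrow> 'a::real_inner) \<Rightarrow> 'a set \<Rightarrow> real"
    and m :: "'a set \<Rightarrow> real"
    and \<iota> :: "('a \<Rightarrow> complex) \<Rightarrow> 'h"
  assumes box_measures: "\<And>e. is_onb e \<Longrightarrow> is_box_measure e (l e)"
    and total_measure: "is_total_measure l m"
    and L2: "is_L2 (completed_ring (total_ring l) m) (completed_measure (total_ring l) m) \<iota> UNIV"
begin

lemma total: "fa_measure (total_ring l) m"
  using total_measure by (simp add: is_total_measure_def)

sublocale T: ring_of_sets UNIV "total_ring l"
  by (rule fa_measure_ring[OF total])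

lemma l_measure: "is_onb e \<Longrightarrow> fa_measure (box_ring e) (l e)"
  using box_measures by (simp add: is_box_measure_def)

lemma l_box: "is_onb e \<Longrightarrow> box_bounds e a b \<Longrightarrow> l e (box_set e a b) = box_volume a b"
  using box_measures by (simp add: is_box_measure_def)

lemma onb_ring_subset: "is_onb e \<Longrightarrow> onb_ring l e \<subseteq> total_ring l"
  unfolding total_ring_def by (rule order_trans[OF _ generated_set_ring_superset]) blast

lemma box_ring_subset: "is_onb e \<Longrightarrow> box_ring e \<subseteq> onb_ring l e"
  unfolding onb_ring_def by (rule completed_ring_superset[OF l_measure])

text \<open>The case \<open>N = 0\<close> of the defining formula, where nothing is
  subtracted.\<close>

lemma m_onb_ring:
  assumes "is_onb e" "A \<in> onb_ring l e"
  shows "m A = onb_measure l e A"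
proof -
  have "m ((\<lambda>_. A) 0 - (\<Union>j\<in>{1..0::nat}. (\<lambda>_. A) j)) = onb_measure l ((\<lambda>_. e) (0::nat)) ((\<lambda>_. A) (0::nat))"
    using total_measure assms unfolding is_total_measure_def by (elim conjE allE[of _ 0]) auto
  then show ?thesis by simp
qed

lemma m_box_ring: "is_onb e \<Longrightarrow> A \<in> box_ring e \<Longrightarrow> m A = l e A"
  using m_onb_ring[of e A] box_ring_subset[of e] completed_measure_eq[OF l_measure, of e A]
  by (auto simp: onb_measure_def)

text \<open>The case \<open>N = 1\<close> says that removing \<open>B\<close> does not change the
  measure of \<open>A\<close>; additivity leaves 0 for the intersection.\<close>

lemma m_Int_unrelated:
  assumes e: "is_onb e" "A \<in> onb_ring l e" and f: "is_onb f" "B \<in> onb_ring l f" and "(f, e) \<notin> onb_rel"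
  shows "m (A \<inter> B) = 0"
proof -
  define g where "g j = (if j = (0::nat) then e else f)" for j
  define C where "C j = (if j = (0::nat) then A else B)" for j
  have "\<forall>j\<le>Suc 0. is_onb (g j) \<and> C j \<in> onb_ring l (g j)" "\<forall>j\<in>{1..Suc 0}. (g j, g 0) \<notin> onb_rel"
    using assms by (auto simp: g_def C_def)
  then have "m (C 0 - (\<Union>j\<in>{1..Suc 0}. C j)) = onb_measure l (g 0) (C 0)"
    using total_measure unfolding is_total_measure_def by blast
  then have "m (A - B) = m A" using m_onb_ring[OF e] by (simp add: g_def C_def)
  moreover have "m A = m (A \<inter> B) + m (A - B)"
    using e f onb_ring_subset by (intro fa_measure_split[OF total]) auto
  ultimately show ?thesis by simp
qed

lemma L2_total: "is_L2 (total_ring l) m \<iota> (closure (\<iota> ` simple_functions (total_ring l)))"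
  by (rule is_L2_restrict[OF L2 completed_ring_superset[OF total]])
     (auto intro!: completed_measure_eq[OF total])

text \<open>Indexed by a basis rather than by a class; \<open>H_cong\<close> shows that only the
  class matters.\<close>

definition H :: "(nat \<Rightarrow> 'a) \<Rightarrow> 'h set" where
  "H e = closure (\<iota> ` simple_functions (onb_ring l e))"

lemma L2_onb:
  assumes "is_onb e"
  shows "is_L2 (onb_ring l e) (onb_measure l e) \<iota> (H e)"
  unfolding H_def
  by (rule is_L2_restrict[OF L2_total onb_ring_subset[OF assms]])
     (use assms in \<open>auto intro!: m_onb_ring simp: onb_ring_def completed_ring_Int[OF l_measure]\<close>)

lemma subspace_H: "is_onb e \<Longrightarrow> subspace (H e)"
  unfolding H_def by (rule subspace_closure[OF subspace_is_L2_image[OF L2_onb]])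

lemma closed_H: "closed (H e)"
  by (simp add: H_def)

lemma indicator_in_H: "A \<in> onb_ring l e \<Longrightarrow> \<iota> (indicator A) \<in> H e"
  unfolding H_def by (rule subsetD[OF closure_subset imageI[OF simple_functions_indicator]])

lemma norm_sq_total:
  "A \<in> total_ring l \<Longrightarrow> B \<in> total_ring l \<Longrightarrow> B \<subseteq> A \<Longrightarrow>
    (norm (\<iota> (indicator A) - \<iota> (indicator B)))\<^sup>2 = m A - m B"
  by (rule is_L2_norm_diff[OF L2_total])

lemma null_indicator:
  assumes "A \<in> total_ring l" "m A = 0"
  shows "\<iota> (indicator A) = 0"
proof -
  have "ip (\<iota> (indicator A)) (\<iota> (indicator A)) = 0"
    using is_L2_ip[OF L2_total assms(1) assms(1)] assms(2) by simp
  then show ?thesis by (simp add: ip_self)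
qed

lemma box_in_H:
  assumes ef: "(e, f) \<in> onb_rel" and ab: "box_bounds e a b"
  shows "\<iota> (indicator (box_set e a b)) \<in> H f"
proof -
  have e: "is_onb e" and f: "is_onb f" using onb_relD[OF ef] by auto
  let ?P = "box_set e a b"
  have P: "?P \<in> box_ring e" by (rule box_in_box_ring[OF ab])
  have PT: "?P \<in> total_ring l" using P box_ring_subset[OF e] onb_ring_subset[OF e] by blast
  have mP: "m ?P = box_volume a b" using m_box_ring[OF e P] l_box[OF e ab] by simp
  show ?thesis
  proof (cases "summable (\<lambda>j. ln (b j - a j))")
    case False
    then have "m ?P = 0" by (simp add: mP box_volume_def)
    then show ?thesis using null_indicator[OF PT] subspace_0[OF subspace_H[OF f]] by simp
  next
    case True
    have out: "outer_le f ?P (box_volume a b)"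
      by (rule outer_le_onb_rel[OF ef box_bounds_imp_admissible[OF ab] True])
    have "\<iota> (indicator ?P) \<in> closure (H f)"
    proof (rule norm_diff_sq_approx)
      fix \<epsilon> :: real assume "\<epsilon> > 0"
      then obtain F where F: "finite F" "\<forall>(a, b)\<in>F. admissible a b" "?P \<subseteq> (\<Union>(a, b)\<in>F. box_set f a b)"
        "(\<Sum>(a, b)\<in>F. box_volume a b) \<le> box_volume a b + \<epsilon>"
        using out unfolding outer_le_def by meson
      \<comment> \<open>Empty boxes are dropped from the cover, because \<open>box_bounds\<close>
        demands nonempty ones.\<close>
      define G where "G = {ab\<in>F. box_set f (fst ab) (snd ab) \<noteq> {}}"
      have G: "finite G" "G \<subseteq> F" using F(1) by (auto simp: G_def)
      have Gb: "box_bounds f (fst ab) (snd ab)" if "ab \<in> G" for ab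
        by (rule admissible_imp_box_bounds) (use that F(2) in \<open>auto simp: G_def\<close>)
      define B where "B = (\<Union>ab\<in>G. box_set f (fst ab) (snd ab))"
      have "B \<in> box_ring f \<and> l f B \<le> (\<Sum>ab\<in>G. l f (box_set f (fst ab) (snd ab)))"
        unfolding B_def by (rule fa_measure_UN_le[OF l_measure[OF f] G(1)]) (rule box_in_box_ring[OF Gb])
      then have B: "B \<in> box_ring f" and le: "l f B \<le> (\<Sum>ab\<in>G. box_volume (fst ab) (snd ab))"
        using l_box[OF f Gb] by auto
      note le
      also have "\<dots> \<le> (\<Sum>ab\<in>F. box_volume (fst ab) (snd ab))"
        by (rule sum_mono2[OF F(1) G(2)]) simp
      finally have mB: "m B \<le> box_volume a b + \<epsilon>"
        using F(4) m_box_ring[OF f B] by (simp add: case_prod_beta)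
      have sub: "?P \<subseteq> B"
        using F(3) unfolding B_def G_def by fastforce
      have BR: "B \<in> onb_ring l f" using B box_ring_subset[OF f] by blast
      then have "(norm (\<iota> (indicator B) - \<iota> (indicator ?P)))\<^sup>2 = m B - m ?P"
        using onb_ring_subset[OF f] by (intro norm_sq_total[OF _ PT sub]) blast
      then have "(norm (\<iota> (indicator ?P) - \<iota> (indicator B)))\<^sup>2 \<le> \<epsilon>"
        using mB mP by (simp add: norm_minus_commute)
      then show "\<exists>y\<in>H f. (norm (\<iota> (indicator ?P) - y))\<^sup>2 \<le> \<epsilon>"
        using indicator_in_H[OF BR] by blast
    qed
    then show ?thesis by (simp add: closure_closed[OF closed_H])
  qed
qed

lemma onb_ring_approx:
  assumes e: "is_onb e" and A: "A \<in> onb_ring l e" and \<epsilon>: "\<epsilon> > 0"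
  shows "\<exists>A1\<in>box_ring e. A1 \<subseteq> A \<and> (norm (\<iota> (indicator A) - \<iota> (indicator A1)))\<^sup>2 \<le> \<epsilon>"
proof -
  interpret B: ring_of_sets UNIV "box_ring e" by (rule fa_measure_ring[OF l_measure[OF e]])
  obtain A1 A2 where A12: "A1 \<in> box_ring e" "A2 \<in> box_ring e" "A1 \<subseteq> A" "A \<subseteq> A2" "l e (A2 - A1) < \<epsilon>"
    using A \<epsilon> unfolding onb_ring_def completed_ring_def by blast
  have T: "A \<in> total_ring l" "A1 \<in> total_ring l" "A2 \<in> total_ring l"
    using A A12 box_ring_subset[OF e] onb_ring_subset[OF e] by blast+
  have "(norm (\<iota> (indicator A) - \<iota> (indicator A1)))\<^sup>2 = m A - m A1"
    by (rule norm_sq_total[OF T(1,2) A12(3)])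
  also have "\<dots> \<le> m A2 - m A1" using fa_measure_mono[OF total T(1,3) A12(4)] by simp
  also have "\<dots> = m (A2 - A1)" using A12 by (intro fa_measure_Diff[OF total T(3,2), symmetric]) blast
  also have "\<dots> = l e (A2 - A1)" using A12 by (intro m_box_ring[OF e]) auto
  finally show ?thesis using A12 by (intro bexI[of _ A1]) auto
qed

text \<open>The indicator of a set in the generated ring is a linear combination of box indicators,
  which reduces the claim to single boxes.\<close>

lemma box_ring_in_H:
  assumes ef: "(e, f) \<in> onb_rel" and A: "A \<in> box_ring e"
  shows "\<iota> (indicator A) \<in> H f"
proof -
  have e: "is_onb e" and f: "is_onb f" using onb_relD[OF ef] by auto
  have fam: "box_family e \<subseteq> total_ring l"
    using generated_set_ring_superset[of "box_family e"] box_ring_subset[OF e] onb_ring_subset[OF e]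
    unfolding box_ring_def by blast
  show ?thesis
  proof (rule is_L2_in_subspace[OF L2_total fam subspace_H[OF f]])
    show "\<iota> (indicator B) \<in> H f" if "B \<in> box_family e" for B
    proof (cases "B = {}")
      case True
      then show ?thesis
        using null_indicator[OF _ fa_measure_empty[OF total]] subspace_0[OF subspace_H[OF f]] by simp
    next
      case False
      then show ?thesis using that box_in_H[OF ef] by (auto simp: box_family_def)
    qed
    show "indicator A \<in> simple_functions (box_family e)"
      by (rule indicator_generated_ring_simple[OF box_family_Int]) (use A in \<open>simp_all add: box_ring_def\<close>)
  qed
qed

lemma H_mono:
  assumes ef: "(e, f) \<in> onb_rel"
  shows "H e \<subseteq> H f"
proof -
  have e: "is_onb e" and f: "is_onb f" using onb_relD[OF ef] by auto
  have "\<iota> (indicator A) \<in> H f" if A: "A \<in> onb_ring l e" for A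
  proof -
    have "\<iota> (indicator A) \<in> closure (H f)"
      using onb_ring_approx[OF e A] box_ring_in_H[OF ef] by (intro norm_diff_sq_approx) blast
    then show ?thesis by (simp add: closure_closed[OF closed_H])
  qed
  then have "\<iota> ` simple_functions (onb_ring l e) \<subseteq> H f"
    using is_L2_in_subspace[OF L2_total onb_ring_subset[OF e] subspace_H[OF f]]
    by (intro image_subsetI) simp
  then show ?thesis unfolding H_def[of e] by (rule closure_minimal[OF _ closed_H])
qed

lemma H_cong: "(e, f) \<in> onb_rel \<Longrightarrow> H e = H f"
  using H_mono onb_rel_sym by blast

lemma H_orthogonal:
  assumes e: "is_onb e" and f: "is_onb f" and "(e, f) \<notin> onb_rel" and "x \<in> H e" "y \<in> H f"
  shows "ip x y = 0"
proof -
  have fe: "(f, e) \<notin> onb_rel" using assms(3) onb_rel_sym by blast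
  have ind: "ip (\<iota> (indicator A)) (\<iota> (indicator B)) = 0" if "A \<in> onb_ring l e" "B \<in> onb_ring l f" for A B
    using is_L2_ip[OF L2_total, of A B] m_Int_unrelated[OF e that(1) f that(2) fe] that
      onb_ring_subset[OF e] onb_ring_subset[OF f] by auto
  have sub: "subspace {x. \<forall>y\<in>Y. ip x y = 0}" for Y
    by (auto simp: subspace_def ip_add_left ip_scale_left)
  have sub': "subspace {y. \<forall>x\<in>X. ip x y = 0}" for X
    by (auto simp: subspace_def ip_add_right ip_scale_right)
  have 1: "ip (\<iota> g) (\<iota> (indicator B)) = 0" if "g \<in> simple_functions (onb_ring l e)" "B \<in> onb_ring l f" for g B
    using is_L2_in_subspace[OF L2_onb[OF e] subset_refl sub[of "{\<iota> (indicator B)}"] _ that(1)] ind that(2) by auto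
  have 2: "ip (\<iota> g) (\<iota> h) = 0" if "g \<in> simple_functions (onb_ring l e)" "h \<in> simple_functions (onb_ring l f)" for g h
    using is_L2_in_subspace[OF L2_onb[OF f] subset_refl sub'[of "{\<iota> g}"] _ that(2)] 1 that(1) by auto
  show ?thesis
    by (rule ip_zero_closure[OF _ assms(4,5)[unfolded H_def]]) (use 2 in auto)
qed

section \<open>The closed span of all the subspaces\<close>

abbreviation onb_sets :: "'a set set" where
  "onb_sets \<equiv> \<Union>e\<in>{e. is_onb e}. onb_ring l e"

definition W :: "'h set" where
  "W = closure (\<iota> ` simple_functions onb_sets)"

lemma onb_sets_subset: "onb_sets \<subseteq> total_ring l"
  using onb_ring_subset by blast

lemma subspace_W: "subspace W"
  unfolding W_def
  by (rule subspace_closure[OF subspace_is_L2_image[OF is_L2_restrict[OF L2_total onb_sets_subset refl]]])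

lemma closed_W: "closed W"
  by (simp add: W_def)

lemma W_approx:
  assumes "\<And>\<epsilon>. \<epsilon> > 0 \<Longrightarrow> \<exists>y\<in>W. (norm (x - y))\<^sup>2 \<le> \<epsilon>"
  shows "x \<in> W"
  using norm_diff_sq_approx[OF assms] by (simp add: closure_closed[OF closed_W])

lemma onb_set_in_W: "A \<in> onb_sets \<Longrightarrow> \<iota> (indicator A) \<in> W"
  unfolding W_def by (rule subsetD[OF closure_subset imageI[OF simple_functions_indicator]])

text \<open>For inequivalent bases the intersection is null. For equivalent ones the image of the
  indicator of \<open>A\<close> is a limit of images of simple functions \<open>g\<close> over the
  ring of \<open>f\<close>; multiplying by the indicator of \<open>B\<close> keeps \<open>g\<close>
  simple over that ring and does not increase distances.\<close>

lemma onb_sets_Int_in_W: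
  assumes "A \<in> onb_sets" "B \<in> onb_sets"
  shows "\<iota> (indicator (A \<inter> B)) \<in> W"
proof -
  obtain e f where e: "is_onb e" "A \<in> onb_ring l e" and f: "is_onb f" "B \<in> onb_ring l f" using assms by auto
  have AB: "A \<in> total_ring l" "B \<in> total_ring l" using assms onb_sets_subset by auto
  show ?thesis
  proof (cases "(e, f) \<in> onb_rel")
    case False
    then have "m (A \<inter> B) = 0" using m_Int_unrelated[OF e f] onb_rel_sym by blast
    then have "\<iota> (indicator (A \<inter> B)) = 0" using null_indicator[of "A \<inter> B"] AB by blast
    then show ?thesis using subspace_0[OF subspace_W] by simp
  next
    case True
    have HW: "H f \<subseteq> W"
      unfolding H_def W_def by (intro closure_mono image_mono simple_functions_mono) (use f in auto)
    have "\<iota> (indicator A) \<in> closure (\<iota> ` simple_functions (onb_ring l f))"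
      using indicator_in_H[OF e(2)] H_mono[OF True] by (auto simp: H_def)
    have "\<iota> (indicator (A \<inter> B)) \<in> closure (H f)"
    proof (rule norm_diff_sq_approx)
      fix \<epsilon> :: real assume "\<epsilon> > 0"
      then obtain y where y: "y \<in> \<iota> ` simple_functions (onb_ring l f)" "dist y (\<iota> (indicator A)) < sqrt \<epsilon>"
        using \<open>\<iota> (indicator A) \<in> closure _\<close> unfolding closure_approachable by (meson real_sqrt_gt_zero)
      then obtain g where g: "g \<in> simple_functions (onb_ring l f)" "y = \<iota> g" by blast
      have gT: "g \<in> simple_functions (total_ring l)" using g(1) simple_functions_mono[OF onb_ring_subset[OF f(1)]] by blast
      have AT: "indicator A \<in> simple_functions (total_ring l)" by (rule simple_functions_indicator[OF AB(1)])
      have Bg: "(\<lambda>x. indicator B x * g x) \<in> simple_functions (onb_ring l f)"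
        by (rule indicator_mult_simple[OF g(1)])
           (use f(2) in \<open>simp add: onb_ring_def completed_ring_Int[OF l_measure[OF f(1)]]\<close>)
      then have BgT: "(\<lambda>x. indicator B x * g x) \<in> simple_functions (total_ring l)"
        using simple_functions_mono[OF onb_ring_subset[OF f(1)]] by blast
      have "(\<lambda>x. indicator B x * (indicator A x - g x)) = (\<lambda>x. indicator (A \<inter> B) x - indicator B x * g x)"
        by (auto simp: indicator_def)
      then have "norm (\<iota> (\<lambda>x. indicator (A \<inter> B) x - indicator B x * g x)) \<le> norm (\<iota> (\<lambda>x. indicator A x - g x))"
        using is_L2_norm_mult_le[OF L2_total T.ring_of_sets_axioms fa_measure_empty[OF total] AB(2)
            simple_functions_diff[OF AT gT]] by simp
      moreover have "\<iota> (\<lambda>x. indicator (A \<inter> B) x - indicator B x * g x) =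
          \<iota> (indicator (A \<inter> B)) - \<iota> (\<lambda>x. indicator B x * g x)"
        by (rule is_L2_diff[OF L2_total _ BgT]) (use AB in \<open>auto intro: simple_functions_indicator\<close>)
      moreover have "\<iota> (\<lambda>x. indicator A x - g x) = \<iota> (indicator A) - \<iota> g"
        by (rule is_L2_diff[OF L2_total AT gT])
      ultimately have "norm (\<iota> (indicator (A \<inter> B)) - \<iota> (\<lambda>x. indicator B x * g x)) \<le> sqrt \<epsilon>"
        using y(2) g(2) by (simp add: dist_norm norm_minus_commute)
      then have "(norm (\<iota> (indicator (A \<inter> B)) - \<iota> (\<lambda>x. indicator B x * g x)))\<^sup>2 \<le> (sqrt \<epsilon>)\<^sup>2"
        by (rule power_mono) simp
      moreover have "\<iota> (\<lambda>x. indicator B x * g x) \<in> H f"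
        unfolding H_def by (rule subsetD[OF closure_subset imageI[OF Bg]])
      ultimately show "\<exists>y\<in>H f. (norm (\<iota> (indicator (A \<inter> B)) - y))\<^sup>2 \<le> \<epsilon>"
        using \<open>\<epsilon> > 0\<close> by auto
    qed
    then show ?thesis using HW by (auto simp: closure_closed[OF closed_H])
  qed
qed

text \<open>Multiplication acts on functions, not on vectors of the Hilbert space, so invariance of
  \<open>W\<close> is expressed through simple functions whose image lies in
  \<open>W\<close>.\<close>

definition W_stable :: "'a set \<Rightarrow> bool" where
  "W_stable A \<longleftrightarrow> A \<in> total_ring l \<and>
     (\<forall>g\<in>simple_functions (total_ring l). \<iota> g \<in> W \<longrightarrow> \<iota> (\<lambda>x. indicator A x * g x) \<in> W)"

lemma indicator_mult_total:
  "A \<in> total_ring l \<Longrightarrow> g \<in> simple_functions (total_ring l) \<Longrightarrow>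
    (\<lambda>x. indicator A x * g x) \<in> simple_functions (total_ring l)"
  by (rule indicator_mult_simple) auto

text \<open>Multiplication by an indicator is a contraction, so stability only has to be checked on a
  set of functions that is dense in \<open>W\<close>.\<close>

lemma W_stable_onb_set:
  assumes A: "A \<in> onb_sets"
  shows "W_stable A"
  unfolding W_stable_def
proof (intro conjI ballI impI)
  show AT: "A \<in> total_ring l" using A onb_sets_subset by blast
  have simple: "\<iota> (\<lambda>x. indicator A x * h x) \<in> W" if "h \<in> simple_functions onb_sets" for h
    using that
  proof (induction rule: simple_functions_induct)
    case zero
    then show ?case using is_L2_zero[OF L2_total] subspace_0[OF subspace_W] by simp
  next
    case (add c B h)
    have eq: "(\<lambda>x. indicator A x * (c * indicator B x + h x)) = (\<lambda>x. c * indicator (A \<inter> B) x + indicator A x * h x)"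
      by (auto simp: indicator_def)
    have "B \<in> total_ring l" using add(1) onb_sets_subset by blast
    then have ABT: "A \<inter> B \<in> total_ring l" using AT by blast
    have hT: "h \<in> simple_functions (total_ring l)" using add(2) simple_functions_mono[OF onb_sets_subset] by blast
    have "\<iota> (\<lambda>x. c * indicator (A \<inter> B) x + indicator A x * h x) =
        scale c (\<iota> (indicator (A \<inter> B))) + \<iota> (\<lambda>x. indicator A x * h x)"
      by (rule is_L2_add_indicator[OF L2_total ABT indicator_mult_total[OF AT hT]])
    then show ?case unfolding eq
      using subspace_add[OF subspace_W] subspace_scale[OF subspace_W] onb_sets_Int_in_W[OF A add(1)] add(3) by simp
  qed
  fix g assume g: "g \<in> simple_functions (total_ring l)" "\<iota> g \<in> W"
  show "\<iota> (\<lambda>x. indicator A x * g x) \<in> W"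
  proof (rule W_approx)
    fix \<epsilon> :: real assume "\<epsilon> > 0"
    then obtain h where h: "h \<in> simple_functions onb_sets" "dist (\<iota> h) (\<iota> g) < sqrt \<epsilon>"
      using g(2) unfolding W_def closure_approachable by (metis (no_types, lifting) imageE real_sqrt_gt_zero)
    have hT: "h \<in> simple_functions (total_ring l)" using h(1) simple_functions_mono[OF onb_sets_subset] by blast
    have "norm (\<iota> (\<lambda>x. indicator A x * (g x - h x))) \<le> norm (\<iota> (\<lambda>x. g x - h x))"
      by (rule is_L2_norm_mult_le[OF L2_total T.ring_of_sets_axioms fa_measure_empty[OF total] AT
            simple_functions_diff[OF g(1) hT]])
    moreover have "\<iota> (\<lambda>x. indicator A x * (g x - h x)) = \<iota> (\<lambda>x. indicator A x * g x) - \<iota> (\<lambda>x. indicator A x * h x)"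
      unfolding right_diff_distrib
      by (rule is_L2_diff[OF L2_total indicator_mult_total[OF AT g(1)] indicator_mult_total[OF AT hT]])
    moreover have "\<iota> (\<lambda>x. g x - h x) = \<iota> g - \<iota> h" by (rule is_L2_diff[OF L2_total g(1) hT])
    ultimately have "norm (\<iota> (\<lambda>x. indicator A x * g x) - \<iota> (\<lambda>x. indicator A x * h x)) \<le> sqrt \<epsilon>"
      using h(2) by (simp add: dist_norm norm_minus_commute)
    then have "(norm (\<iota> (\<lambda>x. indicator A x * g x) - \<iota> (\<lambda>x. indicator A x * h x)))\<^sup>2 \<le> (sqrt \<epsilon>)\<^sup>2"
      by (rule power_mono) simp
    then show "\<exists>y\<in>W. (norm (\<iota> (\<lambda>x. indicator A x * g x) - y))\<^sup>2 \<le> \<epsilon>"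
      using simple[OF h(1)] \<open>\<epsilon> > 0\<close> by auto
  qed
qed

lemma total_ring_in_W:
  assumes "A \<in> total_ring l"
  shows "\<iota> (indicator A) \<in> W"
proof -
  define M where "M = {A. W_stable A \<and> \<iota> (indicator A) \<in> W}"
  have MT: "A \<in> total_ring l" if "A \<in> M" for A using that by (simp add: M_def W_stable_def)
  have ind: "indicator A \<in> simple_functions (total_ring l)" if "A \<in> M" for A
    using MT[OF that] by (rule simple_functions_indicator)
  have "ring_of_sets UNIV M"
    unfolding ring_of_sets_iff
  proof (intro conjI ballI)
    have "(\<lambda>x. 0 :: complex) = indicator ({} :: 'a set)" by (simp add: fun_eq_iff)
    then have z: "\<iota> (indicator {}) = 0" using is_L2_zero[OF L2_total] by simp
    show "{} \<in> M"
      using z is_L2_zero[OF L2_total] subspace_0[OF subspace_W] by (simp add: M_def W_stable_def)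
    fix A B assume A: "A \<in> M" and B: "B \<in> M"
    have sA: "\<iota> (\<lambda>x. indicator A x * g x) \<in> W" if "g \<in> simple_functions (total_ring l)" "\<iota> g \<in> W" for g
      using A that by (simp add: M_def W_stable_def)
    have sB: "\<iota> (\<lambda>x. indicator B x * g x) \<in> W" if "g \<in> simple_functions (total_ring l)" "\<iota> g \<in> W" for g
      using B that by (simp add: M_def W_stable_def)
    have wA: "\<iota> (indicator A) \<in> W" and wB: "\<iota> (indicator B) \<in> W" using A B by (simp_all add: M_def)
    have diff: "\<iota> (\<lambda>x. indicator A x * g x - indicator A x * (indicator B x * g x)) \<in> W"
      and un: "\<iota> (\<lambda>x. (indicator A x * g x - indicator A x * (indicator B x * g x)) + indicator B x * g x) \<in> W"
      if g: "g \<in> simple_functions (total_ring l)" "\<iota> g \<in> W" for g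
    proof -
      note gA = indicator_mult_total[OF MT[OF A] g(1)]
      note gB = indicator_mult_total[OF MT[OF B] g(1)]
      note gAB = indicator_mult_total[OF MT[OF A] gB]
      show d: "\<iota> (\<lambda>x. indicator A x * g x - indicator A x * (indicator B x * g x)) \<in> W"
        unfolding is_L2_diff[OF L2_total gA gAB]
        by (rule subspace_diff[OF subspace_W sA[OF g] sA[OF gB sB[OF g]]])
      show "\<iota> (\<lambda>x. (indicator A x * g x - indicator A x * (indicator B x * g x)) + indicator B x * g x) \<in> W"
        unfolding is_L2_add[OF L2_total simple_functions_diff[OF gA gAB] gB]
        by (rule subspace_add[OF subspace_W d sB[OF g]])
    qed
    have eq: "(\<lambda>x. indicator (A - B) x * g x) = (\<lambda>x. indicator A x * g x - indicator A x * (indicator B x * g x))"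
      "(\<lambda>x. indicator (A \<union> B) x * g x) = (\<lambda>x. (indicator A x * g x - indicator A x * (indicator B x * g x)) + indicator B x * g x)"
      for g :: "'a \<Rightarrow> complex" by (auto simp: indicator_def fun_eq_iff)
    note iA = ind[OF A] and iB = ind[OF B]
    note iAB = indicator_mult_total[OF MT[OF A] iB]
    have eq': "indicator (A - B) = (\<lambda>x. indicator A x - indicator A x * indicator B x :: complex)"
      "indicator (A \<union> B) = (\<lambda>x. (indicator A x - indicator A x * indicator B x) + indicator B x :: complex)"
      by (auto simp: indicator_def fun_eq_iff)
    have d: "\<iota> (\<lambda>x. indicator A x - indicator A x * indicator B x) \<in> W"
      unfolding is_L2_diff[OF L2_total iA iAB]
      by (rule subspace_diff[OF subspace_W wA sA[OF iB wB]])
    have u: "\<iota> (\<lambda>x. (indicator A x - indicator A x * indicator B x) + indicator B x) \<in> W"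
      unfolding is_L2_add[OF L2_total simple_functions_diff[OF iA iAB] iB]
      by (rule subspace_add[OF subspace_W d wB])
    have "A - B \<in> total_ring l" "A \<union> B \<in> total_ring l" using MT[OF A] MT[OF B] by auto
    then have "W_stable (A - B)" "W_stable (A \<union> B)"
      unfolding W_stable_def eq using diff un by simp_all
    moreover have "\<iota> (indicator (A - B)) \<in> W" "\<iota> (indicator (A \<union> B)) \<in> W"
      unfolding eq' by (rule d, rule u)
    ultimately show "A - B \<in> M" "A \<union> B \<in> M" by (simp_all add: M_def)
  qed simp
  moreover have "onb_sets \<subseteq> M" using W_stable_onb_set onb_set_in_W by (auto simp: M_def)
  ultimately have "total_ring l \<subseteq> M" unfolding total_ring_def by (rule generated_set_ring_least)
  then show ?thesis using assms by (auto simp: M_def)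
qed

lemma W_UNIV: "W = UNIV"
proof -
  let ?R = "completed_ring (total_ring l) m" and ?\<mu> = "completed_measure (total_ring l) m"
  have "\<iota> (indicator A) \<in> W" if A: "A \<in> ?R" for A
  proof (rule W_approx)
    fix \<epsilon> :: real assume "\<epsilon> > 0"
    then obtain A1 A2 where A12: "A1 \<in> total_ring l" "A2 \<in> total_ring l" "A1 \<subseteq> A" "A \<subseteq> A2" "m (A2 - A1) < \<epsilon>"
      using A unfolding completed_ring_def by blast
    have A1: "A1 \<in> ?R" using A12(1) completed_ring_superset[OF total] by blast
    \<comment> \<open>An inner set suffices: \<open>A1 \<subseteq> A\<close> makes the squared
      distance a difference of measures, and the completed measure of \<open>A\<close> is at most
      \<open>m A2\<close>.\<close>
    have "(norm (\<iota> (indicator A) - \<iota> (indicator A1)))\<^sup>2 = ?\<mu> A - ?\<mu> A1"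
      by (rule is_L2_norm_diff[OF L2 A A1 A12(3)])
    also have "\<dots> \<le> m A2 - m A1"
      using completed_measure_le[OF total A12(2,4)] completed_measure_eq[OF total A12(1)] by simp
    also have "\<dots> = m (A2 - A1)" using A12 by (intro fa_measure_Diff[OF total, symmetric]) auto
    finally show "\<exists>y\<in>W. (norm (\<iota> (indicator A) - y))\<^sup>2 \<le> \<epsilon>"
      using A12(5) total_ring_in_W[OF A12(1)] by (intro bexI[of _ "\<iota> (indicator A1)"]) auto
  qed
  then have "\<iota> ` simple_functions ?R \<subseteq> W"
    using is_L2_in_subspace[OF L2 subset_refl subspace_W] by (intro image_subsetI) simp
  then have "closure (\<iota> ` simple_functions ?R) \<subseteq> W" by (rule closure_minimal[OF _ closed_W])
  then show ?thesis using L2 by (simp add: is_L2_def top.extremum_unique)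
qed

lemma span_H_dense: "closure (span (\<Union>e\<in>{e. is_onb e}. H e)) = UNIV"
proof -
  let ?S = "span (\<Union>e\<in>{e. is_onb e}. H e)"
  have "\<iota> f \<in> ?S" if "f \<in> simple_functions onb_sets" for f
    using that
  proof (induction rule: simple_functions_induct)
    case zero
    then show ?case by (simp add: is_L2_zero[OF L2_total] span_zero)
  next
    case (add c A g)
    obtain e where e: "is_onb e" "A \<in> onb_ring l e" using add(1) by auto
    have "scale c (\<iota> (indicator A)) \<in> H e"
      by (rule subspace_scale[OF subspace_H[OF e(1)] indicator_in_H[OF e(2)]])
    then have "scale c (\<iota> (indicator A)) \<in> ?S" using e(1) by (intro span_base) blast
    moreover have "A \<in> total_ring l" "g \<in> simple_functions (total_ring l)"
      using add onb_sets_subset simple_functions_mono[OF onb_sets_subset] by blast+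
    ultimately show ?case
      using is_L2_add_indicator[OF L2_total, of A g c] add(3) by (simp add: span_add)
  qed
  then have "\<iota> ` simple_functions onb_sets \<subseteq> ?S" by (rule image_subsetI)
  then have "W \<subseteq> closure ?S" unfolding W_def by (rule closure_mono)
  then show ?thesis using W_UNIV by auto
qed

theorem hilbert_sum_of_onb_classes:
  "\<exists>H :: (nat \<Rightarrow> 'a) set \<Rightarrow> 'h set.
    (\<forall>C\<in>onb_classes. \<forall>e\<in>C. is_L2 (onb_ring l e) (onb_measure l e) \<iota> (H C)) \<and>
    is_hilbert_sum onb_classes H"
proof -
  \<comment> \<open>A representative is chosen for each class; by \<open>H_cong\<close> every other
    representative gives the same subspace.\<close>
  define HC where "HC C = H (SOME e. e \<in> C)" for C
  have onb: "is_onb e" if "C \<in> onb_classes" "e \<in> C" for C e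
    using in_quotient_imp_subset[OF equiv_onb_rel, of C] that by (auto simp: onb_classes_def)
  have some: "(SOME e. e \<in> C) \<in> C" if "C \<in> onb_classes" for C
    using in_quotient_imp_non_empty[OF equiv_onb_rel, of C] that by (simp add: onb_classes_def some_in_eq)
  have HC: "HC C = H e" if "C \<in> onb_classes" "e \<in> C" for C e
    unfolding HC_def
    using quotient_eq_iff[OF equiv_onb_rel, of C C "SOME e. e \<in> C" e] that some[OF that(1)]
    by (intro H_cong) (simp add: onb_classes_def)
  have "(\<Union>C\<in>onb_classes. HC C) = (\<Union>e\<in>{e. is_onb e}. H e)"
  proof (intro equalityI UN_least)
    show "HC C \<subseteq> (\<Union>e\<in>{e. is_onb e}. H e)" if "C \<in> onb_classes" for C
      using HC[OF that some[OF that]] onb[OF that some[OF that]] by blast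
    show "H e \<subseteq> (\<Union>C\<in>onb_classes. HC C)" if "e \<in> {e. is_onb e}" for e
    proof -
      have C: "onb_rel `` {e} \<in> onb_classes" "e \<in> onb_rel `` {e}"
        using that onb_rel_refl by (auto simp: onb_classes_def intro: quotientI)
      then show ?thesis using HC[OF C] by blast
    qed
  qed
  then have "closure (span (\<Union>C\<in>onb_classes. HC C)) = UNIV" using span_H_dense by simp
  moreover have "ip x y = 0" if "C \<in> onb_classes" "D \<in> onb_classes" "C \<noteq> D" "x \<in> HC C" "y \<in> HC D" for C D x y
  proof -
    let ?e = "SOME e. e \<in> C" and ?f = "SOME e. e \<in> D"
    have "(?e, ?f) \<notin> onb_rel"
      using quotient_eq_iff[OF equiv_onb_rel, of C D ?e ?f] that some[OF that(1)] some[OF that(2)]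
      by (simp add: onb_classes_def)
    then show ?thesis
      using H_orthogonal onb[OF that(1) some[OF that(1)]] onb[OF that(2) some[OF that(2)]] that(4,5)
      unfolding HC_def by blast
  qed
  moreover have "subspace (HC C) \<and> closed (HC C)" if "C \<in> onb_classes" for C
    using subspace_H[OF onb[OF that some[OF that]]] closed_H
    by (simp add: HC_def)
  ultimately have "is_hilbert_sum onb_classes HC" unfolding is_hilbert_sum_def by blast
  moreover have "is_L2 (onb_ring l e) (onb_measure l e) \<iota> (HC C)" if "C \<in> onb_classes" "e \<in> C" for C e
    using L2_onb[OF onb[OF that]] HC[OF that] by simp
  ultimately show ?thesis by blast
qed

end

theorem corollary6p5:
  fixes l :: "(nat \<Rightarrow> 'a::{real_inner, polish_space}) \<Rightarrow> 'a set \<Rightarrow> real"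
    and m :: "'a set \<Rightarrow> real"
    and scale :: "complex \<Rightarrow> 'h::banach \<Rightarrow> 'h"
    and ip :: "'h \<Rightarrow> 'h \<Rightarrow> complex"
    and \<iota> :: "('a \<Rightarrow> complex) \<Rightarrow> 'h"
  assumes infinite_dim: "\<nexists>B::'a set. finite B \<and> span B = UNIV"
    and box_measures: "\<And>e. is_onb e \<Longrightarrow> is_box_measure e (l e)"
    and total_measure: "is_total_measure l m"
    and hilbert: "complex_hilbert_space scale ip"
    and L2: "complex_hilbert_space.is_L2 scale ip
      (completed_ring (total_ring l) m) (completed_measure (total_ring l) m) \<iota> UNIV"
  shows "\<exists>H :: (nat \<Rightarrow> 'a) set \<Rightarrow> 'h set.
    (\<forall>C\<in>onb_classes. \<forall>e\<in>C.
       complex_hilbert_space.is_L2 scale ip (onb_ring l e) (onb_measure l e) \<iota> (H C)) \<and>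
    complex_hilbert_space.is_hilbert_sum scale ip onb_classes H"
proof -
  interpret complex_hilbert_space scale ip by (rule hilbert)
  interpret total_measure_L2 scale ip l m \<iota>
    by unfold_locales (fact box_measures, fact total_measure, fact L2)
  show ?thesis by (rule hilbert_sum_of_onb_classes)
qed

end
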